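(* Let $X$ be a second countable locally compact Abelian group, let $\xi_1,\xi_2,\xi_3$ be independent random variables with values in $X$ with nonvanishing characteristic functions, and let $b_1,b_2,b_3$ be continuous endomorphisms of $X$. Let $L_2=b_1\xi_1+b_2\xi_2+b_3\xi_3$. Assume that either (I) $L_1=\xi_1+\xi_2+\xi_3$ and ${\rm Ker}(b_1-b_2)={\rm Ker}(b_1-b_3)={\rm Ker}(b_2-b_3)=\{0\}$, or (II) $L_1=\xi_1+\xi_2$ and ${\rm Ker}(b_1-b_2)={\rm Ker}\,b_3=\{0\}$. Then the distribution of the random vector $(L_1,L_2)$ determines the distributions of the random variables $\xi_j$ up to a shift. That is: if $\eta_1,\eta_2,\eta_3$ are independent random variables with values in $X$ with nonvanishing characteristic functions, $M_2=b_1\eta_1+b_2\eta_2+b_3\eta_3$, and $M_1=\eta_1+\eta_2+\eta_3$ in case (I), respectively $M_1=\eta_1+\eta_2$ in case (II), and if the random vectors $(L_1,L_2)$ and $(M_1,M_2)$ (with values in $X\times X$) are identically distributed, then for each $j=1,2,3$ there is $x_j\in X$ such that $\nu_j=\mu_j*E_{x_j}$, where $\mu_j$ and $\nu_j$ are the distributions of $\xi_j$ and $\eta_j$ respectively.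
   Context: For a second countable locally compact Abelian group $X$ (written additively), $Y$ denotes its character group and $(x,y)$ the value of the character $y\in Y$ at $x\in X$. The characteristic function of a (Borel) probability distribution $\mu$ on $X$ is $\hat\mu(y)=\int_X (x,y)\,d\mu(x)$, $y\in Y$; the characteristic function of a random variable is that of its distribution, and it is nonvanishing if $\hat\mu(y)\neq 0$ for all $y\in Y$. $E_x$ denotes the degenerate distribution concentrated at the point $x\in X$, and $*$ denotes convolution of distributions on $X$. Endomorphisms of $X$ are group homomorphisms $X\to X$; sums and differences of endomorphisms are taken pointwise. *)

theory Defs
  imports "HOL-Probability.Probability"
begin

text \<open>
  A second countable locally compact Abelian group is a type of sort
  \<open>{topological_ab_group_add, second_countable_topology, t2_space}\<close> (as usual, such groups
  are Hausdorff) that satisfies \<open>locally_compact_space euclidean\<close>.  By second countability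
  the Borel sigma-algebra of the product group is the product of the Borel sigma-algebras.
\<close>

definition characters :: "('a::topological_ab_group_add \<Rightarrow> complex) set" where
  "characters = {y. continuous_on UNIV y \<and> (\<forall>x. cmod (y x) = 1) \<and>
                     (\<forall>x x'. y (x + x') = y x * y x')}"

definition char_fun :: "'a::topological_ab_group_add measure \<Rightarrow> ('a \<Rightarrow> complex) \<Rightarrow> complex" where
  "char_fun \<mu> y = (\<integral>x. y x \<partial>\<mu>)"

definition nonvanishing_char_fun :: "'a::topological_ab_group_add measure \<Rightarrow> bool" where
  "nonvanishing_char_fun \<mu> \<longleftrightarrow> (\<forall>y\<in>characters. char_fun \<mu> y \<noteq> 0)"

text \<open>The library constant \<^const>\<open>convolution\<close> is restricted to ordered Euclidean spaces.\<close>

definition group_convolution ::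
  "'a::topological_ab_group_add measure \<Rightarrow> 'a measure \<Rightarrow> 'a measure" where
  "group_convolution \<mu> \<nu> = distr (\<mu> \<Otimes>\<^sub>M \<nu>) borel (\<lambda>(x, y). x + y)"

definition degenerate :: "'a::topological_ab_group_add \<Rightarrow> 'a measure" where
  "degenerate x = return borel x"

text \<open>Qualified, because \<open>additive\<close> alone denotes additivity of set functions here.\<close>

definition continuous_endomorphism :: "('a::topological_ab_group_add \<Rightarrow> 'a) \<Rightarrow> bool" where
  "continuous_endomorphism f \<longleftrightarrow> Modules.additive f \<and> continuous_on UNIV f"

definition group_kernel :: "('a::topological_ab_group_add \<Rightarrow> 'a) \<Rightarrow> 'a set" where
  "group_kernel f = {x. f x = 0}"

end

theory Submission
  imports Defs
begin

text \<open>
  Taking characteristic functions of \<open>(L\<^sub>1, L\<^sub>2)\<close> and \<open>(M\<^sub>1, M\<^sub>2)\<close> gives a functional equation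
  for the quotients \<open>F\<^sub>j\<close> of the characteristic functions of \<open>\<nu>\<^sub>j\<close> and \<open>\<mu>\<^sub>j\<close>; eliminating two of
  them by shifting along two directions leaves
  \<open>F((k \<circ> c) (l \<circ> d)) = F(k \<circ> c) F(l \<circ> d)\<close> for all characters \<open>k, l\<close> and certain injective endomorphisms
  \<open>c, d\<close>.  Read as an equality of the distributions of \<open>(c(x\<^sub>1 + x\<^sub>2), d(x\<^sub>1 + x\<^sub>3))\<close> under
  \<open>\<nu> \<otimes> \<mu> \<otimes> \<mu>\<close> and \<open>\<mu> \<otimes> \<nu> \<otimes> \<nu>\<close>, it loses \<open>c\<close> and \<open>d\<close> by injectivity, so \<open>F\<close> is a homomorphism of
  \<open>Y\<close> into the circle.  Such an \<open>F\<close> is evaluation at a point of \<open>X\<close>: otherwise the characters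
  \<open>y\<close> on one copy of \<open>X\<close> together with \<open>F(y) y\<close> on a second copy would separate the points of the
  disjoint union, and \<open>\<nu>\<close> on the first copy would equal \<open>\<mu>\<close> on the second.

  All this needs only that the characters separate the points of \<open>X\<close>.  That is proved without Haar
  measure: from sums over a maximal separated set, averaged over almost invariant finite
  sets, one obtains a pair of positive definite functions, the second a smoothing of the first,
  and an extreme pair of this kind is proportional to a continuous character.
\<close>

section \<open>Positive definite functions and extreme points\<close>

text \<open>With full duality one would say that an injective \<open>c\<close> has an adjoint with
  dense image in Y, and that a continuous homomorphism from Y to the circle is a point of X. Neither
  fact is used. Both are replaced by one uniqueness theorem: on a \<sigma>-compact space, a family
  of bounded continuous functions that separates points, contains 1 and is closed under products and
  conjugation determines finite measures. Injectivity of \<open>c\<close> and \<open>d\<close> keeps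
  the functions k(c x) l(d x') separating on X \<times> X.

  The pair of laws is dictated by the equation. If x1 has law \<nu> and x2, x3 have law \<mu>, the
  characteristic function of (x1 + x2, x1 + x3) at (k, l) takes \<nu> at kl times \<mu> at k times
  \<mu> at l; its quotient by the same expression with \<mu> and \<nu> exchanged is F(kl) / (F(k)
  F(l)).

  For the existence of characters the tool is the order in which f lies below g when g - f is
  positive definite. It survives pointwise limits and convex decompositions, and evaluated at 0 for
  second differences it bounds 1 - Re y(a). This is how a point that is extreme only in the
  pointwise topology can be continuous.\<close>

definition smear ::
  "'s set \<Rightarrow> ('s \<Rightarrow> complex) \<Rightarrow> ('s \<Rightarrow> 'a::ab_group_add) \<Rightarrow> ('a \<Rightarrow> complex) \<Rightarrow> 'a \<Rightarrow> complex" where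
  "smear S c p f x = (\<Sum>s\<in>S. \<Sum>t\<in>S. c s * cnj (c t) * f (x + p s - p t))"

text \<open>\<open>smear\<close> convolves \<open>f\<close> with \<open>m * m~\<close> for a
  finitely supported complex measure \<open>m\<close>, where \<open>m~\<close> is its reflected
  conjugate; the value at 0 is the usual quadratic form. Asking for a nonnegative real among the
  complex numbers also encodes hermitian symmetry.\<close>

definition pos_def :: "('a::ab_group_add \<Rightarrow> complex) \<Rightarrow> bool" where
  "pos_def f \<longleftrightarrow> (\<forall>(n::nat) c x. smear {..<n} c x f 0 \<in> \<real>\<^sub>\<ge>\<^sub>0)"

lemma smear_reindex:
  assumes "bij_betw h T S"
  shows "smear S c p f x = smear T (c \<circ> h) (p \<circ> h) f x"
  unfolding smear_def by (simp add: sum.reindex_bij_betw[OF assms, symmetric])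

lemma pos_def_smear_nonneg:
  assumes "pos_def f" "finite S"
  shows "smear S c p f 0 \<in> \<real>\<^sub>\<ge>\<^sub>0"
proof -
  obtain h where "bij_betw h {..<card S} S"
    using assms(2) ex_bij_betw_nat_finite[of S] by (auto simp: atLeast0LessThan)
  then show ?thesis
    using assms(1) by (simp add: smear_reindex pos_def_def)
qed

text \<open>Convolving with \<open>m1 * m1~\<close> and then with \<open>m2 * m2~\<close> is
  convolving with \<open>m * m~\<close> for \<open>m = m1 * m2\<close>. Hence smears preserve
  positive definiteness and, the group being Abelian, commute.\<close>

lemma smear_smear:
  "smear S c p (smear T d q f) x =
     smear (S \<times> T) (\<lambda>(s, t). c s * d t) (\<lambda>(s, t). p s + q t) f x"
proof -
  have "smear S c p (smear T d q f) x =
      (\<Sum>s\<in>S. \<Sum>s'\<in>S. \<Sum>t\<in>T. \<Sum>t'\<in>T.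
         (c s * d t) * cnj (c s' * d t') * f (x + (p s + q t) - (p s' + q t')))"
    unfolding smear_def sum_distrib_left by (simp add: algebra_simps)
  also have "\<dots> = (\<Sum>s\<in>S. \<Sum>t\<in>T. \<Sum>s'\<in>S. \<Sum>t'\<in>T.
         (c s * d t) * cnj (c s' * d t') * f (x + (p s + q t) - (p s' + q t')))"
    by (intro sum.cong refl sum.swap)
  finally show ?thesis
    unfolding smear_def by (simp add: sum.cartesian_product')
qed

lemma smear_commute:
  "smear S c p (smear T d q f) x = smear T d q (smear S c p f) x"
proof -
  have "bij_betw prod.swap (T \<times> S) (S \<times> T)"
    by (auto simp: bij_betw_def product_swap)
  then show ?thesis
    by (simp add: smear_smear smear_reindex comp_def case_prod_unfold mult.commute add.commute)
qed

lemma pos_def_smear: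
  assumes "pos_def f" "finite S"
  shows "pos_def (smear S c p f)"
  unfolding pos_def_def smear_smear
  using assms by (auto intro!: pos_def_smear_nonneg)

lemma smear_diff: "smear S c p (\<lambda>x. f x - g x) x = smear S c p f x - smear S c p g x"
  by (simp add: smear_def sum_subtractf algebra_simps)

lemma smear_cmult: "smear S c p (\<lambda>x. k * f x) x = k * smear S c p f x"
  by (simp add: smear_def sum_distrib_left algebra_simps)

lemma pos_def_zero: 
  assumes "pos_def f"
  shows "f 0 \<in> \<real>\<^sub>\<ge>\<^sub>0"
  using pos_def_smear_nonneg[OF assms, of "{()}" "\<lambda>_. 1" "\<lambda>_. 0"] by (simp add: smear_def)

lemma pos_def_two:
  assumes "pos_def f"
  shows "complex_of_real ((cmod c)\<^sup>2) * f 0 + f 0 + c * f x + cnj c * f (- x) \<in> \<real>\<^sub>\<ge>\<^sub>0"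
  using pos_def_smear_nonneg[OF assms, of UNIV "\<lambda>b. if b then c else 1" "\<lambda>b. if b then x else 0"]
  by (simp add: smear_def UNIV_bool complex_norm_square algebra_simps del: of_real_power)

lemma pos_def_minus:
  assumes "pos_def f"
  shows "f (- x) = cnj (f x)"
proof -
  have "f 0 \<in> \<real>\<^sub>\<ge>\<^sub>0" by (rule pos_def_zero[OF assms])
  then show ?thesis
    \<comment> \<open>Weight 1 makes \<open>f x + f (- x)\<close> real, weight \<open>\<i>\<close>
      makes \<open>\<i> * (f x - f (- x))\<close> real.\<close>
    using pos_def_two[OF assms, of 1 x] pos_def_two[OF assms, of \<i> x]
    by (auto simp: complex_nonneg_Reals_iff complex_eq_iff)
qed

lemma pos_def_bound:
  assumes "pos_def f"
  shows "cmod (f x) \<le> Re (f 0)"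
proof (cases "f x = 0")
  case True
  then show ?thesis using pos_def_zero[OF assms] by (auto simp: complex_nonneg_Reals_iff)
next
  case False
  \<comment> \<open>The phase that turns \<open>c * f x\<close> into \<open>- cmod (f x)\<close>,
    the worst case of the two-point form.\<close>
  define c where "c = - cnj (f x) / cmod (f x)"
  have c: "cmod c = 1" "c * f x = - cmod (f x)"
    using False complex_norm_square[of "f x"]
    by (auto simp: c_def norm_divide power2_eq_square field_simps)
  have "cnj c * f (- x) = cnj (c * f x)"
    by (simp add: pos_def_minus[OF assms])
  then have "2 * f 0 - 2 * cmod (f x) \<in> \<real>\<^sub>\<ge>\<^sub>0"
    using pos_def_two[OF assms, of c x] c by (simp add: algebra_simps)
  then show ?thesis by (auto simp: complex_nonneg_Reals_iff)
qed

text \<open>Tested against another smear, the claim becomes one about the value at 0 of the positive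
  definite function \<open>Q\<close>, because smears commute. There it follows from
  \<open>cmod (Q z) \<le> Re (Q 0)\<close> and the total weight \<open>W\<close>.\<close>

lemma pos_def_smear_le:
  assumes f: "pos_def f" and S: "finite S" and W: "(\<Sum>s\<in>S. cmod (c s)) \<le> W"
  shows "pos_def (\<lambda>x. complex_of_real (W\<^sup>2) * f x - smear S c p f x)"
  unfolding pos_def_def smear_diff smear_cmult
proof (intro allI)
  fix n :: nat and d and q :: "nat \<Rightarrow> 'a"
  define Q where "Q = smear {..<n} d q f"
  have Q: "pos_def Q"
    unfolding Q_def using f by (rule pos_def_smear) simp
  have Q0: "Q 0 \<in> \<real>\<^sub>\<ge>\<^sub>0" and sQ: "smear S c p Q 0 \<in> \<real>\<^sub>\<ge>\<^sub>0"
    using pos_def_zero[OF Q] pos_def_smear_nonneg[OF Q S] by auto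
  have W0: "0 \<le> (\<Sum>s\<in>S. cmod (c s))"
    by (simp add: sum_nonneg)
  have "cmod (smear S c p Q 0) \<le> (\<Sum>s\<in>S. \<Sum>t\<in>S. cmod (c s) * cmod (c t) * Re (Q 0))"
    unfolding smear_def
    by (intro sum_norm_le) (auto simp: norm_mult intro!: mult_left_mono pos_def_bound[OF Q])
  also have "\<dots> = (\<Sum>s\<in>S. cmod (c s))\<^sup>2 * Re (Q 0)"
    by (subst power2_eq_square, subst sum_product, simp add: sum_distrib_right)
  also have "\<dots> \<le> W\<^sup>2 * Re (Q 0)"
    using W W0 Q0 by (intro mult_right_mono power_mono) (auto simp: complex_nonneg_Reals_iff)
  finally have "Re (smear S c p Q 0) \<le> W\<^sup>2 * Re (Q 0)"
    using complex_Re_le_cmod order_trans by blast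
  then have "complex_of_real (W\<^sup>2) * Q 0 - smear S c p Q 0 \<in> \<real>\<^sub>\<ge>\<^sub>0"
    using Q0 sQ by (auto simp: complex_nonneg_Reals_iff)
  then show "complex_of_real (W\<^sup>2) * smear {..<n} d q f 0 - smear {..<n} d q (smear S c p f) 0 \<in> \<real>\<^sub>\<ge>\<^sub>0"
    unfolding Q_def by (subst smear_commute)
qed

text \<open>Bauer's maximum principle for the product topology. Among the closed faces inside the
  set where \<open>l\<close> is maximal, a minimal one is a single point: otherwise maximising some
  coordinate over it would give a smaller face.\<close>

lemma extreme_maximizer_exists:
  fixes S :: "('i \<Rightarrow> 'b::euclidean_space) set" and l :: "('i \<Rightarrow> 'b) \<Rightarrow> real"
  assumes S: "compact S" "S \<noteq> {}" and l: "continuous_on UNIV l"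
    and aff: "\<And>u v t. l (\<lambda>i. (1 - t) *\<^sub>R u i + t *\<^sub>R v i) = (1 - t) * l u + t * l v"
  obtains e where "e \<in> S" "\<And>u. u \<in> S \<Longrightarrow> l u \<le> l e"
    "\<And>u v t. u \<in> S \<Longrightarrow> v \<in> S \<Longrightarrow> 0 < t \<Longrightarrow> t < 1 \<Longrightarrow>
       e = (\<lambda>i. (1 - t) *\<^sub>R u i + t *\<^sub>R v i) \<Longrightarrow> u = e \<and> v = e"
proof -
  define face where "face F \<longleftrightarrow> (\<exists>C. closed C \<and> S \<inter> C = F) \<and> (\<exists>z. z \<in> F) \<and>
    (\<forall>u\<in>S. \<forall>v\<in>S. \<forall>t. 0 < t \<and> t < 1 \<and> (\<lambda>i. (1 - t) *\<^sub>R u i + t *\<^sub>R v i) \<in> F \<longrightarrow> u \<in> F \<and> v \<in> F)" for F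
  have face_closed: "\<exists>C. closed C \<and> S \<inter> C = F" and face_ne: "\<exists>z. z \<in> F"
    and face_ext: "\<And>u v t. u \<in> S \<Longrightarrow> v \<in> S \<Longrightarrow> 0 < t \<Longrightarrow> t < 1 \<Longrightarrow>
       (\<lambda>i. (1 - t) *\<^sub>R u i + t *\<^sub>R v i) \<in> F \<Longrightarrow> u \<in> F \<and> v \<in> F"
    if "face F" for F
    using that unfolding face_def by blast+
  \<comment> \<open>At a maximum \<open>m\<close> of an affine function, a proper convex combination
    can reach \<open>m\<close> only if both end points do; so the maximising part of a face is again
    a face.\<close>
  have sub: "\<exists>m. face {w \<in> F. m \<le> g w} \<and> (\<forall>w\<in>F. g w \<le> m)"
    if F: "face F" and g: "continuous_on UNIV g"
      and gaff: "\<And>u v t. g (\<lambda>i. (1 - t) *\<^sub>R u i + t *\<^sub>R v i) = (1 - t) * g u + t * g v"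
    for F and g :: "('i \<Rightarrow> 'b) \<Rightarrow> real"
  proof -
    obtain C where C: "closed C" "S \<inter> C = F" using face_closed[OF F] by blast
    have "F \<noteq> {}" using face_ne[OF F] by blast
    have "compact F" using compact_Int_closed[OF S(1) C(1)] C(2) by simp
    from continuous_attains_sup[OF this \<open>F \<noteq> {}\<close> continuous_on_subset[OF g]]
    obtain z where z: "z \<in> F" "\<And>w. w \<in> F \<Longrightarrow> g w \<le> g z" by auto
    have cl: "closed {w. g z \<le> g w}"
      using g by (intro closed_Collect_le) auto
    have "face {w \<in> F. g z \<le> g w}"
      unfolding face_def
    proof (intro conjI ballI allI impI)
      show "\<exists>D. closed D \<and> S \<inter> D = {w \<in> F. g z \<le> g w}"
        by (rule exI[of _ "C \<inter> {w. g z \<le> g w}"]) (use C cl in auto)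
      show "\<exists>w. w \<in> {w \<in> F. g z \<le> g w}" using z by auto
      fix u v t assume uv: "u \<in> S" "v \<in> S"
        "0 < t \<and> t < 1 \<and> (\<lambda>i. (1 - t) *\<^sub>R u i + t *\<^sub>R v i) \<in> {w \<in> F. g z \<le> g w}"
      then have uvF: "u \<in> F" "v \<in> F" using face_ext[OF F] by blast+
      have le: "g u \<le> g z" "g v \<le> g z" and ge: "g z \<le> (1 - t) * g u + t * g v"
        using uvF z uv by (auto simp: gaff)
      have "(1 - t) * (g z - g u) + t * (g z - g v) \<le> 0" using ge by (simp add: algebra_simps)
      moreover have "0 \<le> (1 - t) * (g z - g u)" "0 \<le> t * (g z - g v)"
        using le uv by auto
      ultimately have "(1 - t) * (g z - g u) = 0" "t * (g z - g v) = 0" by linarith+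
      then have "g u = g z" "g v = g z" using uv by auto
      then show "u \<in> {w \<in> F. g z \<le> g w}" "v \<in> {w \<in> F. g z \<le> g w}" using uvF by auto
    qed
    then show ?thesis using z by blast
  qed
  have "face S"
    unfolding face_def using S by (auto intro!: exI[of _ UNIV])
  from sub[OF this l aff] obtain m where m: "face {w \<in> S. m \<le> l w}" "\<And>w. w \<in> S \<Longrightarrow> l w \<le> m"
    by blast
  define F0 where "F0 = {w \<in> S. m \<le> l w}"
  \<comment> \<open>Complements, because Zorn's lemma is applied in the form that yields maximal
    sets while a minimal face is wanted.\<close>
  define A where "A = uminus ` {F. face F \<and> F \<subseteq> F0}"
  have "\<exists>M\<in>A. \<forall>X\<in>A. M \<subseteq> X \<longrightarrow> X = M"
  proof (rule subset_Zorn_nonempty)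
    show "A \<noteq> {}" unfolding A_def F0_def using m(1) by blast
    fix \<C> assume ne: "\<C> \<noteq> {}" and ch: "subset.chain A \<C>"
    define FF where "FF = uminus ` \<C>"
    have FF: "FF \<noteq> {}" "\<And>F. F \<in> FF \<Longrightarrow> face F \<and> F \<subseteq> F0"
    proof -
      show "FF \<noteq> {}" using ne unfolding FF_def by simp
      fix F assume "F \<in> FF"
      then have "- F \<in> A" using ch unfolding FF_def subset.chain_def by auto
      then show "face F \<and> F \<subseteq> F0" unfolding A_def by (auto simp: image_iff)
    qed
    have tot: "F \<subseteq> G \<or> G \<subseteq> F" if "F \<in> FF" "G \<in> FF" for F G
      using that ch unfolding FF_def subset.chain_def by blast
    have fin: "\<exists>F\<in>FF. F \<subseteq> \<Inter> \<F>" if "finite \<F>" "\<F> \<subseteq> FF" for \<F>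
      using that
    proof (induction \<F> rule: finite_induct)
      case empty then show ?case using FF by auto
    next
      case (insert G \<F>)
      then obtain F where "F \<in> FF" "F \<subseteq> \<Inter> \<F>" "G \<in> FF" by auto
      then show ?case using tot[of F G] by auto
    qed
    have "\<forall>F\<in>FF. \<exists>C. closed C \<and> S \<inter> C = F"
      using FF(2) face_closed by blast
    from bchoice[OF this] obtain C where "\<forall>F\<in>FF. closed (C F) \<and> S \<inter> C F = F" ..
    then have C: "\<And>F. F \<in> FF \<Longrightarrow> closed (C F)" "\<And>F. F \<in> FF \<Longrightarrow> S \<inter> C F = F" by simp_all
    \<comment> \<open>Finitely many faces of a chain have a smallest one, which is nonempty;
      compactness of \<open>S\<close> extends this to the whole chain.\<close>
    have "S \<inter> \<Inter> (C ` FF) \<noteq> {}"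
    proof (rule compact_imp_fip[OF S(1)])
      fix T assume "T \<in> C ` FF" then show "closed T" using C by auto
    next
      fix \<G> assume "finite \<G>" "\<G> \<subseteq> C ` FF"
      then obtain \<F> where \<F>: "finite \<F>" "\<F> \<subseteq> FF" "\<G> = C ` \<F>"
        by (meson finite_subset_image)
      obtain F where F: "F \<in> FF" "F \<subseteq> \<Inter> \<F>" using fin[OF \<F>(1,2)] by (elim bexE)
      obtain z where z: "z \<in> F" using face_ne FF(2)[OF F(1)] by (meson)
      have "z \<in> S" using C(2)[OF F(1)] z by (metis IntD1)
      moreover have "z \<in> C G" if G: "G \<in> \<F>" for G
      proof -
        have "z \<in> G" using F(2) z G by (meson InterD subsetD)
        moreover have "S \<inter> C G = G" using C(2) \<F>(2) G by (meson subsetD)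
        ultimately show ?thesis by (metis IntD2)
      qed
      ultimately have "z \<in> S \<inter> \<Inter> \<G>" unfolding \<F>(3) by simp
      then show "S \<inter> \<Inter> \<G> \<noteq> {}" by (metis empty_iff)
    qed
    moreover have eq: "\<Inter> FF = S \<inter> \<Inter> (C ` FF)"
    proof (intro set_eqI iffI)
      fix z assume z: "z \<in> \<Inter> FF"
      obtain F where "F \<in> FF" using FF(1) by (meson ex_in_conv)
      then have "z \<in> S" using z C(2) by (metis IntD1 InterD)
      moreover have "z \<in> C F" if "F \<in> FF" for F using z C(2)[OF that] that by (metis IntD2 InterD)
      ultimately show "z \<in> S \<inter> \<Inter> (C ` FF)" by simp
    next
      fix z assume "z \<in> S \<inter> \<Inter> (C ` FF)"
      then have "z \<in> S \<inter> C F" if "F \<in> FF" for F using that by simp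
      then show "z \<in> \<Inter> FF" using C(2) by simp
    qed
    ultimately have ne': "\<Inter> FF \<noteq> {}" by simp
    have "face (\<Inter> FF)"
      unfolding face_def
    proof (intro conjI ballI allI impI)
      show "\<exists>D. closed D \<and> S \<inter> D = \<Inter> FF"
        using eq C(1) by (intro exI[of _ "\<Inter> (C ` FF)"]) auto
      show "\<exists>z. z \<in> \<Inter> FF" using ne' by blast
      fix u v t assume "u \<in> S" "v \<in> S"
        "0 < t \<and> t < 1 \<and> (\<lambda>i. (1 - t) *\<^sub>R u i + t *\<^sub>R v i) \<in> \<Inter> FF"
      then show "u \<in> \<Inter> FF" "v \<in> \<Inter> FF" using FF(2) face_ext by blast+
    qed
    moreover have "\<Inter> FF \<subseteq> F0" using FF by blast
    ultimately have "- \<Inter> FF \<in> A" unfolding A_def by blast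
    also have "- \<Inter> FF = \<Union> \<C>" unfolding FF_def by auto
    finally show "\<Union> \<C> \<in> A" .
  qed
  then obtain M where M: "M \<in> A" "\<forall>X\<in>A. M \<subseteq> X \<longrightarrow> X = M"
    by (elim bexE)
  then obtain F where F: "face F" "F \<subseteq> F0" "M = - F" unfolding A_def by (elim imageE CollectE conjE)
  have min: "G = F" if "face G" "G \<subseteq> F" for G
  proof -
    have "- G \<in> A" unfolding A_def using that F(2) by (intro imageI CollectI conjI) simp_all
    then have "- G = - F" using M(2)[rule_format, of "- G"] F(3) that(2) by simp
    then show ?thesis by simp
  qed
  have single: "u = v" if uv: "u \<in> F" "v \<in> F" for u v
  proof (rule ccontr)
    assume "u \<noteq> v"
    then obtain i where "u i \<noteq> v i" by auto
    then obtain b where b: "u i \<bullet> b \<noteq> v i \<bullet> b" using euclidean_eq_iff by metis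
    have "continuous_on UNIV (\<lambda>w::'i \<Rightarrow> 'b. w i \<bullet> b)"
      by (intro continuous_intros continuous_on_product_coordinates)
    from sub[OF F(1) this] obtain m' where "face {w \<in> F. m' \<le> w i \<bullet> b}" "\<forall>w\<in>F. w i \<bullet> b \<le> m'"
      by (auto simp: inner_add_left)
    moreover from this have "{w \<in> F. m' \<le> w i \<bullet> b} = F" by (intro min) auto
    ultimately have "w i \<bullet> b = m'" if "w \<in> F" for w using that by force
    then show False using uv b by simp
  qed
  obtain e where e: "e \<in> F" using face_ne[OF F(1)] by blast
  then have "F = {e}" using single by blast
  show ?thesis
  proof
    show "e \<in> S" using e F unfolding F0_def by auto
    show "l u \<le> l e" if "u \<in> S" for u using m(2)[OF that] e F unfolding F0_def by auto
    show "u = e \<and> v = e" if "u \<in> S" "v \<in> S" "0 < t" "t < 1" "e = (\<lambda>i. (1 - t) *\<^sub>R u i + t *\<^sub>R v i)" for u v t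
      using face_ext[OF F(1) that(1-4)] that(5) \<open>F = {e}\<close> by blast
  qed
qed

text \<open>The two-point smear with weight 1 at 0 and \<open>c\<close> at \<open>a\<close>. For
  \<open>c = -1\<close> it is the negated symmetric second difference. For unimodular
  \<open>c\<close> the twists by \<open>c\<close> and \<open>- c\<close> add up to
  \<open>4 * f\<close>, which supplies the convex decompositions used against extremality.\<close>

abbreviation twist :: "complex \<Rightarrow> 'a::ab_group_add \<Rightarrow> ('a \<Rightarrow> complex) \<Rightarrow> 'a \<Rightarrow> complex" where
  "twist c a \<equiv> smear UNIV (\<lambda>b. if b then c else 1) (\<lambda>b. if b then a else 0)"

lemma twist_eq:
  assumes "cmod c = 1"
  shows "twist c a f x = 2 * f x + c * f (x + a) + cnj c * f (x - a)"
proof -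
  have "c * cnj c = 1" using assms by (simp add: complex_norm_square[symmetric])
  then show ?thesis by (simp add: smear_def UNIV_bool algebra_simps)
qed

section \<open>Dominated pairs and their extreme points\<close>

lemma closed_pos_def:
  assumes "\<And>x. continuous_on UNIV (\<lambda>u. F u x)"
  shows "closed {u. pos_def (F u)}"
proof -
  have "closed ((\<lambda>u. smear {..<n} c x (F u) 0) -` \<real>\<^sub>\<ge>\<^sub>0)" for n :: nat and c x
    unfolding smear_def
    by (intro closed_vimage closed_nonneg_Reals_complex continuous_intros assms)
  then have "closed (\<Inter>(n::nat). \<Inter>c. \<Inter>x. (\<lambda>u. smear {..<n} c x (F u) 0) -` \<real>\<^sub>\<ge>\<^sub>0)"
    by (intro closed_INT ballI)
  also have "(\<Inter>(n::nat). \<Inter>c. \<Inter>x. (\<lambda>u. smear {..<n} c x (F u) 0) -` \<real>\<^sub>\<ge>\<^sub>0) = {u. pos_def (F u)}"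
    by (auto simp: pos_def_def)
  finally show ?thesis .
qed

lemma compact_PiE_UNIV:
  fixes K :: "'i \<Rightarrow> 'b::topological_space set"
  assumes "\<And>i. compact (K i)"
  shows "compact (PiE UNIV K)"
  using assms compactin_PiE[of "\<lambda>_. euclidean" UNIV K] by (simp add: euclidean_product_topology)

text \<open>Gelfand and Raikov obtain characters as extreme positive definite functions. Extreme points
  of a set of functions on the discrete group may be discontinuous; the second component \<open>\<rho>\<close> and
  the domination of its second differences are stable under \<^const>\<open>smear\<close> and keep the extreme
  point continuous.\<close>

definition dominated_pair ::
  "real \<Rightarrow> ('a \<times> real) set \<Rightarrow> ('a::ab_group_add \<Rightarrow> complex) \<Rightarrow> ('a \<Rightarrow> complex) \<Rightarrow> bool" where
  "dominated_pair C E \<phi> \<rho> \<longleftrightarrow> pos_def \<phi> \<and> pos_def \<rho> \<and> pos_def (\<lambda>x. complex_of_real C * \<phi> x - \<rho> x) \<and>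
     (\<forall>(a, \<eta>)\<in>E. pos_def (\<lambda>x. complex_of_real \<eta> * \<phi> x - twist (-1) a \<rho> x))"

text \<open>Every condition says that a linear expression in the pair is positive definite, and
  these expressions commute with smears.\<close>

lemma dominated_pair_smear:
  assumes "dominated_pair C E \<phi> \<rho>" "finite S"
  shows "dominated_pair C E (smear S c p \<phi>) (smear S c p \<rho>)"
proof -
  have "pos_def (smear S c p (\<lambda>x. complex_of_real C * \<phi> x - \<rho> x))"
    "\<forall>(a, \<eta>)\<in>E. pos_def (smear S c p (\<lambda>x. complex_of_real \<eta> * \<phi> x - twist (-1) a \<rho> x))"
    using assms unfolding dominated_pair_def by (auto intro!: pos_def_smear)
  moreover have "smear S c p (\<lambda>x. complex_of_real C * \<phi> x - \<rho> x) =
      (\<lambda>x. complex_of_real C * smear S c p \<phi> x - smear S c p \<rho> x)"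
    by (rule ext) (simp add: smear_diff smear_cmult)
  moreover have "smear S c p (\<lambda>x. complex_of_real \<eta> * \<phi> x - twist (-1) a \<rho> x) =
      (\<lambda>x. complex_of_real \<eta> * smear S c p \<phi> x - twist (-1) a (smear S c p \<rho>) x)" for \<eta> a
    by (rule ext) (simp only: smear_diff smear_cmult smear_commute[of S])
  ultimately show ?thesis
    using assms unfolding dominated_pair_def by (auto intro!: pos_def_smear)
qed

text \<open>Scaling by \<open>r\<close> is the one-point smear of weight
  \<open>sqrt r\<close>.\<close>

lemma dominated_pair_cmult:
  assumes "dominated_pair C E \<phi> \<rho>" "0 \<le> r"
  shows "dominated_pair C E (\<lambda>x. complex_of_real r * \<phi> x) (\<lambda>x. complex_of_real r * \<rho> x)"
proof -
  have "smear {()} (\<lambda>_. complex_of_real (sqrt r)) (\<lambda>_. 0) f = (\<lambda>x. complex_of_real r * f x)" for f :: "'a \<Rightarrow> complex"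
    using assms(2) by (auto simp: smear_def simp flip: of_real_mult)
  then show ?thesis
    using dominated_pair_smear[OF assms(1), of "{()}" "\<lambda>_. complex_of_real (sqrt r)" "\<lambda>_. 0"] by simp
qed

lemma dominated_pair_zero:
  assumes "dominated_pair C E \<phi> \<rho>" "\<phi> 0 = 0"
  shows "\<phi> x = 0" "\<rho> x = 0"
proof -
  have p: "pos_def \<phi>" "pos_def \<rho>" "pos_def (\<lambda>x. complex_of_real C * \<phi> x - \<rho> x)"
    using assms unfolding dominated_pair_def by auto
  show "\<phi> x = 0" using pos_def_bound[OF p(1), of x] assms by simp
  have "Re (\<rho> 0) \<le> 0" using pos_def_zero[OF p(3)] assms by (auto simp: complex_nonneg_Reals_iff)
  then show "\<rho> x = 0" using pos_def_bound[OF p(2), of x] by (metis norm_le_zero_iff order_trans)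
qed

text \<open>The twists by \<open>c\<close> and \<open>- c\<close> split the pair into two dominated
  pairs, so extremality makes each twist a real multiple of the pair, with the same factor for both
  components. The cases \<open>c = 1\<close> and \<open>c = \<i>\<close> together recover
  translation by \<open>a\<close> itself as a multiplication.\<close>

lemma extreme_dominated_pair:
  assumes e: "dominated_pair C E \<phi> \<rho>" "\<phi> 0 = 1"
    and ext: "\<And>\<phi>1 \<rho>1 \<phi>2 \<rho>2 t. dominated_pair C E \<phi>1 \<rho>1 \<Longrightarrow> \<phi>1 0 = 1 \<Longrightarrow>
       dominated_pair C E \<phi>2 \<rho>2 \<Longrightarrow> \<phi>2 0 = 1 \<Longrightarrow> 0 < t \<Longrightarrow> t < 1 \<Longrightarrow>
       (\<And>x. \<phi> x = complex_of_real (1 - t) * \<phi>1 x + complex_of_real t * \<phi>2 x) \<Longrightarrow>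
       (\<And>x. \<rho> x = complex_of_real (1 - t) * \<rho>1 x + complex_of_real t * \<rho>2 x) \<Longrightarrow> \<phi>1 = \<phi> \<and> \<rho>1 = \<rho>"
  shows "\<phi> (x + a) = \<phi> a * \<phi> x" "\<rho> (x + a) = \<phi> a * \<rho> x"
proof -
  have tw: "\<exists>s::real. \<forall>x. twist c a \<phi> x = s * \<phi> x \<and> twist c a \<rho> x = s * \<rho> x" if c: "cmod c = 1" for c
  proof -
    have d: "dominated_pair C E (twist c' a \<phi>) (twist c' a \<rho>)" for c'
      using e by (intro dominated_pair_smear) auto
    have r: "\<exists>r\<ge>0. twist c' a \<phi> 0 = complex_of_real r" for c'
    proof -
      have "twist c' a \<phi> 0 \<in> \<real>\<^sub>\<ge>\<^sub>0"
        using d[of c'] pos_def_zero unfolding dominated_pair_def by blast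
      then show ?thesis by (auto simp: nonneg_Reals_def)
    qed
    obtain r where r1: "r \<ge> 0" "twist c a \<phi> 0 = complex_of_real r" using r by blast
    obtain s where s1: "s \<ge> 0" "twist (-c) a \<phi> 0 = complex_of_real s" using r by blast
    have four: "twist c a f x + twist (-c) a f x = 4 * f x" for f x
      using c by (simp add: twist_eq)
    have "complex_of_real (r + s) = 4" using four[of \<phi> 0] e r1 s1 by simp
    then have rs: "r + s = 4" by (metis of_real_eq_iff of_real_numeral)
    \<comment> \<open>A twist with value 0 at 0 cannot be normalised, but then it vanishes
      identically and the other twist is 4 times the pair.\<close>
    consider "r = 0" | "s = 0" | "r > 0" "s > 0" using r1 s1 by linarith
    then show ?thesis
    proof cases
      case 1
      then show ?thesis using dominated_pair_zero[OF d[of c]] r1 by (intro exI[of _ 0]) auto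
    next
      case 2
      then have "twist (-c) a \<phi> x = 0" "twist (-c) a \<rho> x = 0" for x
        using dominated_pair_zero[OF d[of "-c"]] s1 by auto
      then have "twist c a \<phi> x = 4 * \<phi> x" "twist c a \<rho> x = 4 * \<rho> x" for x
        using four[of \<phi> x] four[of \<rho> x] by simp_all
      then show ?thesis by (intro exI[of _ 4]) auto
    next
      case 3
      define \<phi>1 \<rho>1 \<phi>2 \<rho>2 where defs: "\<phi>1 = (\<lambda>x. complex_of_real (1/r) * twist c a \<phi> x)"
        "\<rho>1 = (\<lambda>x. complex_of_real (1/r) * twist c a \<rho> x)"
        "\<phi>2 = (\<lambda>x. complex_of_real (1/s) * twist (-c) a \<phi> x)"
        "\<rho>2 = (\<lambda>x. complex_of_real (1/s) * twist (-c) a \<rho> x)"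
      have dd: "dominated_pair C E \<phi>1 \<rho>1" "dominated_pair C E \<phi>2 \<rho>2"
        unfolding defs using 3 by (intro dominated_pair_cmult d; simp)+
      have comb: "f x = complex_of_real (1 - s/4) * (complex_of_real (1/r) * twist c a f x) +
          complex_of_real (s/4) * (complex_of_real (1/s) * twist (-c) a f x)" for f x
      proof -
        have "1 - s/4 = r/4" using rs by simp
        moreover have "complex_of_real (q/4) * (complex_of_real (1/q) * z) = z / 4" if "q > 0" for q z
          using that by simp
        ultimately show ?thesis using four[of f x] 3 by (simp only: add_divide_distrib[symmetric]) simp
      qed
      have "\<phi>1 = \<phi> \<and> \<rho>1 = \<rho>"
      proof (rule ext[OF dd(1) _ dd(2)])
        show "\<phi>1 0 = 1" "\<phi>2 0 = 1" unfolding defs using 3 r1 s1 by auto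
        show "0 < s/4" "s/4 < 1" using 3 rs by auto
        show "\<phi> x = complex_of_real (1 - s/4) * \<phi>1 x + complex_of_real (s/4) * \<phi>2 x"
          "\<rho> x = complex_of_real (1 - s/4) * \<rho>1 x + complex_of_real (s/4) * \<rho>2 x" for x
          unfolding defs by (rule comb)+
      qed
      then have "\<phi> x = complex_of_real (1/r) * twist c a \<phi> x" "\<rho> x = complex_of_real (1/r) * twist c a \<rho> x" for x
        unfolding defs by (metis)+
      then show ?thesis using 3 by (intro exI[of _ r]) (simp add: field_simps)
    qed
  qed
  obtain s1 where s1: "\<And>x. twist 1 a \<phi> x = complex_of_real s1 * \<phi> x" "\<And>x. twist 1 a \<rho> x = complex_of_real s1 * \<rho> x"
    using tw[of 1] by auto
  obtain s2 where s2: "\<And>x. twist \<i> a \<phi> x = complex_of_real s2 * \<phi> x" "\<And>x. twist \<i> a \<rho> x = complex_of_real s2 * \<rho> x"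
    using tw[of \<i>] by auto
  \<comment> \<open>The twists give \<open>f (x + a) + f (x - a) = (s1 - 2) * f x\<close> and
    \<open>\<i> * (f (x + a) - f (x - a)) = (s2 - 2) * f x\<close>; solving for
    \<open>f (x + a)\<close> yields this factor.\<close>
  define g where "g = ((complex_of_real s1 - 2) - \<i> * (complex_of_real s2 - 2)) / 2"
  have g: "f (x + a) = g * f x" if "\<And>x. twist 1 a f x = complex_of_real s1 * f x"
    "\<And>x. twist \<i> a f x = complex_of_real s2 * f x" for f x
  proof -
    have 1: "2 * f x + f (x + a) + f (x - a) = complex_of_real s1 * f x"
      using that(1)[of x] twist_eq[of 1 a f x] by simp
    have 2: "2 * f x + \<i> * f (x + a) - \<i> * f (x - a) = complex_of_real s2 * f x"
      using that(2)[of x] by (simp add: twist_eq)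
    have alg: "2 * p = 2 * (((k1 - 2) - \<i> * (k2 - 2)) / 2 * q)"
      if "2 * q + p + m = k1 * q" "2 * q + \<i> * p - \<i> * m = k2 * q" for p q m k1 k2 :: complex
    proof -
      have "2 * p = (2 * q + p + m) - \<i> * (2 * q + \<i> * p - \<i> * m) - 2 * q + 2 * \<i> * q"
        by (simp add: algebra_simps)
      also have "\<dots> = k1 * q - \<i> * (k2 * q) - 2 * q + 2 * \<i> * q" unfolding that ..
      also have "\<dots> = 2 * (((k1 - 2) - \<i> * (k2 - 2)) / 2 * q)" by (simp add: field_simps)
      finally show ?thesis .
    qed
    show ?thesis using alg[OF 1 2] unfolding g_def by (simp only: mult_cancel_left) simp
  qed
  have "\<phi> a = g" using g[OF s1(1) s2(1), of 0] e by simp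
  then show "\<phi> (x + a) = \<phi> a * \<phi> x" "\<rho> (x + a) = \<phi> a * \<rho> x"
    using g[OF s1(1) s2(1)] g[OF s1(2) s2(2)] by auto
qed

text \<open>On the unit circle \<open>(cmod (y a - 1))\<^sup>2 = 2 * (1 - Re (y a))\<close>, so the
  real part alone controls continuity at 0, and multiplicativity carries it to every point.\<close>

lemma continuous_character:
  fixes y :: "'a::topological_ab_group_add \<Rightarrow> complex"
  assumes one: "\<And>x. cmod (y x) = 1" and add: "\<And>x x'. y (x + x') = y x * y x'"
    and small: "\<And>\<epsilon>. 0 < \<epsilon> \<Longrightarrow> \<forall>\<^sub>F a in nhds 0. 1 - Re (y a) < \<epsilon>"
  shows "y \<in> characters"
proof -
  have sq: "(cmod (y a - 1))\<^sup>2 = 2 * (1 - Re (y a))" for a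
  proof -
    have "(Re (y a))\<^sup>2 + (Im (y a))\<^sup>2 = 1" using one[of a] by (metis cmod_power2 one_power2)
    then show ?thesis unfolding cmod_power2 by (simp add: power2_eq_square algebra_simps)
  qed
  have "continuous_on UNIV y"
    unfolding continuous_on_def
  proof
    fix x
    have "(y \<longlongrightarrow> y x) (nhds x)"
    proof (rule tendstoI)
      fix e :: real assume e: "0 < e"
      have t: "filterlim (\<lambda>z. z - x) (nhds 0) (nhds x)"
        using tendsto_diff[OF filterlim_ident tendsto_const, of x x] by simp
      have "\<forall>\<^sub>F z in nhds x. 1 - Re (y (z - x)) < e\<^sup>2 / 2"
        using small[of "e\<^sup>2 / 2"] e t by (auto intro: filterlim_compose eventually_compose_filterlim)
      then show "\<forall>\<^sub>F z in nhds x. dist (y z) (y x) < e"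
      proof eventually_elim
        case (elim z)
        have "(cmod (y (z - x) - 1))\<^sup>2 < e\<^sup>2" using elim by (simp add: sq)
        then have "cmod (y (z - x) - 1) < e" using e by (simp add: power_less_imp_less_base)
        moreover have "y z = y (z - x) * y x" using add[of "z - x" x] by simp
        then have "y z - y x = (y (z - x) - 1) * y x" by (simp add: algebra_simps)
        then have "dist (y z) (y x) = cmod (y (z - x) - 1)" by (simp add: dist_norm norm_mult one)
        ultimately show ?case by simp
      qed
    qed
    then show "(y \<longlongrightarrow> y x) (at x within UNIV)" by (rule tendsto_within_subset[OF tendsto_mono, rotated]) (auto simp: at_within_def)
  qed
  then show ?thesis using one add by (auto simp: characters_def)
qed

text \<open>An extreme pair maximising \<open>Re (\<rho> 0) - Re (\<rho> x0)\<close> has the form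
  \<open>(y, r)\<close> with \<open>r x = y x * r 0\<close>. The maximum is positive, hence
  \<open>r 0\<close> is positive and \<open>y x0 \<noteq> 1\<close>. Domination of the second
  difference at 0 reads \<open>2 * Re (r 0) * (1 - Re (y a)) \<le> \<eta>\<close>, which is
  continuity of \<open>y\<close>.\<close>

lemma character_of_dominated_pair:
  fixes \<phi> \<rho> :: "'a::topological_ab_group_add \<Rightarrow> complex"
  assumes dom: "dominated_pair C E \<phi> \<rho>" and one: "\<phi> 0 = 1"
    and small: "\<And>\<epsilon>. 0 < \<epsilon> \<Longrightarrow> \<forall>\<^sub>F a in nhds 0. \<exists>\<eta><\<epsilon>. (a, \<eta>) \<in> E"
    and x0: "Re (\<rho> x0) < Re (\<rho> 0)"
  obtains y where "y \<in> characters" "y x0 \<noteq> 1"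
proof -
  define S where "S = {u :: 'a \<Rightarrow> complex \<times> complex.
    dominated_pair C E (\<lambda>x. fst (u x)) (\<lambda>x. snd (u x)) \<and> fst (u 0) = 1}"
  define l where "l u = Re (snd (u 0)) - Re (snd (u x0))" for u :: "'a \<Rightarrow> complex \<times> complex"
  have ct: "continuous_on UNIV (\<lambda>u :: 'a \<Rightarrow> complex \<times> complex. fst (u x))"
    "continuous_on UNIV (\<lambda>u :: 'a \<Rightarrow> complex \<times> complex. snd (u x))" for x
    by (intro continuous_intros continuous_on_product_coordinates)+
  have "S = {u. pos_def (\<lambda>x. fst (u x))} \<inter> {u. pos_def (\<lambda>x. snd (u x))} \<inter>
     {u. pos_def (\<lambda>x. complex_of_real C * fst (u x) - snd (u x))} \<inter>
     (\<Inter>(a, \<eta>)\<in>E. {u. pos_def (\<lambda>x. complex_of_real \<eta> * fst (u x) - twist (-1) a (\<lambda>x. snd (u x)) x)}) \<inter>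
     {u. fst (u 0) = 1}"
    unfolding S_def dominated_pair_def by auto
  also have "closed \<dots>"
    unfolding case_prod_unfold
    by (intro closed_Int closed_INT ballI closed_pos_def closed_Collect_eq continuous_intros ct)
       (auto simp: smear_def intro!: continuous_intros ct)
  finally have "closed S" .
  \<comment> \<open>Positive definite functions are bounded by their value at 0, which places
    \<open>S\<close> inside a product of compact balls.\<close>
  have "S \<subseteq> PiE UNIV (\<lambda>_. cball 0 1 \<times> cball 0 C)"
  proof
    fix u assume "u \<in> S"
    then have p: "pos_def (\<lambda>x. fst (u x))" "pos_def (\<lambda>x. snd (u x))"
      "pos_def (\<lambda>x. complex_of_real C * fst (u x) - snd (u x))" "fst (u 0) = 1"
      unfolding S_def dominated_pair_def by auto
    have "Re (snd (u 0)) \<le> C" using pos_def_zero[OF p(3)] p(4) by (auto simp: complex_nonneg_Reals_iff)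
    then have "cmod (snd (u x)) \<le> C" for x using pos_def_bound[OF p(2), of x] by simp
    moreover have "cmod (fst (u x)) \<le> 1" for x using pos_def_bound[OF p(1), of x] p(4) by simp
    ultimately show "u \<in> PiE UNIV (\<lambda>_. cball 0 1 \<times> cball 0 C)"
      by (auto simp: mem_Times_iff)
  qed
  moreover have "compact (PiE (UNIV::'a set) (\<lambda>_. cball (0::complex) 1 \<times> cball (0::complex) C))"
    by (intro compact_PiE_UNIV compact_Times compact_cball)
  ultimately have S: "compact S"
    using compact_Int_closed[OF _ \<open>closed S\<close>] by (metis Int_absorb1)
  have init: "(\<lambda>x. (\<phi> x, \<rho> x)) \<in> S" using dom one by (simp add: S_def)
  have cl: "continuous_on UNIV l" unfolding l_def by (intro continuous_intros ct)
  have aff: "l (\<lambda>i. (1 - t) *\<^sub>R u i + t *\<^sub>R v i) = (1 - t) * l u + t * l v" for u v t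
    unfolding l_def by (simp add: algebra_simps)
  have "S \<noteq> {}" using init by auto
  from S this cl aff obtain e where e: "e \<in> S" "\<And>u. u \<in> S \<Longrightarrow> l u \<le> l e"
    "\<And>u v t. u \<in> S \<Longrightarrow> v \<in> S \<Longrightarrow> 0 < t \<Longrightarrow> t < 1 \<Longrightarrow>
       e = (\<lambda>i. (1 - t) *\<^sub>R u i + t *\<^sub>R v i) \<Longrightarrow> u = e \<and> v = e"
    by (rule extreme_maximizer_exists) (rule that)
  define y where "y = (\<lambda>x. fst (e x))"
  define r where "r = (\<lambda>x. snd (e x))"
  have dy: "dominated_pair C E y r" "y 0 = 1" using e(1) unfolding S_def y_def r_def by auto
  have "y (x + a) = y a * y x \<and> r (x + a) = y a * r x" for x a
  proof -
    have ext: "\<phi>1 = y \<and> \<rho>1 = r" if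
       "dominated_pair C E \<phi>1 \<rho>1" "\<phi>1 0 = 1" "dominated_pair C E \<phi>2 \<rho>2" "\<phi>2 0 = 1" "0 < t" "t < 1"
       "\<And>x. y x = complex_of_real (1 - t) * \<phi>1 x + complex_of_real t * \<phi>2 x"
       "\<And>x. r x = complex_of_real (1 - t) * \<rho>1 x + complex_of_real t * \<rho>2 x" for \<phi>1 \<rho>1 \<phi>2 \<rho>2 t
    proof -
      have "(\<lambda>x. (\<phi>1 x, \<rho>1 x)) = e \<and> (\<lambda>x. (\<phi>2 x, \<rho>2 x)) = e"
      proof (rule e(3)[OF _ _ that(5,6)])
        show "(\<lambda>x. (\<phi>1 x, \<rho>1 x)) \<in> S" "(\<lambda>x. (\<phi>2 x, \<rho>2 x)) \<in> S" using that by (auto simp: S_def)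
        show "e = (\<lambda>i. (1 - t) *\<^sub>R (\<phi>1 i, \<rho>1 i) + t *\<^sub>R (\<phi>2 i, \<rho>2 i))"
        proof
          fix x
          show "e x = (1 - t) *\<^sub>R (\<phi>1 x, \<rho>1 x) + t *\<^sub>R (\<phi>2 x, \<rho>2 x)"
            using that(7)[of x] that(8)[of x] by (simp add: prod_eq_iff y_def r_def scaleR_conv_of_real)
        qed
      qed
      then show ?thesis unfolding y_def r_def by auto
    qed
    have "y (x + a) = y a * y x" by (rule extreme_dominated_pair(1)[OF dy]) (fact ext)
    moreover have "r (x + a) = y a * r x" by (rule extreme_dominated_pair(2)[OF dy]) (fact ext)
    ultimately show ?thesis ..
  qed
  then have mult: "y (x + a) = y a * y x" "r (x + a) = y a * r x" for x a by auto
  have pd: "pos_def y" "pos_def r" using dy unfolding dominated_pair_def by auto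
  have norm1: "cmod (y x) = 1" for x
  proof -
    have "y (x + - x) = y (- x) * y x" by (rule mult)
    then have "1 = cnj (y x) * y x" using dy(2) pos_def_minus[OF pd(1)] by simp
    then have "(cmod (y x))\<^sup>2 = 1"
      using complex_norm_square[of "y x"] by (metis mult.commute of_real_eq_1_iff)
    then show ?thesis by (simp add: power2_eq_1_iff) (smt (verit) norm_ge_zero)
  qed
  have lpos: "0 < Re (r 0) - Re (r x0)"
    using e(2)[OF init] x0 unfolding l_def r_def by simp
  have r0: "r x = y x * r 0" for x using mult(2)[of 0 x] by simp
  have r0': "r 0 = complex_of_real (Re (r 0))" "0 \<le> Re (r 0)"
    using pos_def_zero[OF pd(2)] by (auto simp: complex_nonneg_Reals_iff complex_eq_iff)
  \<comment> \<open>If \<open>r 0\<close> were 0, then \<open>r\<close> would vanish everywhere and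
    the maximum of \<open>l\<close> could not be positive.\<close>
  have rpos: "0 < Re (r 0)"
    using r0' lpos r0 by (metis diff_self less_eq_real_def mult_zero_right of_real_0 order_less_irrefl)
  have "y \<in> characters"
  proof (rule continuous_character)
    show "cmod (y x) = 1" for x by (rule norm1)
    show "y (x + x') = y x * y x'" for x x' using mult(1)[of x' x] by (simp add: add.commute)
    fix \<epsilon> :: real assume "0 < \<epsilon>"
    then have "\<forall>\<^sub>F a in nhds 0. \<exists>\<eta><2 * Re (r 0) * \<epsilon>. (a, \<eta>) \<in> E" using rpos by (intro small) simp
    then show "\<forall>\<^sub>F a in nhds 0. 1 - Re (y a) < \<epsilon>"
    proof eventually_elim
      case (elim a)
      then obtain \<eta> where \<eta>: "\<eta> < 2 * Re (r 0) * \<epsilon>" "(a, \<eta>) \<in> E" by blast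
      have "pos_def (\<lambda>x. complex_of_real \<eta> * y x - twist (-1) a r x)"
        using dy(1) \<eta>(2) unfolding dominated_pair_def by auto
      from pos_def_zero[OF this] have "0 \<le> \<eta> - Re (2 * r 0 - r a - r (- a))"
        using dy(2) by (auto simp: complex_nonneg_Reals_iff twist_eq)
      moreover have "r a = y a * complex_of_real (Re (r 0))"
        using r0[of a] r0'(1) by (rule trans[OF _ arg_cong])
      then have "Re (r a) = Re (y a) * Re (r 0)" by simp
      moreover have "Re (r (-a)) = Re (r a)" using pos_def_minus[OF pd(2), of a] by simp
      ultimately have "2 * Re (r 0) * (1 - Re (y a)) \<le> \<eta>" by (simp add: algebra_simps)
      then have "2 * Re (r 0) * (1 - Re (y a)) < 2 * Re (r 0) * \<epsilon>" using \<eta> by linarith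
      then show ?case using rpos by simp
    qed
  qed
  moreover have "y x0 \<noteq> 1"
  proof
    assume "y x0 = 1"
    then have "r x0 = r 0" using r0[of x0] by (simp only: mult_1_left)
    then show False using lpos by (simp only: diff_self less_irrefl)
  qed
  ultimately show ?thesis by (rule that)
qed

section \<open>Approximately invariant functionals\<close>

text \<open>Tychonoff's theorem yields a cluster point of the whole family; refining the filter by
  its neighbourhoods makes all coordinates converge at once. This does the work of a convergent
  subnet.\<close>

lemma joint_cluster_filter:
  fixes u :: "'i \<Rightarrow> 'x \<Rightarrow> 'b::topological_space"
  assumes F: "F \<noteq> bot" and u: "\<And>i x. u i x \<in> K x" and K: "\<And>x. compact (K x)"
  obtains G L where "G \<noteq> bot" "G \<le> F" "\<And>x. L x \<in> K x" "\<And>x. ((\<lambda>i. u i x) \<longlongrightarrow> L x) G"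
proof -
  have "compact (PiE UNIV K)" by (rule compact_PiE_UNIV[OF K])
  moreover have "filtermap u F \<noteq> bot" using F by (simp add: filtermap_bot_iff)
  moreover have "eventually (\<lambda>z. z \<in> PiE UNIV K) (filtermap u F)"
    using u by (simp add: eventually_filtermap PiE_iff)
  ultimately obtain L where L: "L \<in> PiE UNIV K" "inf (nhds L) (filtermap u F) \<noteq> bot"
    unfolding compact_filter by blast
  define G where "G = inf F (filtercomap u (nhds L))"
  have "G \<noteq> bot"
  proof
    assume "G = bot"
    then have "eventually (\<lambda>_. False) G" by simp
    then obtain P Q where PQ: "eventually P F" "eventually Q (nhds L)" "\<And>i. P i \<Longrightarrow> \<not> Q (u i)"
      unfolding G_def eventually_inf eventually_filtercomap by blast
    have "eventually (\<lambda>z. \<not> Q z) (filtermap u F)"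
      unfolding eventually_filtermap using PQ(1) by eventually_elim (rule PQ(3))
    with PQ(2) have "eventually (\<lambda>_. False) (inf (nhds L) (filtermap u F))"
      unfolding eventually_inf by blast
    then show False using L(2) by (simp add: eventually_False)
  qed
  moreover have "G \<le> F" by (simp add: G_def)
  moreover have "L x \<in> K x" for x using L(1) by auto
  moreover have lim: "(u \<longlongrightarrow> L) G"
    unfolding G_def filterlim_iff_le_filtercomap by simp
  moreover have "((\<lambda>i. u i x) \<longlongrightarrow> L x) G" for x
    using continuous_on_tendsto_compose[OF continuous_on_product_coordinates lim] by simp
  ultimately show ?thesis using that by blast
qed

section \<open>Almost invariant means on an Abelian group\<close>

definition mean :: "'a list \<Rightarrow> ('a \<Rightarrow> real) \<Rightarrow> real" where
  "mean xs F = (\<Sum>b\<leftarrow>xs. F b) / length xs"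

text \<open>Elements are treated one at a time. Concatenating the \<open>N\<close> translates of
  \<open>xs\<close> by 0, a, 2a, ... keeps the invariance already gained, since each translate has
  it, while the shift by \<open>a\<close> telescopes to two end terms, negligible against
  \<open>N\<close> blocks. Lists count coinciding points with multiplicity.\<close>

lemma approx_invariant_list:
  fixes A :: "'a::ab_group_add set" and \<epsilon> :: real
  assumes "finite A" "0 < \<epsilon>"
  shows "\<exists>xs. xs \<noteq> [] \<and> (\<forall>a\<in>A. \<forall>F M::real. (\<forall>x. \<bar>F x\<bar> \<le> M) \<longrightarrow>
    \<bar>(\<Sum>b\<leftarrow>xs. F (b + a)) - (\<Sum>b\<leftarrow>xs. F b)\<bar> \<le> \<epsilon> * M * length xs)"
  using assms(1)
proof (induction A rule: finite_induct)
  case empty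
  show ?case by (rule exI[of _ "[0]"]) auto
next
  case (insert a A)
  then obtain xs where xs: "xs \<noteq> []" "\<And>a F (M::real). a \<in> A \<Longrightarrow> (\<And>x. \<bar>F x\<bar> \<le> M) \<Longrightarrow>
    \<bar>(\<Sum>b\<leftarrow>xs. F (b + a)) - (\<Sum>b\<leftarrow>xs. F b)\<bar> \<le> \<epsilon> * M * length xs" by blast
  obtain N where N: "2 < real N * \<epsilon>" using assms(2) ex_less_of_nat_mult by blast
  \<comment> \<open>\<open>m j\<close> is the j-fold sum of \<open>a\<close>.\<close>
  define m where "m j = (\<Sum>_<j. a)" for j :: nat
  define ys where "ys = concat (map (\<lambda>j. map (\<lambda>b. b + m j) xs) [0..<N])"
  have sum_ys: "(\<Sum>b\<leftarrow>ys. F b) = (\<Sum>j<N. \<Sum>b\<leftarrow>xs. F (b + m j))" for F :: "'a \<Rightarrow> real"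
    unfolding ys_def by (induction N) (auto simp: comp_def)
  have len: "length ys = N * length xs"
    unfolding ys_def by (induction N) auto
  have bound: "\<bar>\<Sum>b\<leftarrow>zs. F b\<bar> \<le> M * length zs" if "\<And>x. \<bar>F x\<bar> \<le> M" for F :: "'a \<Rightarrow> real" and M zs
  proof (induction zs)
    case (Cons z zs)
    then show ?case using that[of z] by (simp add: algebra_simps abs_le_iff)
  qed simp
  have "\<bar>(\<Sum>b\<leftarrow>ys. F (b + c)) - (\<Sum>b\<leftarrow>ys. F b)\<bar> \<le> \<epsilon> * M * length ys"
    if c: "c \<in> insert a A" and M: "\<And>x. \<bar>F x\<bar> \<le> M" for c F and M :: real
  proof (cases "c = a")
    case True
    have M0: "0 \<le> M" using M[of 0] by linarith
    have "(\<Sum>b\<leftarrow>ys. F (b + a)) - (\<Sum>b\<leftarrow>ys. F b) =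
        (\<Sum>j<N. (\<Sum>b\<leftarrow>xs. F (b + m (Suc j))) - (\<Sum>b\<leftarrow>xs. F (b + m j)))"
      unfolding sum_ys sum_subtractf by (simp add: m_def add.assoc)
    also have "\<dots> = (\<Sum>b\<leftarrow>xs. F (b + m N)) - (\<Sum>b\<leftarrow>xs. F (b + m 0))"
      by (rule sum_lessThan_telescope)
    also have "\<bar>\<dots>\<bar> \<le> M * length xs + M * length xs"
      by (rule order_trans[OF abs_triangle_ineq4 add_mono]) (rule bound, rule M)+
    also have "\<dots> = 2 * (M * length xs)" by simp
    also have "\<dots> \<le> (real N * \<epsilon>) * (M * length xs)"
      using N M0 by (intro mult_right_mono) auto
    also have "\<dots> = \<epsilon> * M * length ys" by (simp add: len)
    finally show ?thesis using True by simp
  next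
    case False
    then have "c \<in> A" using c by simp
    have "(\<Sum>b\<leftarrow>ys. F (b + c)) - (\<Sum>b\<leftarrow>ys. F b) =
        (\<Sum>j<N. (\<Sum>b\<leftarrow>xs. F (b + c + m j)) - (\<Sum>b\<leftarrow>xs. F (b + m j)))"
      unfolding sum_ys sum_subtractf by (simp add: ac_simps)
    also have "\<bar>\<dots>\<bar> \<le> (\<Sum>j<N. \<epsilon> * M * length xs)"
      by (rule order_trans[OF sum_abs sum_mono]) (rule xs(2)[OF \<open>c \<in> A\<close>], rule M)
    also have "\<dots> = \<epsilon> * M * length ys" by (simp add: len)
    finally show ?thesis .
  qed
  moreover have "ys \<noteq> []"
  proof -
    have "N \<noteq> 0" using N by (cases N) auto
    then show ?thesis using len xs(1) by auto
  qed
  ultimately show ?case by (intro exI[of _ ys]) blast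
qed

text \<open>The index runs over a finite set of shifts together with an accuracy
  \<open>1 / (n + 1)\<close>. A filter is used instead of a sequence because the invariance must
  hold in the limit for every element of the group.\<close>

lemma approx_invariant_filter:
  obtains \<F> :: "'a::ab_group_add list filter" where "\<F> \<noteq> bot" "\<forall>\<^sub>F xs in \<F>. xs \<noteq> []"
    "\<And>a \<epsilon>. 0 < \<epsilon> \<Longrightarrow> \<forall>\<^sub>F xs in \<F>. \<forall>F M::real. (\<forall>x. \<bar>F x\<bar> \<le> M) \<longrightarrow>
       \<bar>mean xs (\<lambda>b. F (b + a)) - mean xs F\<bar> \<le> \<epsilon> * M"
proof -
  have "\<forall>A::'a set. \<forall>n::nat. \<exists>xs. finite A \<longrightarrow> xs \<noteq> [] \<and> (\<forall>a\<in>A. \<forall>F M::real. (\<forall>x. \<bar>F x\<bar> \<le> M) \<longrightarrow>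
    \<bar>(\<Sum>b\<leftarrow>xs. F (b + a)) - (\<Sum>b\<leftarrow>xs. F b)\<bar> \<le> inverse (Suc n) * M * length xs)"
    using approx_invariant_list[where \<epsilon> = "inverse (real (Suc n))" for n]
    by (metis inverse_positive_iff_positive of_nat_0_less_iff zero_less_Suc)
  then obtain pick :: "'a set \<Rightarrow> nat \<Rightarrow> 'a list" where
    pick': "\<forall>A n. finite A \<longrightarrow> pick A n \<noteq> [] \<and> (\<forall>a\<in>A. \<forall>F M::real. (\<forall>x. \<bar>F x\<bar> \<le> M) \<longrightarrow>
    \<bar>(\<Sum>b\<leftarrow>pick A n. F (b + a)) - (\<Sum>b\<leftarrow>pick A n. F b)\<bar> \<le> inverse (Suc n) * M * length (pick A n))"
    unfolding choice_iff by blast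
  have pick: "\<And>A n. finite A \<Longrightarrow> pick A n \<noteq> []"
      "\<And>A n a F (M::real). finite A \<Longrightarrow> a \<in> A \<Longrightarrow> (\<And>x. \<bar>F x\<bar> \<le> M) \<Longrightarrow>
        \<bar>(\<Sum>b\<leftarrow>pick A n. F (b + a)) - (\<Sum>b\<leftarrow>pick A n. F b)\<bar> \<le> inverse (Suc n) * M * length (pick A n)"
    using pick' by simp_all
  define \<H> where "\<H> = finite_subsets_at_top (UNIV :: 'a set) \<times>\<^sub>F sequentially"
  define \<F> where "\<F> = filtermap (\<lambda>z. pick (fst z) (snd z)) \<H>"
  have A: "\<forall>\<^sub>F A in finite_subsets_at_top (UNIV :: 'a set). finite A \<and> a \<in> A" for a
    unfolding eventually_finite_subsets_at_top by (intro exI[of _ "{a}"]) auto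
  show ?thesis
  proof (rule that)
    show "\<F> \<noteq> bot"
      unfolding \<F>_def \<H>_def filtermap_bot_iff prod_filter_eq_bot by simp
    show "\<forall>\<^sub>F xs in \<F>. xs \<noteq> []"
      unfolding \<F>_def \<H>_def eventually_filtermap
      by (rule eventually_mono[OF eventually_prodI[OF A[of 0] always_eventually[OF allI[OF TrueI]]]])
         (auto dest: pick(1))
    fix a :: 'a and \<epsilon> :: real assume "0 < \<epsilon>"
    then have n: "\<forall>\<^sub>F n in sequentially. inverse (real (Suc n)) < \<epsilon>"
      using LIMSEQ_inverse_real_of_nat by (rule order_tendstoD(2)[rotated])
    show "\<forall>\<^sub>F xs in \<F>. \<forall>F M::real. (\<forall>x. \<bar>F x\<bar> \<le> M) \<longrightarrow>
       \<bar>mean xs (\<lambda>b. F (b + a)) - mean xs F\<bar> \<le> \<epsilon> * M"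
      unfolding \<F>_def \<H>_def eventually_filtermap
    proof (rule eventually_mono[OF eventually_prodI[OF A[of a] n]], intro allI impI)
      fix z :: "'a set \<times> nat" and F :: "'a \<Rightarrow> real" and M :: real
      assume z: "(finite (fst z) \<and> a \<in> fst z) \<and> inverse (real (Suc (snd z))) < \<epsilon>"
        and F: "\<forall>x. \<bar>F x\<bar> \<le> M"
      define A n where "A = fst z" and "n = snd z"
      have h: "inverse (real (Suc n)) < \<epsilon>" "finite A" "a \<in> A" "\<forall>x. \<bar>F x\<bar> \<le> M"
        using z F unfolding A_def n_def by auto
      define xs where "xs = pick A n"
      have len: "0 < real (length xs)" using pick(1)[OF h(2)] by (simp add: xs_def)
      have M0: "0 \<le> M" using h(4)[rule_format, of 0] by linarith
      have "\<bar>(\<Sum>b\<leftarrow>xs. F (b + a)) - (\<Sum>b\<leftarrow>xs. F b)\<bar> \<le> inverse (Suc n) * M * length xs"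
        unfolding xs_def using h by (intro pick(2)) auto
      also have "\<dots> \<le> \<epsilon> * M * length xs"
        using h M0 by (intro mult_right_mono) auto
      finally show "\<bar>mean (pick (fst z) (snd z)) (\<lambda>b. F (b + a)) - mean (pick (fst z) (snd z)) F\<bar> \<le> \<epsilon> * M"
        using len unfolding mean_def A_def[symmetric] n_def[symmetric] xs_def[symmetric] diff_divide_distrib[symmetric]
        by (simp add: abs_divide pos_divide_le_eq)
    qed
  qed
qed

section \<open>Separated sets and a substitute for the Haar integral\<close>

lemma diff_nhd:
  fixes W :: "'a::topological_ab_group_add set"
  assumes "open W" "0 \<in> W"
  obtains U where "open U" "0 \<in> U" "U \<subseteq> W" "\<And>x. x \<in> U \<Longrightarrow> - x \<in> U" "\<And>x y. x \<in> U \<Longrightarrow> y \<in> U \<Longrightarrow> x - y \<in> W"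
proof -
  have "open ((\<lambda>z. fst z - snd z) -` W)"
    by (intro open_vimage assms continuous_intros)
  moreover have "(0, 0) \<in> (\<lambda>z::'a \<times> 'a. fst z - snd z) -` W" using assms by simp
  ultimately obtain A B where AB: "open A" "open B" "0 \<in> A" "0 \<in> B"
    "A \<times> B \<subseteq> (\<lambda>z. fst z - snd z) -` W"
    by (elim open_prod_elim) auto
  have op: "open (uminus -` (A \<inter> B))"
    using AB by (intro open_vimage continuous_intros) auto
  show ?thesis
  proof
    show "open (A \<inter> B \<inter> uminus -` (A \<inter> B))" using op AB by auto
    have "x - 0 \<in> W" if "x \<in> A" for x using AB that by force
    then show "A \<inter> B \<inter> uminus -` (A \<inter> B) \<subseteq> W" by auto
    show "x - y \<in> W" if "x \<in> A \<inter> B \<inter> uminus -` (A \<inter> B)" "y \<in> A \<inter> B \<inter> uminus -` (A \<inter> B)" for x y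
      using AB(5) that by force
  qed (use AB in auto)
qed

text \<open>For a maximal separated set, a point with no member of the set within \<open>N\<close>
  could be adjoined; symmetry of \<open>N\<close> and \<open>0 \<in> N\<close> enter here.\<close>

lemma separated_net:
  fixes N :: "'a::ab_group_add set"
  assumes "0 \<in> N" and sym: "\<And>x. x \<in> N \<Longrightarrow> - x \<in> N"
  obtains \<Lambda> where "\<And>x y. x \<in> \<Lambda> \<Longrightarrow> y \<in> \<Lambda> \<Longrightarrow> x - y \<in> N \<Longrightarrow> x = y" "\<And>x. \<exists>y\<in>\<Lambda>. y - x \<in> N"
proof -
  define sep where "sep L \<longleftrightarrow> (\<forall>x\<in>L. \<forall>y\<in>L. x - y \<in> N \<longrightarrow> x = y)" for L
  have "\<exists>L\<in>Collect sep. \<forall>X\<in>Collect sep. L \<subseteq> X \<longrightarrow> X = L"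
  proof (rule subset_Zorn')
    fix \<C> assume C: "subset.chain (Collect sep) \<C>"
    have "x = y" if xy: "x \<in> \<Union> \<C>" "y \<in> \<Union> \<C>" "x - y \<in> N" for x y
    proof -
      obtain X Y where "X \<in> \<C>" "Y \<in> \<C>" "x \<in> X" "y \<in> Y" using xy(1,2) by blast
      moreover have "X \<subseteq> Y \<or> Y \<subseteq> X" using C calculation unfolding subset.chain_def by blast
      ultimately obtain Z where "Z \<in> \<C>" "x \<in> Z" "y \<in> Z" by blast
      moreover have "sep Z" using C calculation(1) unfolding subset.chain_def by blast
      ultimately show ?thesis using that(3) unfolding sep_def by blast
    qed
    then show "\<Union> \<C> \<in> Collect sep" unfolding sep_def by blast
  qed
  then obtain L where L: "sep L" "\<And>X. sep X \<Longrightarrow> L \<subseteq> X \<Longrightarrow> X = L" by auto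
  show ?thesis
  proof (rule that)
    show "x = y" if "x \<in> L" "y \<in> L" "x - y \<in> N" for x y using L(1) that unfolding sep_def by blast
    show "\<exists>y\<in>L. y - x \<in> N" for x
    proof (rule ccontr)
      assume no: "\<not> (\<exists>y\<in>L. y - x \<in> N)"
      have "x - y \<notin> N" if "y \<in> L" for y using no that sym[of "x - y"] by auto
      then have "sep (insert x L)" using L(1) no unfolding sep_def by auto
      then have "x \<in> L" using L(2)[of "insert x L"] by auto
      then show False using no assms(1) by force
    qed
  qed
qed

text \<open>\<open>K\<close> is covered by finitely many translates of a \<open>U\<close> with
  \<open>U - U \<subseteq> N\<close>, and each translate contains at most one point
  \<open>y + b\<close>. The number of translates bounds the count uniformly in \<open>b\<close>,
  which makes sums over translated nets bounded.\<close>

lemma separated_finite: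
  fixes N :: "'a::topological_ab_group_add set"
  assumes "open N" "0 \<in> N" "compact K"
    and sep: "\<And>x y. x \<in> \<Lambda> \<Longrightarrow> y \<in> \<Lambda> \<Longrightarrow> x - y \<in> N \<Longrightarrow> x = y"
  obtains m where "\<And>b. finite {y \<in> \<Lambda>. y + b \<in> K}" "\<And>b. card {y \<in> \<Lambda>. y + b \<in> K} \<le> m"
proof -
  obtain U where U: "open U" "0 \<in> U" "\<And>x y. x \<in> U \<Longrightarrow> y \<in> U \<Longrightarrow> x - y \<in> N"
    using diff_nhd[OF assms(1,2)] by metis
  have "\<exists>Z\<subseteq>K. finite Z \<and> K \<subseteq> (\<Union>z\<in>Z. (\<lambda>x. x - z) -` U)"
  proof (rule compactE_image[OF assms(3), of K "\<lambda>z. (\<lambda>x. x - z) -` U"])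
    show "open ((\<lambda>x. x - z) -` U)" for z by (intro open_vimage U continuous_intros)
    show "K \<subseteq> (\<Union>z\<in>K. (\<lambda>x. x - z) -` U)" using U by auto
  qed auto
  then obtain Z where Z: "finite Z" "K \<subseteq> (\<Union>z\<in>Z. (\<lambda>x. x - z) -` U)" by blast
  show ?thesis
  proof
    fix b
    have "\<forall>y\<in>{y \<in> \<Lambda>. y + b \<in> K}. \<exists>z\<in>Z. y + b - z \<in> U" using Z(2) by auto
    then obtain z where z: "\<And>y. y \<in> \<Lambda> \<Longrightarrow> y + b \<in> K \<Longrightarrow> z y \<in> Z \<and> y + b - z y \<in> U"
      by (metis (mono_tags, lifting) mem_Collect_eq)
    have inj: "inj_on z {y \<in> \<Lambda>. y + b \<in> K}"
    proof (rule inj_onI)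
      fix x y assume xy: "x \<in> {y \<in> \<Lambda>. y + b \<in> K}" "y \<in> {y \<in> \<Lambda>. y + b \<in> K}" "z x = z y"
      then have "(x + b - z x) - (y + b - z y) \<in> N"
        using z[of x] z[of y] by (intro U(3)) simp_all
      then show "x = y" using xy by (intro sep) auto
    qed
    moreover have "z ` {y \<in> \<Lambda>. y + b \<in> K} \<subseteq> Z" using z by auto
    ultimately show "finite {y \<in> \<Lambda>. y + b \<in> K}" "card {y \<in> \<Lambda>. y + b \<in> K} \<le> card Z"
      using Z(1) by (auto intro: inj_on_finite card_inj_on_le)
  qed
qed

lemma sum_list_map_nth:
  fixes F :: "'a \<Rightarrow> real"
  shows "(\<Sum>b\<leftarrow>xs. F b) = (\<Sum>j<length xs. F (xs ! j))"
  by (simp add: sum_list_sum_nth atLeast0LessThan)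

text \<open>\<open>I xs f\<close> averages the sums of \<open>f\<close> over the translates
  \<open>\<Lambda> + b\<close>, with \<open>b\<close> in \<open>xs\<close>. Density of
  \<open>\<Lambda>\<close> gives the lower bound, separation the upper one, and invariance appears
  only along the filter. No limit functional is formed: each \<open>I xs\<close> stays a finite
  nonnegative combination of point values, so that it can be turned into a
  \<open>smear\<close>.\<close>

lemma approximate_Haar_functional:
  fixes N :: "'a::topological_ab_group_add set"
  assumes N: "open N" "0 \<in> N" and sym: "\<And>x. x \<in> N \<Longrightarrow> - x \<in> N"
  obtains \<F> :: "'a list filter" and I :: "'a list \<Rightarrow> ('a \<Rightarrow> real) \<Rightarrow> real" where
    "\<F> \<noteq> bot"
    "\<And>xs K. compact K \<Longrightarrow> \<exists>(D :: (nat \<times> 'a) set) p w. finite D \<and> 0 \<le> w \<and> (\<forall>s\<in>D. p s \<in> K) \<and>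
       (\<forall>f. (\<forall>z. z \<notin> K \<longrightarrow> f z = 0) \<longrightarrow> I xs f = w * (\<Sum>s\<in>D. f (p s)))"
    "\<And>K. compact K \<Longrightarrow> \<exists>C\<ge>0. \<forall>xs f. \<forall>M::real. (\<forall>z. z \<notin> K \<longrightarrow> f z = 0) \<longrightarrow> (\<forall>z. \<bar>f z\<bar> \<le> M) \<longrightarrow> \<bar>I xs f\<bar> \<le> C * M"
    "\<And>K. compact K \<Longrightarrow> \<forall>\<^sub>F xs in \<F>. \<forall>f. (\<forall>z. z \<notin> K \<longrightarrow> f z = 0) \<longrightarrow> (\<forall>z. 0 \<le> f z) \<longrightarrow>
       (\<forall>z\<in>N. 1 \<le> f z) \<longrightarrow> 1 \<le> I xs f"
    "\<And>K a \<epsilon>. compact K \<Longrightarrow> 0 < \<epsilon> \<Longrightarrow> \<forall>\<^sub>F xs in \<F>. \<forall>f. \<forall>M::real. (\<forall>z. z \<notin> K \<longrightarrow> f z = 0) \<longrightarrow>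
       (\<forall>z. \<bar>f z\<bar> \<le> M) \<longrightarrow> \<bar>I xs (\<lambda>z. f (z + a)) - I xs f\<bar> \<le> \<epsilon> * M"
proof -
  obtain \<Lambda> where \<Lambda>: "\<And>x y. x \<in> \<Lambda> \<Longrightarrow> y \<in> \<Lambda> \<Longrightarrow> x - y \<in> N \<Longrightarrow> x = y" "\<And>x. \<exists>y\<in>\<Lambda>. y - x \<in> N"
    using separated_net[of N] N(2) sym by metis
  obtain \<F> :: "'a list filter" where \<F>: "\<F> \<noteq> bot" "\<forall>\<^sub>F xs in \<F>. xs \<noteq> []"
    "\<And>a \<epsilon>. 0 < \<epsilon> \<Longrightarrow> \<forall>\<^sub>F xs in \<F>. \<forall>F M::real. (\<forall>x. \<bar>F x\<bar> \<le> M) \<longrightarrow>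
       \<bar>mean xs (\<lambda>b. F (b + a)) - mean xs F\<bar> \<le> \<epsilon> * M"
    by (rule approx_invariant_filter) (rule that)
  \<comment> \<open>Summation over the support avoids naming a compact set; for each
    \<open>K\<close> that carries \<open>f\<close> the sum is the finite one over
    \<open>K\<close>.\<close>
  define L where "L f b = (\<Sum>y\<in>{y \<in> \<Lambda>. f (y + b) \<noteq> 0}. f (y + b))" for f :: "'a \<Rightarrow> real" and b
  define I where "I xs f = mean xs (L f)" for xs f
  have fin: "\<exists>m. \<forall>b. finite {y \<in> \<Lambda>. y + b \<in> K} \<and> card {y \<in> \<Lambda>. y + b \<in> K} \<le> m" if "compact K" for K
    by (rule separated_finite[OF N that, of \<Lambda>]) (use \<Lambda>(1) in blast)+
  have L_eq: "L f b = (\<Sum>y\<in>{y \<in> \<Lambda>. y + b \<in> K}. f (y + b))"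
    if "compact K" "\<forall>z. z \<notin> K \<longrightarrow> f z = 0" for K f b
    unfolding L_def using fin[OF that(1)] that(2) by (intro sum.mono_neutral_left) auto
  have L_bound: "\<bar>L f b\<bar> \<le> m * M" if "compact K" "\<forall>z. z \<notin> K \<longrightarrow> f z = 0" "\<forall>z. \<bar>f z\<bar> \<le> M"
    "\<forall>b. finite {y \<in> \<Lambda>. y + b \<in> K} \<and> card {y \<in> \<Lambda>. y + b \<in> K} \<le> m" for K f b and M :: real and m :: nat
  proof -
    have "0 \<le> M" using that(3)[rule_format, of 0] by linarith
    have "\<bar>L f b\<bar> \<le> (\<Sum>y\<in>{y \<in> \<Lambda>. y + b \<in> K}. M)"
      unfolding L_eq[OF that(1,2)] by (rule order_trans[OF sum_abs sum_mono]) (use that in auto)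
    also have "\<dots> \<le> m * M" using that(4) \<open>0 \<le> M\<close> by (simp add: mult_right_mono)
    finally show ?thesis .
  qed
  have mean_bound: "\<bar>mean xs F\<bar> \<le> M" if "\<And>b. \<bar>F b\<bar> \<le> M" for xs :: "'a list" and F and M :: real
  proof -
    have "0 \<le> M" using that[of 0] by linarith
    have "\<bar>\<Sum>b\<leftarrow>xs. F b\<bar> \<le> length xs * M"
      unfolding sum_list_map_nth by (rule order_trans[OF sum_abs]) (use sum_bounded_above[of "{..<length xs}" "\<lambda>j. \<bar>F (xs ! j)\<bar>" M] that in auto)
    then show ?thesis using \<open>0 \<le> M\<close> by (cases "xs = []") (auto simp: mean_def abs_divide pos_divide_le_eq mult.commute)
  qed
  show ?thesis
  proof (rule that[of \<F> I])
    show "\<F> \<noteq> bot" by (rule \<F>)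
  next
    fix xs :: "'a list" and K :: "'a set" assume K: "compact K"
    define D where "D = (SIGMA j:{..<length xs}. {y \<in> \<Lambda>. y + xs ! j \<in> K})"
    define p where "p = (\<lambda>(j, y). y + xs ! j)"
    have "finite D" unfolding D_def using fin[OF K] by auto
    moreover have "I xs f = 1 / length xs * (\<Sum>s\<in>D. f (p s))" if "\<forall>z. z \<notin> K \<longrightarrow> f z = 0" for f
    proof -
      have "(\<Sum>s\<in>D. f (p s)) = (\<Sum>j<length xs. L f (xs ! j))"
        unfolding D_def p_def L_eq[OF K that] using fin[OF K] by (subst sum.Sigma) (auto simp: case_prod_unfold)
      then show ?thesis by (simp add: I_def mean_def sum_list_map_nth)
    qed
    moreover have "\<forall>s\<in>D. p s \<in> K" unfolding D_def p_def by auto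
    ultimately show "\<exists>(D :: (nat \<times> 'a) set) p w. finite D \<and> 0 \<le> w \<and> (\<forall>s\<in>D. p s \<in> K) \<and>
       (\<forall>f. (\<forall>z. z \<notin> K \<longrightarrow> f z = 0) \<longrightarrow> I xs f = w * (\<Sum>s\<in>D. f (p s)))"
      by (intro exI[of _ D] exI[of _ p] exI[of _ "1 / length xs"]) auto
  next
    fix K :: "'a set" assume K: "compact K"
    obtain m where m: "\<forall>b. finite {y \<in> \<Lambda>. y + b \<in> K} \<and> card {y \<in> \<Lambda>. y + b \<in> K} \<le> m" using fin[OF K] by blast
    show "\<exists>C\<ge>0. \<forall>xs f. \<forall>M::real. (\<forall>z. z \<notin> K \<longrightarrow> f z = 0) \<longrightarrow> (\<forall>z. \<bar>f z\<bar> \<le> M) \<longrightarrow> \<bar>I xs f\<bar> \<le> C * M"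
      unfolding I_def using L_bound[OF K _ _ m] by (intro exI[of _ "real m"] conjI allI impI mean_bound) auto
  next
    fix K :: "'a set" assume K: "compact K"
    show "\<forall>\<^sub>F xs in \<F>. \<forall>f. (\<forall>z. z \<notin> K \<longrightarrow> f z = 0) \<longrightarrow> (\<forall>z. 0 \<le> f z) \<longrightarrow>
       (\<forall>z\<in>N. 1 \<le> f z) \<longrightarrow> 1 \<le> I xs f"
      using \<F>(2)
    proof (eventually_elim, intro allI impI)
      fix xs :: "'a list" and f :: "'a \<Rightarrow> real" assume xs: "xs \<noteq> []" and f: "\<forall>z. z \<notin> K \<longrightarrow> f z = (0::real)" "\<forall>z. 0 \<le> f z" "\<forall>z\<in>N. 1 \<le> f z"
      have "1 \<le> L f b" for b
      proof -
        obtain y where y: "y \<in> \<Lambda>" "y + b \<in> N" using \<Lambda>(2)[of "-b"] by auto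
        then have "y + b \<in> K" using f by force
        then have "f (y + b) \<le> L f b"
          unfolding L_eq[OF K f(1)] using fin[OF K] f(2) y by (intro member_le_sum) auto
        then show ?thesis using f(3) y by force
      qed
      then have "real (length xs) * 1 \<le> (\<Sum>b\<leftarrow>xs. L f b)"
        unfolding sum_list_map_nth using \<open>\<And>b. 1 \<le> L f b\<close> sum_bounded_below[of "{..<length xs}" 1 "\<lambda>j. L f (xs ! j)"] by simp
      then show "1 \<le> I xs f" using xs by (simp add: I_def mean_def le_divide_eq)
    qed
  next
    fix K :: "'a set" and a and \<epsilon> :: real assume K: "compact K" and \<epsilon>: "0 < \<epsilon>"
    obtain m where m: "\<forall>b. finite {y \<in> \<Lambda>. y + b \<in> K} \<and> card {y \<in> \<Lambda>. y + b \<in> K} \<le> m" using fin[OF K] by blast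
    \<comment> \<open>\<open>L f\<close> is bounded by \<open>m * M\<close>, so the accuracy is
      divided by \<open>m\<close>; the added 1 covers \<open>m = 0\<close>.\<close>
    have "0 < \<epsilon> / (real m + 1)" using \<epsilon> by simp
    from \<F>(3)[OF this, of a]
    show "\<forall>\<^sub>F xs in \<F>. \<forall>f. \<forall>M::real. (\<forall>z. z \<notin> K \<longrightarrow> f z = 0) \<longrightarrow>
       (\<forall>z. \<bar>f z\<bar> \<le> M) \<longrightarrow> \<bar>I xs (\<lambda>z. f (z + a)) - I xs f\<bar> \<le> \<epsilon> * M"
    proof (eventually_elim, intro allI impI)
      fix xs :: "'a list" and f :: "'a \<Rightarrow> real" and M assume xs: "\<forall>F M::real. (\<forall>x. \<bar>F x\<bar> \<le> M) \<longrightarrow> \<bar>mean xs (\<lambda>b. F (b + a)) - mean xs F\<bar> \<le> \<epsilon> / (real m + 1) * M"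
        and f: "\<forall>z. z \<notin> K \<longrightarrow> f z = 0" "\<forall>z. \<bar>f z\<bar> \<le> M"
      \<comment> \<open>Translating \<open>f\<close> translates \<open>L f\<close>, so invariance of
        the means passes to \<open>I\<close>.\<close>
      have "L (\<lambda>z. f (z + a)) = (\<lambda>b. L f (b + a))" by (rule ext) (simp add: L_def add.assoc)
      moreover have "\<forall>x. \<bar>L f x\<bar> \<le> real m * M" using L_bound[OF K f m] by simp
      ultimately have "\<bar>I xs (\<lambda>z. f (z + a)) - I xs f\<bar> \<le> \<epsilon> / (real m + 1) * (real m * M)"
        using xs unfolding I_def by simp
      also have "\<dots> = (\<epsilon> * M) * (real m / (real m + 1))" by simp
      also have "\<dots> \<le> (\<epsilon> * M) * 1"
        using \<epsilon> f(2)[rule_format, of 0] by (intro mult_left_mono) (auto simp: divide_le_eq)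
      finally show "\<bar>I xs (\<lambda>z. f (z + a)) - I xs f\<bar> \<le> \<epsilon> * M" by simp
    qed
  qed
qed

lemma pos_def_lim:
  assumes "G \<noteq> bot" "\<forall>\<^sub>F i in G. pos_def (f i)" "\<And>x. ((\<lambda>i. f i x) \<longlongrightarrow> g x) G"
  shows "pos_def g"
  unfolding pos_def_def
proof (intro allI)
  fix n :: nat and c x
  show "smear {..<n} c x g 0 \<in> \<real>\<^sub>\<ge>\<^sub>0"
  proof (rule Lim_in_closed_set[OF closed_nonneg_Reals_complex _ assms(1)])
    show "\<forall>\<^sub>F i in G. smear {..<n} c x (f i) 0 \<in> \<real>\<^sub>\<ge>\<^sub>0"
      using assms(2) by eventually_elim (simp add: pos_def_def)
    show "((\<lambda>i. smear {..<n} c x (f i) 0) \<longlongrightarrow> smear {..<n} c x g 0) G"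
      unfolding smear_def by (intro tendsto_intros assms(3))
  qed
qed

section \<open>Existence of characters\<close>

lemma Hausdorff_space_t2: "Hausdorff_space (euclidean :: 'a::t2_space topology)"
  unfolding Hausdorff_space_def disjnt_def by (simp, metis hausdorff)

lemma bump_function:
  fixes V :: "'a::{topological_ab_group_add, t2_space} set"
  assumes lc: "locally_compact_space (euclidean :: 'a topology)"
    and V: "open V" "0 \<in> V"
  obtains g :: "'a \<Rightarrow> real" where "continuous_on UNIV g" "\<And>z. 0 \<le> g z" "\<And>z. g z \<le> 1" "g 0 = 1"
    "\<And>z. z \<notin> V \<Longrightarrow> g z = 0"
proof -
  have "completely_regular_space (euclidean :: 'a topology)"
    using lc Hausdorff_space_t2 by (intro locally_compact_regular_imp_completely_regular_space) auto
  then obtain f :: "'a \<Rightarrow> real" where f: "continuous_map euclidean (top_of_set {0..1}) f" "f 0 = 0" "f ` (- V) \<subseteq> {1}"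
    using V unfolding completely_regular_space_def
    by (metis ComplD DiffI UNIV_I closed_Compl closed_closedin topspace_euclidean)
  have "continuous_on UNIV f" "\<And>z. 0 \<le> f z \<and> f z \<le> 1"
    using f(1) by (auto simp: continuous_map_in_subtopology image_subset_iff)
  then show ?thesis using f by (intro that[of "\<lambda>z. 1 - f z"]) (auto intro!: continuous_intros)
qed

text \<open>Compactness of \<open>K\<close> makes continuity of \<open>g (z - a)\<close> in
  \<open>a\<close> uniform over \<open>z \<in> K\<close>; off \<open>K\<close> both values vanish
  for \<open>a \<in> V\<close>.\<close>

lemma bump_function_uniform:
  fixes g :: "'a::topological_ab_group_add \<Rightarrow> real"
  assumes g: "continuous_on UNIV g" and K: "compact K" and V: "open V" "0 \<in> V"
    and supp: "\<And>a z. a \<in> V \<Longrightarrow> z \<notin> K \<Longrightarrow> g z = 0 \<and> g (z - a) = 0" and m: "0 < m"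
  shows "\<forall>\<^sub>F a in nhds 0. \<forall>z. \<bar>g z - g (z - a)\<bar> \<le> m"
proof -
  have "continuous_on (UNIV \<times> K) (\<lambda>q. g (snd q - fst q))"
    by (intro continuous_on_compose2[OF g] continuous_intros) auto
  then obtain X where X: "0 \<in> X" "open X" "\<forall>a\<in>X. \<forall>z\<in>K. dist (g (z - a)) (g z) \<le> m"
    by (rule continuous_on_prod_compactE[OF _ K UNIV_I[of 0] m]) (rule that, simp_all)
  have "\<forall>\<^sub>F a in nhds 0. a \<in> X \<inter> V"
    using X V by (intro eventually_nhds_in_open) auto
  then show ?thesis
  proof eventually_elim
    case (elim a)
    show ?case
    proof
      fix z
      show "\<bar>g z - g (z - a)\<bar> \<le> m"
        using X(3) elim supp[of a z] m by (cases "z \<in> K") (auto simp: dist_real_def abs_minus_commute)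
    qed
  qed
qed

text \<open>For a Haar measure, \<open>\<phi> x\<close> would be the measure of
  \<open>A \<inter> (A - x)\<close>, an autocorrelation and hence positive definite, and
  \<open>\<rho> x\<close> the double integral of \<open>g s * g t * \<phi> (x + s - t)\<close>.
  Shifting \<open>\<rho>\<close> amounts to shifting the continuous bump \<open>g\<close>, so its
  second differences are small in the order of positive definite functions. \<open>A\<close> is so
  small that \<open>\<rho>\<close> vanishes at \<open>x0\<close> but not at 0.\<close>

theorem characters_separate_points:
  fixes x0 :: "'a::{topological_ab_group_add, t2_space}"
  assumes lc: "locally_compact_space (euclidean :: 'a topology)" and x0: "x0 \<noteq> 0"
  obtains y where "y \<in> characters" "y x0 \<noteq> 1"
proof -

  \<comment> \<open>Nested neighbourhoods of 0 and the bump function\<close>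
  have "\<exists>U K. openin euclidean U \<and> compactin euclidean K \<and> (0::'a) \<in> U \<and> U \<subseteq> K"
    using lc unfolding locally_compact_space_def by (rule bspec) simp
  then obtain U K where U: "open U" "(0::'a) \<in> U" "U \<subseteq> K" and K: "compact K"
    by (auto simp: open_openin[symmetric])
  define W where "W = U - {x0}"
  have W: "open W" "0 \<in> W" "W \<subseteq> K" "x0 \<notin> W" using U x0 by (auto simp: W_def open_Diff)
  obtain W1 where W1: "open W1" "0 \<in> W1" "W1 \<subseteq> W" "\<And>x y. x \<in> W1 \<Longrightarrow> y \<in> W1 \<Longrightarrow> x - y \<in> W"
    using diff_nhd[OF W(1,2)] by metis
  obtain W2 where W2: "open W2" "0 \<in> W2" "W2 \<subseteq> W1" "\<And>x y. x \<in> W2 \<Longrightarrow> y \<in> W2 \<Longrightarrow> x - y \<in> W1"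
    using diff_nhd[OF W1(1,2)] by metis
  obtain V where V: "open V" "0 \<in> V" "V \<subseteq> W2" "\<And>x. x \<in> V \<Longrightarrow> - x \<in> V" "\<And>x y. x \<in> V \<Longrightarrow> y \<in> V \<Longrightarrow> x - y \<in> W2"
    using diff_nhd[OF W2(1,2)] by metis
  obtain V' where V': "open V'" "0 \<in> V'" "V' \<subseteq> V" "\<And>x. x \<in> V' \<Longrightarrow> - x \<in> V'" "\<And>x y. x \<in> V' \<Longrightarrow> y \<in> V' \<Longrightarrow> x - y \<in> V"
    using diff_nhd[OF V(1,2)] by metis
  have VK: "V \<subseteq> K" using V(3) W2(3) W1(3) W(3) by blast
  define A where "A = {z. \<exists>u\<in>V. \<exists>v\<in>V. z = u + v}"
  have AW: "A \<subseteq> W2"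
  proof
    fix z assume "z \<in> A"
    then obtain u v where "u \<in> V" "v \<in> V" "z = u - (- v)" unfolding A_def by auto
    then show "z \<in> W2" using V(4)[of v] V(5)[of u "- v"] by simp
  qed
  have AK: "A \<subseteq> K" using AW W2(3) W1(3) W(3) by blast
  \<comment> \<open>Two such points of \<open>A\<close> would put \<open>x0 + u\<close> into
    \<open>W1\<close>; since \<open>u\<close> lies there too, \<open>x0\<close> would fall into
    \<open>W\<close>, from which it was removed.\<close>
  have far: "z + (x0 + u) \<notin> A" if "z \<in> A" "u \<in> V" for z u
  proof
    assume "z + (x0 + u) \<in> A"
    then have "(z + (x0 + u)) - z \<in> W1" using W2(4) AW that by blast
    then have "(x0 + u) - u \<in> W" using V(3) W2(3) that by (intro W1(4)) auto
    then show False using W(4) by simp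
  qed
  obtain g :: "'a \<Rightarrow> real" where g: "continuous_on UNIV g" "\<And>z. 0 \<le> g z" "\<And>z. g z \<le> 1" "g 0 = 1"
    "\<And>z. z \<notin> V' \<Longrightarrow> g z = 0"
    using bump_function[OF lc V'(1,2)] by metis
  \<comment> \<open>Symmetrised to serve as separation neighbourhood; \<open>2 * g\<close> is at
    least 1 on it, which fits the lower bound of \<open>I\<close>.\<close>
  define N where "N = {z. 1/2 < g z} \<inter> {z. 1/2 < g (- z)}"
  have N: "open N" "0 \<in> N" "\<And>x. x \<in> N \<Longrightarrow> - x \<in> N"
  proof -
    have "continuous_on UNIV (\<lambda>z. g (- z))"
      by (intro continuous_on_compose2[OF g(1)] continuous_intros) auto
    then show "open N" unfolding N_def using g(1) by (intro open_Int open_Collect_less) auto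
  qed (use g in \<open>auto simp: N_def\<close>)
  have NV: "N \<subseteq> V'" using g(5) unfolding N_def by force
  obtain \<F> :: "'a list filter" and I :: "'a list \<Rightarrow> ('a \<Rightarrow> real) \<Rightarrow> real" where
    \<F>: "\<F> \<noteq> bot"
    and rep: "\<And>xs K. compact K \<Longrightarrow> \<exists>(D :: (nat \<times> 'a) set) p w. finite D \<and> 0 \<le> w \<and> (\<forall>s\<in>D. p s \<in> K) \<and>
       (\<forall>f. (\<forall>z. z \<notin> K \<longrightarrow> f z = 0) \<longrightarrow> I xs f = w * (\<Sum>s\<in>D. f (p s)))"
    and bnd: "\<And>K. compact K \<Longrightarrow> \<exists>C\<ge>0. \<forall>xs f. \<forall>M::real. (\<forall>z. z \<notin> K \<longrightarrow> f z = 0) \<longrightarrow> (\<forall>z. \<bar>f z\<bar> \<le> M) \<longrightarrow> \<bar>I xs f\<bar> \<le> C * M"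
    and low: "\<And>K. compact K \<Longrightarrow> \<forall>\<^sub>F xs in \<F>. \<forall>f. (\<forall>z. z \<notin> K \<longrightarrow> f z = 0) \<longrightarrow> (\<forall>z. 0 \<le> f z) \<longrightarrow>
       (\<forall>z\<in>N. 1 \<le> f z) \<longrightarrow> 1 \<le> I xs f"
    and inv: "\<And>K a \<epsilon>. compact K \<Longrightarrow> 0 < \<epsilon> \<Longrightarrow> \<forall>\<^sub>F xs in \<F>. \<forall>f. \<forall>M::real. (\<forall>z. z \<notin> K \<longrightarrow> f z = 0) \<longrightarrow>
       (\<forall>z. \<bar>f z\<bar> \<le> M) \<longrightarrow> \<bar>I xs (\<lambda>z. f (z + a)) - I xs f\<bar> \<le> \<epsilon> * M"
    by (rule approximate_Haar_functional[OF N(1,2)], erule N(3), rule that)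

  \<comment> \<open>The autocorrelation \<phi> of the set A\<close>
  define supp where "supp f \<longleftrightarrow> (\<forall>z. z \<notin> K \<longrightarrow> f z = 0)" for f :: "'a \<Rightarrow> real"
  define good where "good xs D p w \<longleftrightarrow> finite D \<and> 0 \<le> w \<and> (\<forall>s\<in>D. p s \<in> K) \<and>
       (\<forall>f. supp f \<longrightarrow> I xs f = w * (\<Sum>s\<in>D. f (p s)))" for xs and D :: "(nat \<times> 'a) set" and p w
  have "\<forall>xs. \<exists>D p w. good xs D p w"
    using rep[OF K] unfolding good_def supp_def ..
  from choice[OF this] obtain D where "\<forall>xs. \<exists>p w. good xs (D xs) p w" ..
  from choice[OF this] obtain p where "\<forall>xs. \<exists>w. good xs (D xs) (p xs) w" ..
  from choice[OF this] obtain w where "\<forall>xs. good xs (D xs) (p xs) (w xs)" ..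
  then have D: "finite (D xs)" "0 \<le> w xs" "\<And>s. s \<in> D xs \<Longrightarrow> p xs s \<in> K" and
    I: "\<And>f. supp f \<Longrightarrow> I xs f = w xs * (\<Sum>s\<in>D xs. f (p xs s))" for xs
    unfolding good_def by simp_all
  obtain C where C: "0 \<le> C" "\<And>xs f M. supp f \<Longrightarrow> (\<And>z. \<bar>f z\<bar> \<le> M) \<Longrightarrow> \<bar>I xs f\<bar> \<le> C * M"
    using bnd[OF K] unfolding supp_def by meson
  have I_mono: "I xs f \<le> I xs f'" if "supp f" "supp f'" "\<And>z. f z \<le> f' z" for xs f f'
    unfolding I[OF that(1)] I[OF that(2)] by (intro mult_left_mono sum_mono that D)
  \<comment> \<open>The integrand is the indicator of \<open>A \<inter> (A - x)\<close>;
    \<open>\<phi> x\<close> is a limit of its values under \<open>I xs\<close>.\<close>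
  define F where "F x z = indicator A z * (indicator A (z + x) :: real)" for x z
  have F: "supp (F x)" "\<bar>F x z\<bar> \<le> 1" "0 \<le> F x z" for x z
    using AK unfolding supp_def F_def by (auto simp: indicator_def)
  have "I xs (F x) \<in> cball 0 C" for xs x
    using C(2)[OF F(1,2), of xs x] by simp
  then obtain G \<phi> where G: "G \<noteq> bot" "G \<le> \<F>" and \<phi>C: "\<And>x. \<phi> x \<in> cball 0 C" and \<phi>: "\<And>x. ((\<lambda>xs. I xs (F x)) \<longlongrightarrow> \<phi> x) G"
    by (rule joint_cluster_filter[OF \<F>, of "\<lambda>xs x. I xs (F x)" "\<lambda>_. cball 0 C"]) (auto intro: compact_cball)
  have \<phi>C': "\<bar>\<phi> x\<bar> \<le> C" for x using \<phi>C[of x] by simp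
  have \<phi>1: "1 \<le> \<phi> u" if "u \<in> V" for u
  proof (rule tendsto_lowerbound[OF \<phi> _ G(1)])
    have "1 \<le> F u z" if "z \<in> N" for z
    proof -
      have "z \<in> V" using NV V' that by auto
      then have "z + 0 \<in> A" "z + u \<in> A" using V(2) \<open>u \<in> V\<close> unfolding A_def by blast+
      then show ?thesis by (simp add: F_def)
    qed
    then have "\<forall>\<^sub>F xs in \<F>. 1 \<le> I xs (F u)"
      using low[OF K] F unfolding supp_def by (auto elim: eventually_mono)
    then show "\<forall>\<^sub>F xs in G. 1 \<le> I xs (F u)" using G(2) filter_leD by blast
  qed
  have \<phi>0: "\<phi> (x0 + u) = 0" if "u \<in> V" for u
  proof -
    have "F (x0 + u) z = 0" for z using far[OF _ that, of z] by (simp add: F_def indicator_def)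
    then have "I xs (F (x0 + u)) = 0" for xs using C(2)[OF F(1), of "x0 + u" 0 xs] by simp
    then show ?thesis using \<phi>[of "x0 + u"] G(1) by (simp add: tendsto_const_iff)
  qed
  have \<phi>_pd: "pos_def (\<lambda>x. complex_of_real (\<phi> x))"
    unfolding pos_def_def
  proof (intro allI)
    fix n :: nat and c :: "nat \<Rightarrow> complex" and x :: "nat \<Rightarrow> 'a"
    define h where "h i z = (indicator A (z + x i) :: real)" for i z
    \<comment> \<open>Products of translated indicators live on translates of \<open>K\<close>, so
      \<open>I\<close> is represented on the union of these.\<close>
    define K' where "K' = (\<Union>i<n. (\<lambda>z. z - x i) ` K)"
    have K': "compact K'"
      unfolding K'_def by (intro compact_UN compact_continuous_image continuous_intros K) auto
    have hK: "z \<notin> K' \<longrightarrow> h i z * h j z = 0" if "i < n" for i j z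
    proof
      assume z: "z \<notin> K'"
      have "z + x i \<notin> K"
      proof
        assume "z + x i \<in> K"
        then have "(z + x i) - x i \<in> K'" unfolding K'_def using that by blast
        then show False using z by simp
      qed
      then show "h i z * h j z = 0" using AK by (auto simp: h_def indicator_def)
    qed
    \<comment> \<open>\<open>h i z * h j z\<close> is \<open>F (x i - x j)\<close> translated by
      \<open>x j\<close>; almost invariance removes the translation in the limit.\<close>
    have lim: "((\<lambda>xs. I xs (\<lambda>z. h i z * h j z)) \<longlongrightarrow> \<phi> (x i - x j)) G" for i j
    proof -
      have "((\<lambda>xs. I xs (\<lambda>z. F (x i - x j) (z + x j)) - I xs (F (x i - x j))) \<longlongrightarrow> 0) \<F>"
      proof (rule tendstoI)
        fix e :: real assume "0 < e"
        then have "0 < e / 2" by simp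
        from inv[OF K this, of "x j"]
        show "\<forall>\<^sub>F xs in \<F>. dist (I xs (\<lambda>z. F (x i - x j) (z + x j)) - I xs (F (x i - x j))) 0 < e"
        proof eventually_elim
          case (elim xs)
          have "\<bar>I xs (\<lambda>z. F (x i - x j) (z + x j)) - I xs (F (x i - x j))\<bar> \<le> e / 2 * 1"
            using elim F(1,2) unfolding supp_def by blast
          then show ?case using \<open>0 < e\<close> by simp
        qed
      qed
      then have "((\<lambda>xs. I xs (\<lambda>z. F (x i - x j) (z + x j)) - I xs (F (x i - x j)) + I xs (F (x i - x j))) \<longlongrightarrow> 0 + \<phi> (x i - x j)) G"
        by (intro tendsto_add \<phi>) (rule tendsto_mono[OF G(2)])
      moreover have "(\<lambda>z. F (x i - x j) (z + x j)) = (\<lambda>z. h i z * h j z)"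
        by (rule ext) (simp add: F_def h_def algebra_simps)
      ultimately show ?thesis by simp
    qed
    show "smear {..<n} c x (\<lambda>x. complex_of_real (\<phi> x)) 0 \<in> \<real>\<^sub>\<ge>\<^sub>0"
    proof (rule Lim_in_closed_set[OF closed_nonneg_Reals_complex _ G(1)])
      show "((\<lambda>xs. \<Sum>i<n. \<Sum>j<n. c i * cnj (c j) * complex_of_real (I xs (\<lambda>z. h i z * h j z))) \<longlongrightarrow>
        smear {..<n} c x (\<lambda>x. complex_of_real (\<phi> x)) 0) G"
        unfolding smear_def add_0_left by (intro tendsto_intros lim)
      show "\<forall>\<^sub>F xs in G. (\<Sum>i<n. \<Sum>j<n. c i * cnj (c j) * complex_of_real (I xs (\<lambda>z. h i z * h j z))) \<in> \<real>\<^sub>\<ge>\<^sub>0"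
      proof (intro always_eventually allI)
        fix xs
        obtain D' :: "(nat \<times> 'a) set" and p' w' where D': "finite D'" "0 \<le> w'"
          "\<forall>f. (\<forall>z. z \<notin> K' \<longrightarrow> f z = 0) \<longrightarrow> I xs f = w' * (\<Sum>s\<in>D'. f (p' s))"
          using rep[OF K', of xs] by blast
        \<comment> \<open>Since \<open>I xs\<close> is a nonnegative sum of point values on
          \<open>K'\<close>, the quadratic form becomes the sum of
          \<open>w' * (cmod (q s))\<^sup>2\<close>.\<close>
        define q where "q s = (\<Sum>i<n. c i * complex_of_real (h i (p' s)))" for s
        have "(\<Sum>i<n. \<Sum>j<n. c i * cnj (c j) * complex_of_real (I xs (\<lambda>z. h i z * h j z))) =
          (\<Sum>i<n. \<Sum>j<n. \<Sum>s\<in>D'. complex_of_real w' * ((c i * complex_of_real (h i (p' s))) * cnj (c j * complex_of_real (h j (p' s)))))"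
        proof (intro sum.cong refl)
          fix i j assume ij: "i \<in> {..<n}" "j \<in> {..<n}"
          have "I xs (\<lambda>z. h i z * h j z) = w' * (\<Sum>s\<in>D'. h i (p' s) * h j (p' s))"
            using D'(3) hK ij by simp
          then show "c i * cnj (c j) * complex_of_real (I xs (\<lambda>z. h i z * h j z)) =
            (\<Sum>s\<in>D'. complex_of_real w' * ((c i * complex_of_real (h i (p' s))) * cnj (c j * complex_of_real (h j (p' s)))))"
            by (simp add: sum_distrib_left mult_ac)
        qed
        also have "\<dots> = (\<Sum>i<n. \<Sum>s\<in>D'. \<Sum>j<n. complex_of_real w' * ((c i * complex_of_real (h i (p' s))) * cnj (c j * complex_of_real (h j (p' s)))))"
          by (intro sum.cong refl sum.swap)
        also have "\<dots> = (\<Sum>s\<in>D'. \<Sum>i<n. \<Sum>j<n. complex_of_real w' * ((c i * complex_of_real (h i (p' s))) * cnj (c j * complex_of_real (h j (p' s)))))"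
          by (rule sum.swap)
        also have "\<dots> = (\<Sum>s\<in>D'. complex_of_real w' * (q s * cnj (q s)))"
          unfolding q_def cnj_sum
          unfolding sum_product
          unfolding sum_distrib_left ..
        also have "\<dots> = complex_of_real (\<Sum>s\<in>D'. w' * (cmod (q s))\<^sup>2)"
          by (simp add: complex_norm_square[symmetric])
        also have "\<dots> \<in> \<real>\<^sub>\<ge>\<^sub>0"
          using D'(2) by (simp only: nonneg_Reals_of_real_iff) (intro sum_nonneg mult_nonneg_nonneg, auto)
        finally show "(\<Sum>i<n. \<Sum>j<n. c i * cnj (c j) * complex_of_real (I xs (\<lambda>z. h i z * h j z))) \<in> \<real>\<^sub>\<ge>\<^sub>0" .
      qed
    qed
  qed

  \<comment> \<open>The smoothed autocorrelation \<rho>\<close>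
  define J where "J xs v y = I xs (\<lambda>t. v t * \<phi> (y - t))" for xs v y
  \<comment> \<open>Two slots, so that each can be translated separately. On the diagonal
    \<open>B xs u u\<close> is a smear of \<open>\<phi>\<close> with weights
    \<open>w xs * u (p xs s)\<close>.\<close>
  define B where "B xs u v x = I xs (\<lambda>s. u s * J xs v (x + s))" for xs u v x
  have suppM: "supp (\<lambda>t. v t * f t)" if "supp v" for v f :: "'a \<Rightarrow> real"
    using that by (simp add: supp_def)
  have J: "J xs v y = w xs * (\<Sum>t\<in>D xs. v (p xs t) * \<phi> (y - p xs t))" if "supp v" for xs v y
    unfolding J_def by (rule I[OF suppM[OF that]])
  have B: "B xs u v x = w xs * (\<Sum>s\<in>D xs. u (p xs s) * J xs v (x + p xs s))" if "supp u" for xs u v x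
    unfolding B_def by (rule I[OF suppM[OF that]])
  have prod_le: "\<bar>u * v\<bar> \<le> a * b" if "\<bar>u\<bar> \<le> a" "\<bar>v\<bar> \<le> b" for u v a b :: real
    unfolding abs_mult using that by (intro mult_mono) auto
  have J_bound: "\<bar>J xs v y\<bar> \<le> C * (M * C)" if "supp v" "\<And>z. \<bar>v z\<bar> \<le> M" for xs v y M
    unfolding J_def by (rule C(2)[OF suppM[OF that(1)] prod_le[OF that(2) \<phi>C']])
  have B_bound: "\<bar>B xs u v x\<bar> \<le> C * (1 * (C * (1 * C)))" if "supp u" "\<And>z. \<bar>u z\<bar> \<le> 1" "supp v" "\<And>z. \<bar>v z\<bar> \<le> 1" for xs u v x
    unfolding B_def by (rule C(2)[OF suppM[OF that(1)] prod_le[OF that(2) J_bound[OF that(3,4)]]])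
  have smear_B: "smear (D xs) (\<lambda>s. complex_of_real (w xs * u (p xs s))) (p xs) (\<lambda>x. complex_of_real (\<phi> x)) x
      = complex_of_real (B xs u u x)" if "supp u" for xs u x
  proof -
    have "B xs u u x = (\<Sum>s\<in>D xs. \<Sum>t\<in>D xs. (w xs * u (p xs s)) * (w xs * u (p xs t)) * \<phi> (x + p xs s - p xs t))"
      unfolding B[OF that] J[OF that] sum_distrib_left by (simp only: mult_ac)
    then show ?thesis unfolding smear_def by simp
  qed
  have B_pd: "pos_def (\<lambda>x. complex_of_real (B xs u u x))"
    and B_le: "\<And>M. (\<And>z. \<bar>u z\<bar> \<le> M) \<Longrightarrow>
      pos_def (\<lambda>x. complex_of_real ((C * M)\<^sup>2) * complex_of_real (\<phi> x) - complex_of_real (B xs u u x))"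
    if "supp u" for xs u
  proof -
    show "pos_def (\<lambda>x. complex_of_real (B xs u u x))"
      using pos_def_smear[OF \<phi>_pd D(1), of xs "\<lambda>s. complex_of_real (w xs * u (p xs s))" "p xs"]
      unfolding smear_B[OF that, abs_def] .
    fix M assume M: "\<And>z. \<bar>u z\<bar> \<le> M"
    have sa: "supp (\<lambda>z. \<bar>u z\<bar>)" using that by (simp add: supp_def)
    \<comment> \<open>The total weight of the smear is \<open>I\<close> of the absolute value of
      \<open>u\<close>; this is where the constant \<open>(C * M)\<^sup>2\<close> comes
      from.\<close>
    have "(\<Sum>s\<in>D xs. cmod (complex_of_real (w xs * u (p xs s)))) = I xs (\<lambda>z. \<bar>u z\<bar>)"
      unfolding I[OF sa] using D(2) by (simp add: sum_distrib_left abs_mult norm_mult)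
    also have "\<dots> \<le> C * M"
      using C(2)[OF sa, of M xs] M by simp
    finally show "pos_def (\<lambda>x. complex_of_real ((C * M)\<^sup>2) * complex_of_real (\<phi> x) - complex_of_real (B xs u u x))"
      unfolding smear_B[OF that, symmetric] by (rule pos_def_smear_le[OF \<phi>_pd D(1)])
  qed
  have g1: "supp g" "\<bar>g z\<bar> \<le> 1" for z
    using g(2,3,5)[of z] g(5) V'(3) VK unfolding supp_def by (auto simp: abs_le_iff)
  have "B xs g g x \<in> cball 0 (C * (1 * (C * (1 * C))))" for xs x
    using B_bound[OF g1 g1, of xs x] by simp
  then obtain G' \<rho> where G': "G' \<noteq> bot" "G' \<le> G" and \<rho>: "\<And>x. ((\<lambda>xs. B xs g g x) \<longlongrightarrow> \<rho> x) G'"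
    by (rule joint_cluster_filter[OF G(1), of "\<lambda>xs. B xs g g"]) (auto intro: compact_cball)
  have G'F: "G' \<le> \<F>" using G'(2) G(2) by simp
  \<comment> \<open>\<open>\<eta>\<close> is the constant of \<open>B_le\<close> for the difference
    of \<open>g\<close> and its translate by \<open>a\<close>.\<close>
  define E where "E = {(a, \<eta>). a \<in> V' \<and> (\<exists>m\<ge>0. (\<forall>z. \<bar>g z - g (z - a)\<bar> \<le> m) \<and> \<eta> = (C * m)\<^sup>2)}"

  \<comment> \<open>Second differences of \<rho>\<close>
  have twist_pd: "pos_def (\<lambda>x. complex_of_real \<eta> * complex_of_real (\<phi> x) - twist (-1) a (\<lambda>x. complex_of_real (\<rho> x)) x)"
    if E: "(a, \<eta>) \<in> E" for a \<eta>
  proof -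
    obtain m where m: "a \<in> V'" "0 \<le> m" "\<And>z. \<bar>g z - g (z - a)\<bar> \<le> m" "\<eta> = (C * m)\<^sup>2"
      using E unfolding E_def by blast
    define g' where "g' z = g (z - a)" for z
    define h where "h z = g z - g' z" for z
    have g': "supp g'" "\<bar>g' z\<bar> \<le> 1" for z
    proof -
      have "g (z - a) = 0" if "z \<notin> K" for z
      proof (rule g(5), rule notI)
        assume "z - a \<in> V'"
        then have "(z - a) - (- a) \<in> V" using m(1) V'(4,5) by blast
        then show False using that VK by auto
      qed
      then show "supp g'" "\<bar>g' z\<bar> \<le> 1" using g1(2) by (auto simp: supp_def g'_def)
    qed
    have h: "supp h" "\<And>z. \<bar>h z\<bar> \<le> m" using g1(1) g'(1) m(3) by (auto simp: supp_def h_def g'_def)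
    have null: "(e \<longlongrightarrow> 0) \<F>" if "\<And>\<epsilon>. 0 < \<epsilon> \<Longrightarrow> \<forall>\<^sub>F xs in \<F>. \<bar>e xs\<bar> \<le> c * \<epsilon>" "0 \<le> c" for e :: "'a list \<Rightarrow> real" and c
    proof (rule tendstoI)
      fix \<epsilon> :: real assume "0 < \<epsilon>"
      then have pos: "0 < \<epsilon> / (c + 1)" using that(2) by simp
      have lt: "c * (\<epsilon> / (c + 1)) < \<epsilon>" using \<open>0 < \<epsilon>\<close> that(2) by (simp add: divide_less_eq field_simps)
      show "\<forall>\<^sub>F xs in \<F>. dist (e xs) 0 < \<epsilon>"
        using that(1)[OF pos] lt by (auto elim: eventually_mono)
    qed
    \<comment> \<open>The substitution \<open>z - a\<close> for \<open>z\<close> moves a translation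
      of the first slot to the argument, with an error that dies along the filter. In
      \<open>shift2\<close> the second slot moves the argument the opposite way.\<close>
    have shift1: "((\<lambda>xs. B xs g' v x - B xs g v (x + a)) \<longlongrightarrow> 0) \<F>" if v: "supp v" "\<And>z. \<bar>v z\<bar> \<le> 1" for v x
    proof (rule null)
      show "0 \<le> C * (1 * C)" using C by simp
      fix \<epsilon> :: real assume "0 < \<epsilon>"
      from inv[OF K this, of "- a"]
      show "\<forall>\<^sub>F xs in \<F>. \<bar>B xs g' v x - B xs g v (x + a)\<bar> \<le> C * (1 * C) * \<epsilon>"
      proof eventually_elim
        case (elim xs)
        define f where "f z = g z * J xs v (x + a + z)" for z
        have f: "supp f" "\<And>z. \<bar>f z\<bar> \<le> 1 * (C * (1 * C))" unfolding f_def
          by (rule suppM[OF g1(1)], rule prod_le[OF g1(2) J_bound[OF v]])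
        have "\<bar>I xs (\<lambda>z. f (z + (- a))) - I xs f\<bar> \<le> \<epsilon> * (1 * (C * (1 * C)))"
          using elim f unfolding supp_def by blast
        moreover have "(\<lambda>z. f (z + (- a))) = (\<lambda>z. g' z * J xs v (x + z))"
          by (rule ext) (simp add: f_def g'_def algebra_simps)
        ultimately show ?case unfolding B_def f_def by (simp add: mult_ac)
      qed
    qed
    have shift2: "((\<lambda>xs. B xs u g' x - B xs u g (x - a)) \<longlongrightarrow> 0) \<F>" if u: "supp u" "\<And>z. \<bar>u z\<bar> \<le> 1" for u x
    proof (rule null)
      show "0 \<le> C * (1 * C)" using C by simp
      fix \<epsilon> :: real assume "0 < \<epsilon>"
      from inv[OF K this, of "- a"]
      show "\<forall>\<^sub>F xs in \<F>. \<bar>B xs u g' x - B xs u g (x - a)\<bar> \<le> C * (1 * C) * \<epsilon>"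
      proof eventually_elim
        case (elim xs)
        have diff: "\<bar>J xs g' y - J xs g (y - a)\<bar> \<le> \<epsilon> * (1 * C)" for y
        proof -
          define f where "f t = g t * \<phi> (y - a - t)" for t
          have f: "supp f" "\<And>z. \<bar>f z\<bar> \<le> 1 * C" unfolding f_def
            by (rule suppM[OF g1(1)], rule prod_le[OF g1(2) \<phi>C'])
          have "\<bar>I xs (\<lambda>z. f (z + (- a))) - I xs f\<bar> \<le> \<epsilon> * (1 * C)"
            using elim f unfolding supp_def by blast
          moreover have "(\<lambda>z. f (z + (- a))) = (\<lambda>z. g' z * \<phi> (y - z))"
            by (rule ext) (simp add: f_def g'_def algebra_simps)
          ultimately show ?thesis unfolding J_def f_def by simp
        qed
        have "B xs u g' x - B xs u g (x - a) = I xs (\<lambda>s. u s * (J xs g' (x + s) - J xs g (x + s - a)))"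
          unfolding B[OF u(1)] I[OF suppM[OF u(1)]]
          by (simp add: right_diff_distrib sum_subtractf algebra_simps)
        also have "\<bar>\<dots>\<bar> \<le> C * (1 * (\<epsilon> * (1 * C)))"
          by (rule C(2)[OF suppM[OF u(1)] prod_le[OF u(2) diff]])
        finally show ?case by (simp add: mult_ac)
      qed
    qed
    have Bh: "B xs h h x = B xs g g x - B xs g' g x - B xs g g' x + B xs g' g' x" for xs x
    proof -
      have Jh: "J xs h y = J xs g y - J xs g' y" for y
        unfolding J[OF h(1)] J[OF g1(1)] J[OF g'(1)] h_def
        by (simp add: sum_subtractf sum.distrib algebra_simps)
      then show ?thesis
        unfolding B[OF h(1)] B[OF g1(1)] B[OF g'(1)] Jh unfolding h_def
        by (simp add: sum_subtractf sum.distrib algebra_simps)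
    qed
    \<comment> \<open>Of the four terms of \<open>B xs h h x\<close>, the mixed ones tend to
      \<open>\<rho> (x + a)\<close> and \<open>\<rho> (x - a)\<close>; in the last one the two
      shifts cancel.\<close>
    have "((\<lambda>xs. B xs h h x) \<longlongrightarrow> 2 * \<rho> x - \<rho> (x + a) - \<rho> (x - a)) G'" for x
    proof -
      have "((\<lambda>xs. 2 * B xs g g x - B xs g g (x + a) - B xs g g (x - a)
         - (B xs g' g x - B xs g g (x + a)) - (B xs g g' x - B xs g g (x - a))
         + (B xs g' g' x - B xs g g' (x + a)) + (B xs g g' (x + a) - B xs g g (x + a - a))) \<longlongrightarrow>
         2 * \<rho> x - \<rho> (x + a) - \<rho> (x - a) - 0 - 0 + 0 + 0) G'"
        by (intro tendsto_intros \<rho> tendsto_mono[OF G'F] shift1 shift2 g1 g')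
      then show ?thesis by (simp add: Bh algebra_simps)
    qed
    then have "((\<lambda>xs. complex_of_real \<eta> * complex_of_real (\<phi> x) - complex_of_real (B xs h h x)) \<longlongrightarrow>
      complex_of_real \<eta> * complex_of_real (\<phi> x) - complex_of_real (2 * \<rho> x - \<rho> (x + a) - \<rho> (x - a))) G'" for x
      by (intro tendsto_intros)
    moreover have "\<forall>\<^sub>F xs in G'. pos_def (\<lambda>x. complex_of_real \<eta> * complex_of_real (\<phi> x) - complex_of_real (B xs h h x))"
      unfolding m(4) using B_le[OF h(1) h(2)] by (intro always_eventually allI)
    ultimately have "pos_def (\<lambda>x. complex_of_real \<eta> * complex_of_real (\<phi> x) - complex_of_real (2 * \<rho> x - \<rho> (x + a) - \<rho> (x - a)))"
      by (intro pos_def_lim[OF G'(1)])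
    then show ?thesis by (simp add: twist_eq)
  qed

  \<comment> \<open>The pair is dominated and distinguishes x0 from 0\<close>
  have \<rho>C: "((\<lambda>xs. complex_of_real (B xs g g x)) \<longlongrightarrow> complex_of_real (\<rho> x)) G'" for x
    by (intro tendsto_intros \<rho>)
  have dom: "dominated_pair ((C * 1)\<^sup>2) E (\<lambda>x. complex_of_real (\<phi> x)) (\<lambda>x. complex_of_real (\<rho> x))"
    unfolding dominated_pair_def
  proof (intro conjI)
    show "pos_def (\<lambda>x. complex_of_real (\<rho> x))"
      by (rule pos_def_lim[OF G'(1) _ \<rho>C]) (intro always_eventually allI B_pd g1)
    show "pos_def (\<lambda>x. complex_of_real ((C * 1)\<^sup>2) * complex_of_real (\<phi> x) - complex_of_real (\<rho> x))"
    proof (rule pos_def_lim[OF G'(1)])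
      show "\<forall>\<^sub>F xs in G'. pos_def (\<lambda>x. complex_of_real ((C * 1)\<^sup>2) * complex_of_real (\<phi> x) - complex_of_real (B xs g g x))"
        by (intro always_eventually allI B_le g1)
    qed (intro tendsto_intros \<rho>C)
  qed (use \<phi>_pd twist_pd in auto)
  have \<phi>00: "1 \<le> \<phi> 0" by (rule \<phi>1[OF V(2)])
  have small: "\<forall>\<^sub>F a in nhds 0. \<exists>\<eta><\<epsilon>. (a, \<eta>) \<in> E" if "0 < \<epsilon>" for \<epsilon>
  proof -
    \<comment> \<open>Makes \<open>(C * m)\<^sup>2\<close> smaller than \<open>\<epsilon>\<close>,
      with the added 1 guarding against \<open>C = 0\<close>.\<close>
    define m where "m = sqrt \<epsilon> / (C + 1)"
    have m: "0 < m" using that C(1) by (simp add: m_def)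
    have "C * m < sqrt \<epsilon>" using that C(1) by (simp add: m_def divide_less_eq field_simps)
    then have "(C * m)\<^sup>2 < (sqrt \<epsilon>)\<^sup>2" using m C(1) by (intro power_strict_mono) auto
    then have lt: "(C * m)\<^sup>2 < \<epsilon>" using that by simp
    have "\<forall>\<^sub>F a in nhds 0. \<forall>z. \<bar>g z - g (z - a)\<bar> \<le> m"
    proof (rule bump_function_uniform[OF g(1) K V'(1,2) _ m])
      fix a z assume az: "a \<in> V'" "z \<notin> K"
      have "z - a \<notin> V'"
      proof
        assume "z - a \<in> V'"
        then have "(z - a) - (- a) \<in> V" using az(1) V'(4,5) by blast
        then show False using az VK by auto
      qed
      moreover have "z \<notin> V'" using az V'(3) VK by auto
      ultimately show "g z = 0 \<and> g (z - a) = 0" using g(5) by blast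
    qed
    moreover have "\<forall>\<^sub>F a in nhds 0. a \<in> V'" using V' by (intro eventually_nhds_in_open) auto
    ultimately show ?thesis
    proof eventually_elim
      case (elim a)
      then have "(a, (C * m)\<^sup>2) \<in> E" unfolding E_def using m by (auto intro!: exI[of _ m])
      then show ?case using lt by blast
    qed
  qed
  have \<rho>x0: "\<rho> x0 = 0"
  proof -
    have "B xs g g x0 = 0" for xs
    proof -
      \<comment> \<open>If both \<open>g\<close>-factors are nonzero, \<open>p xs s - p xs t\<close>
        lies in \<open>V\<close>, and \<open>\<phi>\<close> vanishes on
        \<open>x0 + V\<close>.\<close>
      have z: "g (p xs s) * (g (p xs t) * \<phi> (x0 + p xs s - p xs t)) = 0" for s t
        using g(5)[of "p xs s"] g(5)[of "p xs t"] V'(5)[of "p xs s" "p xs t"] \<phi>0[of "p xs s - p xs t"]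
        by (auto simp: add_diff_eq)
      then show ?thesis unfolding B[OF g1(1)] J[OF g1(1)] sum_distrib_left
        by (intro sum.neutral ballI) (simp add: mult.left_commute)
    qed
    then show ?thesis using \<rho>[of x0] G'(1) by (simp add: tendsto_const_iff)
  qed
  \<comment> \<open>Each slot contributes a factor 1/2, because \<open>2 * g\<close> is at least 1
    on \<open>N\<close>; the kernel \<open>\<phi>\<close> is at least 1 on differences of points of
    \<open>V'\<close>.\<close>
  have \<rho>0: "1 / 4 \<le> \<rho> 0"
  proof (rule tendsto_lowerbound[OF \<rho> _ G'(1)])
    have "\<forall>\<^sub>F xs in \<F>. 1 / 4 \<le> B xs g g 0"
      using low[OF K]
    proof eventually_elim
      case (elim xs)
      have "supp (\<lambda>z. 2 * g z)" using g1(1) by (simp add: supp_def)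
      have "1 \<le> I xs (\<lambda>z. 2 * g z)"
        using elim \<open>supp (\<lambda>z. 2 * g z)\<close> g(2) unfolding supp_def by (auto simp: N_def)
      also have "\<dots> = 2 * I xs g" unfolding I[OF g1(1)] I[OF \<open>supp (\<lambda>z. 2 * g z)\<close>] by (simp add: sum_distrib_left mult_ac)
      finally have Ig: "1 / 2 \<le> I xs g" by simp
      have "g s * I xs g \<le> g s * J xs g (0 + s)" for s
      proof (cases "s \<in> V'")
        case True
        have "g t \<le> g t * \<phi> (0 + s - t)" for t
          using g(5)[of t] g(2)[of t] V'(5)[OF True, of t] \<phi>1[of "s - t"]
          by (cases "t \<in> V'") (auto intro: mult_left_mono[of 1 _ "g t", simplified])
        then have "I xs g \<le> J xs g (0 + s)" unfolding J_def by (intro I_mono g1 suppM) auto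
        then show ?thesis using g(2) by (intro mult_left_mono) auto
      qed (use g(5) in simp)
      then have "I xs (\<lambda>s. g s * I xs g) \<le> B xs g g 0" unfolding B_def by (intro I_mono g1 suppM)
      moreover have "I xs (\<lambda>s. g s * I xs g) = I xs g * I xs g"
        unfolding I[OF suppM[OF g1(1), of "\<lambda>_. I xs g"]] by (subst (2) I[OF g1(1)]) (simp add: sum_distrib_left[symmetric] mult_ac)
      moreover have "1 / 2 * (1 / 2) \<le> I xs g * I xs g" using Ig by (intro mult_mono) auto
      ultimately show ?case by simp
    qed
    then show "\<forall>\<^sub>F xs in G'. 1 / 4 \<le> B xs g g 0" using G'F filter_leD by blast
  qed
  define r where "r = 1 / \<phi> 0"
  have r: "0 < r" "r * \<phi> 0 = 1" using \<phi>00 by (auto simp: r_def)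
  show ?thesis
  proof (rule character_of_dominated_pair[OF dominated_pair_cmult[OF dom less_imp_le[OF r(1)]] _ small])
    show "complex_of_real r * complex_of_real (\<phi> 0) = 1" using r(2) by (simp flip: of_real_mult)
    show "Re (complex_of_real r * complex_of_real (\<rho> x0)) < Re (complex_of_real r * complex_of_real (\<rho> 0))"
      using r(1) \<rho>x0 \<rho>0 by simp
  qed (assumption, rule that)
qed

section \<open>Uniqueness of measures\<close>

inductive_set trig_span :: "('z \<Rightarrow> complex) set \<Rightarrow> ('z \<Rightarrow> complex) set" for G where
  base: "g \<in> G \<Longrightarrow> g \<in> trig_span G"
| add: "f \<in> trig_span G \<Longrightarrow> g \<in> trig_span G \<Longrightarrow> (\<lambda>x. f x + g x) \<in> trig_span G"
| scale: "f \<in> trig_span G \<Longrightarrow> (\<lambda>x. c * f x) \<in> trig_span G"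

text \<open>Instantiated three times: by the characters of X, by their extensions to two copies of
  X, and by the functions k(c x) l(d x') on X \<times> X.\<close>

locale separating_characters =
  fixes G :: "('z::{second_countable_topology, t2_space} \<Rightarrow> complex) set"
  assumes cont: "g \<in> G \<Longrightarrow> continuous_on UNIV g"
    and norm_le: "g \<in> G \<Longrightarrow> cmod (g x) \<le> 1"
    and one: "(\<lambda>_. 1) \<in> G"
    and mult: "g \<in> G \<Longrightarrow> h \<in> G \<Longrightarrow> (\<lambda>x. g x * h x) \<in> G"
    and cnj: "g \<in> G \<Longrightarrow> (\<lambda>x. cnj (g x)) \<in> G"
    and sep: "x \<noteq> x' \<Longrightarrow> \<exists>g\<in>G. g x \<noteq> g x'"
begin

lemma span_cont: "f \<in> trig_span G \<Longrightarrow> continuous_on UNIV f"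
  by (induction rule: trig_span.induct) (auto intro: cont continuous_on_add continuous_on_mult_left)

lemma span_bounded: "f \<in> trig_span G \<Longrightarrow> \<exists>b. \<forall>x. cmod (f x) \<le> b"
proof (induction rule: trig_span.induct)
  case (base g)
  then show ?case using norm_le by blast
next
  case (add f g)
  then obtain a b where "\<forall>x. cmod (f x) \<le> a" "\<forall>x. cmod (g x) \<le> b" by blast
  then show ?case by (intro exI[of _ "a + b"]) (meson add_mono norm_triangle_ineq order_trans)
next
  case (scale f c)
  then obtain a where "\<forall>x. cmod (f x) \<le> a" by blast
  then show ?case by (intro exI[of _ "cmod c * a"]) (auto simp: norm_mult intro: mult_left_mono)
qed

lemma span_mult:
  assumes "f \<in> trig_span G" "g \<in> trig_span G"
  shows "(\<lambda>x. f x * g x) \<in> trig_span G"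
proof -
  have base: "(\<lambda>x. f x * g x) \<in> trig_span G" if "f \<in> G" "g \<in> trig_span G" for f g
    using that(2)
  proof (induction rule: trig_span.induct)
    case (base g)
    then show ?case using mult that(1) by (intro trig_span.base)
  next
    case (add g h)
    then show ?case using trig_span.add[OF add.IH] by (simp add: algebra_simps)
  next
    case (scale g c)
    then show ?case using trig_span.scale[OF scale.IH, of c] by (simp add: algebra_simps)
  qed
  show ?thesis using assms(1)
  proof (induction rule: trig_span.induct)
    case (base f)
    then show ?case using \<open>g \<in> trig_span G\<close> by (rule \<open>\<And>f g. f \<in> G \<Longrightarrow> g \<in> trig_span G \<Longrightarrow> _\<close>)
  next
    case (add g h)
    then show ?case using trig_span.add[OF add.IH] by (simp add: algebra_simps)
  next
    case (scale g c)
    then show ?case using trig_span.scale[OF scale.IH, of c] by (simp add: algebra_simps)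
  qed
qed

definition "R = {h. (\<lambda>x. complex_of_real (h x)) \<in> trig_span G}"

lemma R_const: "(\<lambda>_. r) \<in> R"
  using trig_span.scale[OF trig_span.base[OF one], of "complex_of_real r"] by (simp add: R_def)

lemma R_add: "f \<in> R \<Longrightarrow> g \<in> R \<Longrightarrow> (\<lambda>x. f x + g x) \<in> R"
  using trig_span.add by (auto simp: R_def)

lemma R_mult: "f \<in> R \<Longrightarrow> g \<in> R \<Longrightarrow> (\<lambda>x. f x * g x) \<in> R"
  using span_mult by (auto simp: R_def)

lemma R_sum: "(\<And>i. i \<in> I \<Longrightarrow> f i \<in> R) \<Longrightarrow> (\<lambda>x. \<Sum>i\<in>I. f i x) \<in> R"
  by (induction I rule: infinite_finite_induct) (auto intro!: R_add R_const)

lemma R_polynomial: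
  assumes "real_polynomial_function p" "h \<in> R"
  shows "(\<lambda>x. p (h x)) \<in> R"
  using assms(1)
proof (induction rule: real_polynomial_function.induct)
  case (linear f)
  then have "f x = x * f 1" for x
    using linear_simps(5)[OF linear, of x 1] by simp
  then have "(\<lambda>x. f (h x)) = (\<lambda>x. h x * f 1)" by metis
  then show ?case using R_mult[OF assms(2) R_const] by simp
qed (auto intro: R_const R_add R_mult)

lemma R_cont: "h \<in> R \<Longrightarrow> continuous_on UNIV h"
proof -
  assume "h \<in> R"
  then have "continuous_on UNIV (\<lambda>x. Re (complex_of_real (h x)))"
    unfolding R_def by (intro continuous_intros span_cont) simp
  then show ?thesis by simp
qed

lemma R_bounded: "h \<in> R \<Longrightarrow> \<exists>b. \<forall>x. \<bar>h x\<bar> \<le> b"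
  using span_bounded[of "\<lambda>x. complex_of_real (h x)"] by (auto simp: R_def)

text \<open>With \<open>c = g z\<close> this is a nonnegative member of \<open>R\<close> that
  vanishes exactly where \<open>g\<close> takes the value \<open>g z\<close>.\<close>

lemma R_dist: "g \<in> G \<Longrightarrow> (\<lambda>x. (cmod (g x - c))\<^sup>2) \<in> R"
proof -
  assume g: "g \<in> G"
  have "(\<lambda>x. g x + (- c) * 1) \<in> trig_span G" "(\<lambda>x. cnj (g x) + (- cnj c) * 1) \<in> trig_span G"
    by (rule trig_span.add[OF trig_span.base[OF g] trig_span.scale[OF trig_span.base[OF one]]],
        rule trig_span.add[OF trig_span.base[OF cnj[OF g]] trig_span.scale[OF trig_span.base[OF one]]])
  from span_mult[OF this] show ?thesis
    by (simp add: R_def complex_norm_square mult_ac del: of_real_power)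
qed

text \<open>For \<open>z\<close> outside \<open>C\<close>, finitely many functions
  \<open>d c\<close>, each vanishing at \<open>z\<close>, have a sum that is positive on the compact
  set \<open>C\<close>; hence some superlevel set contains \<open>C\<close> and misses
  \<open>z\<close>. The Lindeloef property leaves countably many of these.\<close>

lemma compact_countable_Inter:
  assumes C: "compact C"
  obtains \<H> where "countable \<H>" "\<H> \<subseteq> {{x. \<delta> \<le> h x} | h \<delta>. h \<in> R}" "C = \<Inter> \<H>"
proof -
  define \<U> where "\<U> = {{x. h x < \<delta>} | h \<delta>. h \<in> R \<and> (\<forall>c\<in>C. \<delta> \<le> h c)}"
  have op: "open U" if "U \<in> \<U>" for U
    using that unfolding \<U>_def by (auto intro!: open_Collect_less R_cont continuous_intros)
  have "\<exists>U\<in>\<U>. z \<in> U" if z: "z \<notin> C" for z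
  proof -
    have "\<forall>c\<in>C. \<exists>g. g \<in> G \<and> g c \<noteq> g z" using sep z by metis
    from bchoice[OF this] obtain g where g: "\<forall>c\<in>C. g c \<in> G \<and> g c c \<noteq> g c z" by auto
    define d where "d c x = (cmod (g c x - g c z))\<^sup>2" for c x
    have d: "d c \<in> R" "0 < d c c" "0 \<le> d c x" "d c z = 0" if "c \<in> C" for c x
      using g that unfolding d_def by (auto intro!: R_dist)
    have cov: "C \<subseteq> (\<Union>c\<in>C. {x. 0 < d c x})" using d by auto
    have opn: "\<And>c. c \<in> C \<Longrightarrow> open {x. 0 < d c x}"
      using d by (auto intro!: open_Collect_less R_cont continuous_intros)
    obtain I where I: "I \<subseteq> C" "finite I" "C \<subseteq> (\<Union>c\<in>I. {x. 0 < d c x})"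
      by (rule compactE_image[OF C opn cov], assumption, rule that)
    define h where "h x = (\<Sum>c\<in>I. d c x)" for x
    have hR: "h \<in> R" unfolding h_def using d I by (intro R_sum) auto
    have hpos: "0 < h x" if xC: "x \<in> C" for x
    proof -
      obtain c where "c \<in> I" "0 < d c x" using I(3) xC by auto
      then show ?thesis unfolding h_def using d I by (intro sum_pos2[of _ c]) auto
    qed
    have hz: "h z = 0" unfolding h_def using d I by (intro sum.neutral) auto
    have "\<exists>\<delta>>0. \<forall>c\<in>C. \<delta> \<le> h c"
    proof (cases "C = {}")
      case False
      then obtain c where "c \<in> C" "\<forall>x\<in>C. h c \<le> h x"
        using continuous_attains_inf[OF C False continuous_on_subset[OF R_cont[OF hR]]] by blast
      then show ?thesis using hpos by blast
    qed (auto intro: exI[of _ 1])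
    then obtain \<delta> where "\<delta> > 0" "\<forall>c\<in>C. \<delta> \<le> h c" by blast
    then show ?thesis unfolding \<U>_def using hR hz by (intro bexI[of _ "{x. h x < \<delta>}"]) auto
  qed
  then have cover: "- C = \<Union> \<U>" unfolding \<U>_def by force
  obtain \<V> where \<V>: "\<V> \<subseteq> \<U>" "countable \<V>" "\<Union> \<V> = \<Union> \<U>" using Lindelof[OF op] by metis
  show ?thesis
  proof
    show "countable (uminus ` \<V>)" using \<V> by simp
    have "C = - \<Union> \<V>" using cover \<V>(3) by (metis double_complement)
    then show "C = \<Inter> (uminus ` \<V>)" by (simp only:) auto
    show "uminus ` \<V> \<subseteq> {{x. \<delta> \<le> h x} | h \<delta>. h \<in> R}"
    proof
      fix A assume "A \<in> uminus ` \<V>"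
      then obtain h \<delta> where "h \<in> R" "A = - {x. h x < \<delta>}" using \<V>(1) unfolding \<U>_def by blast
      moreover have "- {x. h x < \<delta>} = {x. \<delta> \<le> h x}" by auto
      ultimately show "A \<in> {{x. \<delta> \<le> h x} | h \<delta>. h \<in> R}" by blast
    qed
  qed
qed

text \<open>Uniform approximation on the whole space can fail without compactness, so equality of
  integrals is propagated in stages: from \<open>R\<close> to continuous functions of one member of
  \<open>R\<close>, by Weierstrass on its bounded range, then to indicators of superlevel sets, then
  to compact sets and, through the exhaustion \<open>K\<close>, to closed sets.\<close>

lemma measure_eq:
  fixes M N :: "'z measure" and K :: "nat \<Rightarrow> 'z set"
  assumes M: "finite_measure M" "sets M = sets borel" and N: "finite_measure N" "sets N = sets borel"
    and K: "\<And>n. compact (K n)" "(\<Union>n. K n) = UNIV"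
    and eq: "\<And>g. g \<in> G \<Longrightarrow> (\<integral>x. g x \<partial>M) = (\<integral>x. g x \<partial>N)"
  shows "M = N"
proof -
  interpret M: finite_measure M by fact
  interpret N: finite_measure N by fact
  note [measurable_cong] = M(2) N(2)
  have int: "integrable M f" "integrable N f"
    if "f \<in> borel_measurable borel" "\<And>x. norm (f x) \<le> b" for f :: "'z \<Rightarrow> 'b::{banach, second_countable_topology}" and b
    using that by (auto intro!: M.integrable_const_bound[of _ b] N.integrable_const_bound[of _ b] simp: measurable_cong_sets[OF M(2) refl] measurable_cong_sets[OF N(2) refl])
  have span_meas: "f \<in> borel_measurable borel" if "f \<in> trig_span G" for f
    using span_cont[OF that] by (rule borel_measurable_continuous_onI)
  have span_int: "integrable M f" "integrable N f" if f: "f \<in> trig_span G" for f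
    using span_bounded[OF f] int[OF span_meas[OF f]] by auto
  have span_eq: "(\<integral>x. f x \<partial>M) = (\<integral>x. f x \<partial>N)" if "f \<in> trig_span G" for f
    using that
  proof (induction rule: trig_span.induct)
    case (add f g)
    then show ?case using span_int by simp
  qed (auto intro: eq)
  have R_meas: "h \<in> borel_measurable borel" if "h \<in> R" for h
    using R_cont[OF that] by (rule borel_measurable_continuous_onI)
  have R_eq: "(\<integral>x. h x \<partial>M) = (\<integral>x. h x \<partial>N)" if "h \<in> R" for h
  proof -
    have "complex_of_real (\<integral>x. h x \<partial>M) = complex_of_real (\<integral>x. h x \<partial>N)"
      using span_eq[of "\<lambda>x. complex_of_real (h x)"] that by (simp add: R_def)
    then show ?thesis by simp
  qed
  \<comment> \<open>Testing against every \<open>h \<in> R\<close>, and not only against 1, allows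
    factors to be multiplied in one after another.\<close>
  define ok where "ok \<Phi> \<longleftrightarrow> \<Phi> \<in> borel_measurable borel \<and> (\<exists>b. \<forall>x. \<bar>\<Phi> x\<bar> \<le> b) \<and>
     (\<forall>h\<in>R. (\<integral>x. \<Phi> x * h x \<partial>M) = (\<integral>x. \<Phi> x * h x \<partial>N))" for \<Phi> :: "'z \<Rightarrow> real"
  have ok_one: "ok (\<lambda>_. 1)" unfolding ok_def using R_eq by auto
  have ok_R: "ok (\<lambda>x. \<Phi> x * r x)" if \<Phi>: "ok \<Phi>" and r: "r \<in> R" for \<Phi> r
  proof -
    obtain a b where ab: "\<And>x. \<bar>\<Phi> x\<bar> \<le> a" "\<And>x. \<bar>r x\<bar> \<le> b" using \<Phi> R_bounded[OF r] unfolding ok_def by blast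
    have "\<bar>\<Phi> x * r x\<bar> \<le> a * b" for x
      unfolding abs_mult using ab[of x] by (intro mult_mono) auto
    moreover have "(\<lambda>x. \<Phi> x * r x) \<in> borel_measurable borel"
      using \<Phi> R_meas[OF r] unfolding ok_def by auto
    moreover have "(\<integral>x. \<Phi> x * r x * h x \<partial>M) = (\<integral>x. \<Phi> x * r x * h x \<partial>N)" if "h \<in> R" for h
      using \<Phi> R_mult[OF r that] unfolding ok_def by (simp add: mult.assoc)
    ultimately show ?thesis unfolding ok_def by blast
  qed
  have ok_cont: "ok (\<lambda>x. \<Phi> x * \<phi> (r x))" if \<Phi>: "ok \<Phi>" and r: "r \<in> R" and \<phi>: "continuous_on UNIV \<phi>"
    for \<Phi> r and \<phi> :: "real \<Rightarrow> real"
  proof -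
    obtain a b where ab: "\<And>x. \<bar>\<Phi> x\<bar> \<le> a" "\<And>x. \<bar>r x\<bar> \<le> b" using \<Phi> R_bounded[OF r] unfolding ok_def by blast
    have rb: "r x \<in> {-b..b}" for x using ab(2)[of x] by (auto simp: abs_le_iff)
    have "bounded (\<phi> ` {-b..b})"
      by (intro compact_imp_bounded compact_continuous_image continuous_on_subset[OF \<phi>]) auto
    then obtain d where "\<forall>s\<in>\<phi> ` {-b..b}. norm s \<le> d" unfolding bounded_iff by blast
    then have d: "\<And>t. t \<in> {-b..b} \<Longrightarrow> \<bar>\<phi> t\<bar> \<le> d" by simp
    have bd: "\<bar>\<Phi> x * \<phi> (r x)\<bar> \<le> a * d" for x
      unfolding abs_mult using ab(1)[of x] d[OF rb[of x]] by (intro mult_mono) auto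
    have m\<phi>: "\<phi> \<in> borel_measurable borel" using \<phi> by (rule borel_measurable_continuous_onI)
    have m\<Phi>: "\<Phi> \<in> borel_measurable borel" using \<Phi> unfolding ok_def by blast
    note [measurable] = m\<phi> m\<Phi> R_meas[OF r]
    have "(\<integral>x. \<Phi> x * \<phi> (r x) * h x \<partial>M) = (\<integral>x. \<Phi> x * \<phi> (r x) * h x \<partial>N)" if h: "h \<in> R" for h
    proof -
      obtain e where e: "\<And>x. \<bar>h x\<bar> \<le> e" using R_bounded[OF h] by blast
      note [measurable] = R_meas[OF h]
      have a0: "0 \<le> a" "0 \<le> e" using ab(1)[of undefined] e[of undefined] by linarith+
      \<comment> \<open>Independent of \<open>\<epsilon>\<close>: \<open>a\<close> and
        \<open>e\<close> bound the factors that are not approximated, the rest is total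
        mass.\<close>
      define c where "c = a * e * (measure M (space M) + measure N (space N))"
      have le: "\<bar>(\<integral>x. \<Phi> x * \<phi> (r x) * h x \<partial>M) - (\<integral>x. \<Phi> x * \<phi> (r x) * h x \<partial>N)\<bar> \<le> \<epsilon> * c" if \<epsilon>: "0 < \<epsilon>" for \<epsilon>
      proof -
        obtain p where p: "real_polynomial_function p" "\<And>t. t \<in> {-b..b} \<Longrightarrow> \<bar>\<phi> t - p t\<bar> < \<epsilon>"
          using Stone_Weierstrass_real_polynomial_function[OF _ continuous_on_subset[OF \<phi>] \<epsilon>, of "{-b..b}"] by auto
        have pR: "(\<lambda>x. p (r x)) \<in> R" by (rule R_polynomial[OF p(1) r])
        note [measurable] = R_meas[OF pR]
        obtain q where q: "\<And>x. \<bar>p (r x)\<bar> \<le> q" using R_bounded[OF pR] by blast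
        have b1: "norm (\<Phi> x * \<phi> (r x) * h x) \<le> a * d * e" for x
          unfolding real_norm_def abs_mult[of _ "h x"] using bd[of x] e[of x] by (intro mult_mono) auto
        have b2: "norm (\<Phi> x * p (r x) * h x) \<le> a * q * e" for x
          unfolding real_norm_def abs_mult using ab(1)[of x] q[of x] e[of x] a0 by (intro mult_mono) auto
        have m1: "(\<lambda>x. \<Phi> x * \<phi> (r x) * h x) \<in> borel_measurable borel"
          and m2: "(\<lambda>x. \<Phi> x * p (r x) * h x) \<in> borel_measurable borel" by measurable
        have diff: "norm (\<Phi> x * \<phi> (r x) * h x - \<Phi> x * p (r x) * h x) \<le> a * \<epsilon> * e" for x
        proof -
          have "norm (\<Phi> x * \<phi> (r x) * h x - \<Phi> x * p (r x) * h x) = \<bar>\<Phi> x\<bar> * \<bar>\<phi> (r x) - p (r x)\<bar> * \<bar>h x\<bar>"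
            by (simp add: abs_mult[symmetric] algebra_simps)
          also have "\<dots> \<le> a * \<epsilon> * e" using ab(1)[of x] e[of x] p(2)[OF rb[of x]] a0 by (intro mult_mono) auto
          finally show ?thesis .
        qed
        have close: "\<bar>(\<integral>x. \<Phi> x * \<phi> (r x) * h x \<partial>L) - (\<integral>x. \<Phi> x * p (r x) * h x \<partial>L)\<bar> \<le> a * \<epsilon> * e * measure L (space L)"
          if "integrable L (\<lambda>x. \<Phi> x * \<phi> (r x) * h x)" "integrable L (\<lambda>x. \<Phi> x * p (r x) * h x)" "finite_measure L" for L
        proof -
          interpret L: finite_measure L by fact
          have "\<bar>(\<integral>x. \<Phi> x * \<phi> (r x) * h x - \<Phi> x * p (r x) * h x \<partial>L)\<bar> \<le> (\<integral>x. a * \<epsilon> * e \<partial>L)"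
            unfolding real_norm_def[symmetric]
            by (rule order_trans[OF integral_norm_bound integral_mono]) (use that diff in auto)
          then show ?thesis using that by (simp add: mult_ac)
        qed
        have "(\<integral>x. \<Phi> x * p (r x) * h x \<partial>M) = (\<integral>x. \<Phi> x * p (r x) * h x \<partial>N)"
          using ok_R[OF \<Phi> pR] h unfolding ok_def by blast
        then show ?thesis
          using close[OF int(1)[OF m1 b1] int(1)[OF m2 b2] M(1)] close[OF int(2)[OF m1 b1] int(2)[OF m2 b2] N(1)]
          unfolding c_def by (simp add: algebra_simps)
      qed
      have "\<bar>(\<integral>x. \<Phi> x * \<phi> (r x) * h x \<partial>M) - (\<integral>x. \<Phi> x * \<phi> (r x) * h x \<partial>N)\<bar> \<le> 0"
      proof (rule field_le_epsilon)
        fix e' :: real assume "0 < e'"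
        have c0: "0 \<le> c" unfolding c_def using a0 by simp
        have "\<bar>(\<integral>x. \<Phi> x * \<phi> (r x) * h x \<partial>M) - (\<integral>x. \<Phi> x * \<phi> (r x) * h x \<partial>N)\<bar> \<le> e' / (c + 1) * c"
          using \<open>0 < e'\<close> c0 by (intro le) simp
        also have "\<dots> \<le> 0 + e'" using \<open>0 < e'\<close> c0 by (simp add: divide_le_eq algebra_simps)
        finally show "\<bar>(\<integral>x. \<Phi> x * \<phi> (r x) * h x \<partial>M) - (\<integral>x. \<Phi> x * \<phi> (r x) * h x \<partial>N)\<bar> \<le> 0 + e'" .
      qed
      then show ?thesis by simp
    qed
    moreover have "(\<lambda>x. \<Phi> x * \<phi> (r x)) \<in> borel_measurable borel" by measurable
    ultimately show ?thesis unfolding ok_def using bd by blast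
  qed
  have ok_ind: "ok (\<lambda>x. \<Phi> x * indicator {x. \<delta> \<le> r x} x)" if \<Phi>: "ok \<Phi>" and r: "r \<in> R" for \<Phi> r \<delta>
  proof -
    obtain a where a: "\<And>x. \<bar>\<Phi> x\<bar> \<le> a" using \<Phi> unfolding ok_def by blast
    have m\<Phi>: "\<Phi> \<in> borel_measurable borel" using \<Phi> unfolding ok_def by blast
    note [measurable] = m\<Phi> R_meas[OF r]
    \<comment> \<open>Ramps that equal 1 for \<open>t \<ge> \<delta>\<close> and, once
      \<open>n > 0\<close>, equal 0 below \<open>\<delta> - 1 / n\<close>; their limit is the
      indicator of the closed half-line.\<close>
    define \<phi> where "\<phi> n t = max 0 (min 1 (1 + real n * (t - \<delta>)))" for n t
    have \<phi>c: "continuous_on UNIV (\<phi> n)" for n unfolding \<phi>_def by (intro continuous_intros)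
    have [measurable]: "\<phi> n \<in> borel_measurable borel" for n
      using \<phi>c by (rule borel_measurable_continuous_onI)
    have \<phi>b: "\<bar>\<phi> n t\<bar> \<le> 1" for n t by (auto simp: \<phi>_def)
    have \<phi>l: "(\<lambda>n. \<phi> n t) \<longlonglongrightarrow> (if \<delta> \<le> t then 1 else 0)" for t
    proof (cases "\<delta> \<le> t")
      case True
      then have "\<phi> n t = 1" for n by (auto simp: \<phi>_def max_def min_def)
      then show ?thesis using True by simp
    next
      case False
      then obtain n0 where n0: "1 < real n0 * (\<delta> - t)" using ex_less_of_nat_mult[of "\<delta> - t" 1] by auto
      have "\<phi> n t = 0" if "n0 \<le> n" for n
      proof -
        have "real n0 * (\<delta> - t) \<le> real n * (\<delta> - t)" using that False by (intro mult_right_mono) auto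
        then have "1 + real n * (t - \<delta>) \<le> 0" using n0 by (simp add: algebra_simps)
        then show ?thesis by (simp add: \<phi>_def)
      qed
      then have "(\<lambda>n. \<phi> n t) \<longlonglongrightarrow> 0"
        by (intro tendsto_eventually) (auto simp: eventually_sequentially)
      then show ?thesis using False by simp
    qed
    have [measurable]: "(indicator {x. \<delta> \<le> r x} :: 'z \<Rightarrow> real) \<in> borel_measurable borel" by measurable
    have "(\<integral>x. \<Phi> x * indicator {x. \<delta> \<le> r x} x * h x \<partial>M) = (\<integral>x. \<Phi> x * indicator {x. \<delta> \<le> r x} x * h x \<partial>N)" if h: "h \<in> R" for h
    proof -
      obtain e where e: "\<And>x. \<bar>h x\<bar> \<le> e" using R_bounded[OF h] by blast
      note [measurable] = R_meas[OF h]
      have dc: "(\<lambda>n. \<integral>x. \<Phi> x * \<phi> n (r x) * h x \<partial>L) \<longlonglongrightarrow> (\<integral>x. \<Phi> x * indicator {x. \<delta> \<le> r x} x * h x \<partial>L)"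
        if L: "finite_measure L" "sets L = sets borel" for L
      proof (rule integral_dominated_convergence[where w = "\<lambda>_. a * 1 * e"])
        interpret L: finite_measure L by fact
        show "(\<lambda>x. \<Phi> x * indicator {x. \<delta> \<le> r x} x * h x) \<in> borel_measurable L"
          "\<And>n. (\<lambda>x. \<Phi> x * \<phi> n (r x) * h x) \<in> borel_measurable L"
          unfolding measurable_cong_sets[OF L(2) refl] by measurable
        show "integrable L (\<lambda>_. a * 1 * e)" by simp
        show "AE x in L. (\<lambda>n. \<Phi> x * \<phi> n (r x) * h x) \<longlonglongrightarrow> \<Phi> x * indicator {x. \<delta> \<le> r x} x * h x"
        proof (intro AE_I2 tendsto_intros)
          fix x show "(\<lambda>n. \<phi> n (r x)) \<longlonglongrightarrow> indicator {x. \<delta> \<le> r x} x"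
            using \<phi>l[of "r x"] by (cases "\<delta> \<le> r x") simp_all
        qed
        show "AE x in L. norm (\<Phi> x * \<phi> n (r x) * h x) \<le> a * 1 * e" for n
        proof (intro AE_I2)
          fix x show "norm (\<Phi> x * \<phi> n (r x) * h x) \<le> a * 1 * e"
            unfolding real_norm_def abs_mult using a[of x] \<phi>b[of n "r x"] e[of x] by (intro mult_mono) auto
        qed
      qed
      have "(\<integral>x. \<Phi> x * \<phi> n (r x) * h x \<partial>M) = (\<integral>x. \<Phi> x * \<phi> n (r x) * h x \<partial>N)" for n
        using ok_cont[OF \<Phi> r \<phi>c] h unfolding ok_def by blast
      then show ?thesis using dc[OF M] dc[OF N] by (simp add: LIMSEQ_unique)
    qed
    moreover have "\<bar>\<Phi> x * indicator {x. \<delta> \<le> r x} x\<bar> \<le> a" for x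
      using a[of x] by (auto simp: indicator_def)
    moreover have "(\<lambda>x. \<Phi> x * indicator {x. \<delta> \<le> r x} x) \<in> borel_measurable borel" by measurable
    ultimately show ?thesis unfolding ok_def by blast
  qed
  \<comment> \<open>Requiring that multiplication by the indicator preserve \<open>ok\<close> makes
    \<open>P\<close> closed under intersection, as uniqueness from a generator demands.\<close>
  define P where "P = {A \<in> sets borel. \<forall>\<Phi>. ok \<Phi> \<longrightarrow> ok (\<lambda>x. \<Phi> x * indicator A x)}"
  have P_eq: "emeasure M A = emeasure N A" if "A \<in> P" for A
  proof -
    have "ok (\<lambda>x. 1 * indicator A x)" using that ok_one unfolding P_def by blast
    then have "\<forall>h\<in>R. (\<integral>x. 1 * indicator A x * h x \<partial>M) = (\<integral>x. 1 * indicator A x * h x \<partial>N)"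
      unfolding ok_def by blast
    from bspec[OF this R_const[of 1]] have "measure M A = measure N A"
      using sets_eq_imp_space_eq[OF M(2)] sets_eq_imp_space_eq[OF N(2)] by simp
    moreover have "A \<in> sets M" "A \<in> sets N" using that M(2) N(2) unfolding P_def by auto
    ultimately show ?thesis by (simp add: M.emeasure_eq_measure N.emeasure_eq_measure)
  qed
  have "closed A \<Longrightarrow> A \<in> sigma_sets UNIV P" for A
  proof -
    assume A: "closed A"
    have "A \<inter> K n \<in> sigma_sets UNIV P" for n
    proof -
      have "compact (A \<inter> K n)" using A K(1) by (simp add: closed_Int_compact)
      then obtain \<H> where \<H>: "countable \<H>" "\<H> \<subseteq> {{x. \<delta> \<le> h x} | h \<delta>. h \<in> R}" "A \<inter> K n = \<Inter> \<H>"
        by (rule compact_countable_Inter)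
      have HP: "\<H> \<subseteq> P"
      proof
        fix B assume "B \<in> \<H>"
        then obtain h \<delta> where h: "h \<in> R" "B = {x. \<delta> \<le> h x}" using \<H>(2) by blast
        have "B \<in> sets borel" unfolding h(2)
          by (intro borel_closed closed_Collect_le R_cont[OF h(1)] continuous_intros)
        then show "B \<in> P" unfolding P_def using ok_ind[OF _ h(1), of _ \<delta>] h(2) by blast
      qed
      interpret S: sigma_algebra UNIV "sigma_sets UNIV P" by (rule sigma_algebra_sigma_sets) auto
      show ?thesis
      proof (cases "\<H> = {}")
        case True
        then show ?thesis using \<H>(3) S.top by simp
      next
        case False
        then show ?thesis unfolding \<H>(3) using \<H>(1) HP
          by (intro S.countable_INT'[where A = "\<lambda>x. x" and X = \<H>, simplified]) auto
      qed
    qed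
    then have "(\<Union>n. A \<inter> K n) \<in> sigma_sets UNIV P" by (rule sigma_sets.Union)
    moreover have "(\<Union>n. A \<inter> K n) = A" using K(2) by auto
    ultimately show ?thesis by simp
  qed
  then have "sigma_sets UNIV {A. closed A} \<subseteq> sigma_sets UNIV P"
    by (intro sigma_sets_mono) auto
  moreover have "sigma_sets UNIV P \<subseteq> sets borel"
    using sets.sigma_sets_subset[of P borel] unfolding P_def by auto
  moreover have "sets (borel :: 'z measure) = sigma_sets UNIV {A. closed A}"
    unfolding borel_eq_closed by simp
  ultimately have sig: "sets (borel :: 'z measure) = sigma_sets UNIV P" by auto
  show ?thesis
  proof (rule measure_eqI_generator_eq[where E = P and \<Omega> = UNIV and A = "\<lambda>_. UNIV"])
    show "Int_stable P"
    proof (rule Int_stableI)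
      fix A B assume AB: "A \<in> P" "B \<in> P"
      have "ok (\<lambda>x. \<Phi> x * indicator (A \<inter> B) x)" if "ok \<Phi>" for \<Phi>
      proof -
        have "ok (\<lambda>x. (\<Phi> x * indicator A x) * indicator B x)" using AB that unfolding P_def by blast
        then show ?thesis by (simp add: indicator_inter_arith mult.assoc)
      qed
      then show "A \<inter> B \<in> P" using AB unfolding P_def by auto
    qed
    have "(\<lambda>x. \<Phi> x * indicator UNIV x) = \<Phi>" for \<Phi> :: "'z \<Rightarrow> real" by simp
    then have "UNIV \<in> P" unfolding P_def by simp
    then show "range (\<lambda>_::nat. UNIV) \<subseteq> P" by auto
    show "sets M = sigma_sets UNIV P" "sets N = sigma_sets UNIV P" using M N sig by auto
  qed (use P_eq in auto)
qed

end

section \<open>Exhaustion by compact sets\<close>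

lemma sigma_compact:
  assumes "locally_compact_space (euclidean :: 'a::{second_countable_topology, t2_space} topology)"
  obtains K :: "nat \<Rightarrow> 'a::{second_countable_topology, t2_space} set"
    where "\<And>n. compact (K n)" "(\<Union>n. K n) = UNIV"
proof -
  have "\<forall>x::'a. \<exists>U K. open U \<and> compact K \<and> x \<in> U \<and> U \<subseteq> K"
    using assms unfolding locally_compact_space_def by (simp add: open_openin[symmetric])
  from choice[OF this] obtain U :: "'a \<Rightarrow> 'a set" where
    "\<forall>x. \<exists>K. open (U x) \<and> compact K \<and> x \<in> U x \<and> U x \<subseteq> K" ..
  from choice[OF this] obtain K where "\<forall>x. open (U x) \<and> compact (K x) \<and> x \<in> U x \<and> U x \<subseteq> K x" ..
  then have UK: "open (U x)" "compact (K x)" "x \<in> U x" "U x \<subseteq> K x" for x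
    by simp_all
  have opn: "open S" if "S \<in> range U" for S using that UK(1) by auto
  obtain \<V> where \<V>: "\<V> \<subseteq> range U" "countable \<V>" "\<Union> \<V> = \<Union> (range U)"
    by (rule Lindelof[of "range U", OF opn], assumption, rule that)
  obtain X where X: "countable X" "\<V> = U ` X"
    using \<V>(1,2) countable_subset_image[of \<V> U UNIV] by blast
  have cov: "(\<Union>x\<in>X. K x) = UNIV"
  proof (intro set_eqI iffI UNIV_I)
    fix z
    have "z \<in> \<Union> \<V>" unfolding \<V>(3) using UK(3)[of z] by blast
    then obtain x where "x \<in> X" "z \<in> U x" unfolding X(2) by blast
    then show "z \<in> (\<Union>x\<in>X. K x)" using UK(4)[of x] by blast
  qed
  then have ne: "X \<noteq> {}" by auto
  have "(\<Union>n. K (from_nat_into X n)) = (\<Union>x\<in>range (from_nat_into X). K x)" by simp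
  also have "\<dots> = UNIV" unfolding range_from_nat_into[OF ne X(1)] by (rule cov)
  finally show ?thesis using UK(2) by (intro that[of "\<lambda>n. K (from_nat_into X n)"])
qed

text \<open>\<open>'a \<times> bool\<close> models the disjoint union of two copies of X; this
  instance brings it within the scope of the uniqueness theorem.\<close>

instance bool :: second_countable_topology
proof
  show "\<exists>B::bool set set. countable B \<and> open = generate_topology B"
    by (intro exI[of _ "range lessThan \<union> range greaterThan"]) (auto simp: open_bool_def)
qed

lemma compact_Union_prod:
  fixes A :: "nat \<Rightarrow> 'a::topological_space set" and B :: "nat \<Rightarrow> 'b::topological_space set"
  assumes "\<And>n. compact (A n)" "(\<Union>n. A n) = UNIV" "\<And>n. compact (B n)" "(\<Union>n. B n) = UNIV"
  obtains C :: "nat \<Rightarrow> ('a \<times> 'b) set" where "\<And>n. compact (C n)" "(\<Union>n. C n) = UNIV"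
proof -
  let ?C = "\<lambda>n. A (fst (prod_decode n)) \<times> B (snd (prod_decode n))"
  have "compact (?C n)" for n using assms by (intro compact_Times)
  moreover have "(\<Union>n. ?C n) = UNIV"
  proof (intro set_eqI iffI UNIV_I)
    fix z :: "'a \<times> 'b"
    obtain i j where "fst z \<in> A i" "snd z \<in> B j" using assms(2,4) by blast
    then have "z \<in> ?C (prod_encode (i, j))" by (simp add: mem_Times_iff)
    then show "z \<in> (\<Union>n. ?C n)" by blast
  qed
  ultimately show ?thesis by (rule that)
qed

section \<open>Characters and translates of measures\<close>

lemma characters_mult: "y \<in> characters \<Longrightarrow> z \<in> characters \<Longrightarrow> (\<lambda>x. y x * z x) \<in> characters"
  by (auto simp: characters_def norm_mult intro: continuous_on_mult)

lemma characters_cnj: "y \<in> characters \<Longrightarrow> (\<lambda>x. cnj (y x)) \<in> characters"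
  by (auto simp: characters_def intro: continuous_on_cnj)

lemma characters_one: "(\<lambda>_. 1) \<in> characters"
  by (simp add: characters_def)

lemma characters_zero:
  assumes "y \<in> characters"
  shows "y 0 = 1"
proof -
  have "y (0 + 0) = y 0 * y 0" "cmod (y 0) = 1" using assms unfolding characters_def by blast+
  then show ?thesis by auto
qed

lemma characters_uminus:
  assumes "y \<in> characters"
  shows "y (- x) = cnj (y x)"
proof -
  have 1: "y (x + - x) = y x * y (- x)" "cmod (y x) = 1" using assms unfolding characters_def by blast+
  then have "y x * y (- x) = y x * cnj (y x)"
    using characters_zero[OF assms] complex_norm_square[of "y x"] by simp
  then show ?thesis using 1(2) by auto
qed

lemma characters_diff:
  assumes "y \<in> characters"
  shows "y (x - z) = y x * cnj (y z)"
proof -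
  have "y (x + - z) = y x * y (- z)" using assms unfolding characters_def by blast
  then show ?thesis by (simp add: characters_uminus[OF assms])
qed

lemma characters_comp:
  assumes "y \<in> characters" "continuous_endomorphism c"
  shows "(\<lambda>x. y (c x)) \<in> characters"
  using assms unfolding characters_def continuous_endomorphism_def
  by (auto simp: Modules.additive_def intro: continuous_on_compose2[of UNIV y])

lemma characters_measurable: "y \<in> characters \<Longrightarrow> y \<in> borel_measurable borel"
  unfolding characters_def by (intro borel_measurable_continuous_onI) simp

lemma separating_characters_characters:
  assumes "locally_compact_space (euclidean :: 'a::{topological_ab_group_add, second_countable_topology, t2_space} topology)"
  shows "separating_characters (characters :: ('a::{topological_ab_group_add, second_countable_topology, t2_space} \<Rightarrow> complex) set)"
proof
  fix x x' :: 'a assume "x \<noteq> x'"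
  then have "x - x' \<noteq> 0" by simp
  then obtain y where y: "y \<in> characters" "y (x - x') \<noteq> 1"
    using characters_separate_points[OF assms] by metis
  have "y x \<noteq> y x'"
  proof
    assume "y x = y x'"
    then have "y (x - x') = y (x' - x')" by (simp only: characters_diff[OF y(1)])
    then show False using y(2) characters_zero[OF y(1)] by simp
  qed
  then show "\<exists>g\<in>characters. g x \<noteq> g x'" using y(1) by blast
next
  show "continuous_on UNIV g" "cmod (g x) \<le> 1" if "g \<in> characters" for g :: "'a \<Rightarrow> complex" and x
    using that by (auto simp: characters_def)
qed (auto intro: characters_mult characters_cnj characters_one)

lemma char_fun_cnj: "char_fun \<mu> (\<lambda>x. cnj (y x)) = cnj (char_fun \<mu> y)"
  by (simp add: char_fun_def)

lemma char_fun_distr: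
  assumes "sets \<mu> = sets borel" "c \<in> borel_measurable borel" "y \<in> characters"
  shows "char_fun (distr \<mu> borel c) y = (\<integral>x. y (c x) \<partial>\<mu>)"
  unfolding char_fun_def using assms
  by (intro integral_distr characters_measurable) (simp_all add: measurable_cong_sets[OF assms(1) refl])

lemma integral_pair_mult:
  fixes f g :: "_ \<Rightarrow> complex"
  assumes A: "prob_space A" and B: "prob_space B"
    and f: "f \<in> borel_measurable A" "\<And>x. cmod (f x) \<le> 1" and g: "g \<in> borel_measurable B" "\<And>x. cmod (g x) \<le> 1"
  shows "(\<integral>z. f (fst z) * g (snd z) \<partial>(A \<Otimes>\<^sub>M B)) = (\<integral>x. f x \<partial>A) * (\<integral>x. g x \<partial>B)"
proof -
  interpret A: prob_space A by fact
  interpret B: prob_space B by fact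
  interpret P: pair_prob_space A B ..
  have m: "(\<lambda>z. f (fst z) * g (snd z)) \<in> borel_measurable (A \<Otimes>\<^sub>M B)" using f(1) g(1) by measurable
  have "integrable (A \<Otimes>\<^sub>M B) (\<lambda>z. f (fst z) * g (snd z))"
  proof (rule P.integrable_const_bound[OF _ m])
    show "AE z in A \<Otimes>\<^sub>M B. cmod (f (fst z) * g (snd z)) \<le> 1"
      using f(2) g(2) by (auto simp: norm_mult mult_le_one)
  qed
  then have "integrable (A \<Otimes>\<^sub>M B) (\<lambda>(x, y). f x * g y)" by (simp add: case_prod_unfold)
  from P.integral_fst[OF this]
  show ?thesis by (simp add: case_prod_unfold)
qed

lemma group_convolution_degenerate:
  fixes \<mu> :: "'a::{topological_ab_group_add, second_countable_topology, t2_space} measure"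
  assumes "sets \<mu> = sets borel" "prob_space \<mu>"
  shows "group_convolution \<mu> (degenerate x) = distr \<mu> borel (\<lambda>t. t + x)"
proof -
  interpret prob_space \<mu> by fact
  interpret R: prob_space "return borel x" by (rule prob_space_return) simp
  have add: "(\<lambda>z. fst z + snd z) \<in> borel_measurable (\<mu> \<Otimes>\<^sub>M return borel x)"
  proof -
    have "(\<lambda>z::'a \<times> 'a. fst z + snd z) \<in> borel_measurable (borel \<Otimes>\<^sub>M borel)"
      unfolding borel_prod by (intro borel_measurable_continuous_onI continuous_intros)
    then show ?thesis using assms(1) by (simp cong: measurable_cong_sets sets_pair_measure_cong)
  qed
  have tr: "(\<lambda>t. t + x) \<in> borel_measurable \<mu>"
    unfolding measurable_cong_sets[OF assms(1) refl] by (intro borel_measurable_continuous_onI continuous_intros)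
  show ?thesis
  proof (rule measure_eqI)
    fix S assume "S \<in> sets (group_convolution \<mu> (degenerate x))"
    then have S: "S \<in> sets borel" by (simp add: group_convolution_def)
    let ?T = "(\<lambda>z. fst z + snd z) -` S \<inter> space (\<mu> \<Otimes>\<^sub>M return borel x)"
    have T: "?T \<in> sets (\<mu> \<Otimes>\<^sub>M return borel x)" using add S by (rule measurable_sets)
    have "emeasure (group_convolution \<mu> (degenerate x)) S = emeasure (\<mu> \<Otimes>\<^sub>M return borel x) ?T"
      using emeasure_distr[OF add S] by (simp add: group_convolution_def degenerate_def case_prod_unfold)
    also have "\<dots> = (\<integral>\<^sup>+ t. emeasure (return borel x) (Pair t -` ?T) \<partial>\<mu>)"
      by (rule R.emeasure_pair_measure_alt[OF T])
    also have "\<dots> = (\<integral>\<^sup>+ t. indicator ((\<lambda>t. t + x) -` S \<inter> space \<mu>) t \<partial>\<mu>)"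
    proof (rule nn_integral_cong)
      fix t assume t: "t \<in> space \<mu>"
      have "Pair t -` ?T \<in> sets borel" using sets_Pair1[OF T, of t] by simp
      then show "emeasure (return borel x) (Pair t -` ?T) = indicator ((\<lambda>t. t + x) -` S \<inter> space \<mu>) t"
        using t by (auto simp: indicator_def space_pair_measure)
    qed
    also have "\<dots> = emeasure \<mu> ((\<lambda>t. t + x) -` S \<inter> space \<mu>)"
      using measurable_sets[OF tr S] by (rule nn_integral_indicator)
    also have "\<dots> = emeasure (distr \<mu> borel (\<lambda>t. t + x)) S" by (rule emeasure_distr[OF tr S, symmetric])
    finally show "emeasure (group_convolution \<mu> (degenerate x)) S = emeasure (distr \<mu> borel (\<lambda>t. t + x)) S" .
  qed (simp add: group_convolution_def)
qed

text \<open>The three rules for \<open>F\<close> make the family twisted by \<open>F\<close> on the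
  second copy closed under products and conjugation and bounded by 1, so uniqueness applies to it.
  Once \<open>F\<close> is known to be an evaluation, uniqueness on X itself identifies \<nu> with a
  translate.\<close>

lemma shift_of_multiplier:
  fixes \<mu> \<nu> :: "'a::{topological_ab_group_add, second_countable_topology, t2_space} measure"
  assumes lc: "locally_compact_space (euclidean :: 'a topology)"
    and \<mu>: "prob_space \<mu>" "sets \<mu> = sets borel" and \<nu>: "prob_space \<nu>" "sets \<nu> = sets borel"
    and eq: "\<And>y. y \<in> characters \<Longrightarrow> char_fun \<nu> y = F y * char_fun \<mu> y"
    and mult: "\<And>y z. y \<in> characters \<Longrightarrow> z \<in> characters \<Longrightarrow> F (\<lambda>x. y x * z x) = F y * F z"
    and cnj: "\<And>y. y \<in> characters \<Longrightarrow> F (\<lambda>x. cnj (y x)) = cnj (F y)"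
    and unit: "\<And>y. y \<in> characters \<Longrightarrow> cmod (F y) = 1"
  shows "\<exists>x. \<nu> = distr \<mu> borel (\<lambda>t. t + x)"
proof -
  interpret \<mu>: prob_space \<mu> by fact
  interpret \<nu>: prob_space \<nu> by fact
  interpret C: separating_characters "characters :: ('a \<Rightarrow> complex) set"
    by (rule separating_characters_characters[OF lc])
  obtain K :: "nat \<Rightarrow> 'a set" where K: "\<And>n. compact (K n)" "(\<Union>n. K n) = UNIV"
    using sigma_compact[OF lc] by blast
  have "\<exists>x. \<forall>y\<in>characters. F y = y x"
  proof (rule ccontr)
    assume no: "\<not> (\<exists>x. \<forall>y\<in>characters. F y = y x)"
    define ext where "ext y z = y (fst z) * (if snd z then F y else 1)" for y and z :: "'a \<times> bool"
    have one: "F (\<lambda>_. 1) = 1"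
      using mult[OF characters_one characters_one] unit[OF characters_one] by auto
    interpret D: separating_characters "ext ` characters"
    proof
      fix g assume "g \<in> ext ` characters"
      then obtain y where y: "y \<in> characters" "g = ext y" by blast
      have "continuous_on UNIV y" using y(1) by (simp add: characters_def)
      then show "continuous_on UNIV g"
        unfolding y(2) ext_def
        by (intro continuous_intros continuous_on_compose2[of UNIV y UNIV fst]
            continuous_on_compose2[of UNIV "\<lambda>b. if b then F y else 1" UNIV snd]) auto
      show "cmod (g z) \<le> 1" for z
        using y unit[OF y(1)] by (simp add: ext_def norm_mult characters_def)
      show "(\<lambda>z. cnj (g z)) \<in> ext ` characters"
        by (rule image_eqI[OF _ characters_cnj[OF y(1)]]) (auto simp: y(2) ext_def cnj[OF y(1)])
      fix h assume "h \<in> ext ` characters"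
      then obtain y' where y': "y' \<in> characters" "h = ext y'" by blast
      show "(\<lambda>z. g z * h z) \<in> ext ` characters"
        by (rule image_eqI[OF _ characters_mult[OF y(1) y'(1)]]) (auto simp: y(2) y'(2) ext_def mult[OF y(1) y'(1)])
    next
      show "(\<lambda>_. 1) \<in> ext ` characters"
        by (rule image_eqI[OF _ characters_one]) (auto simp: ext_def one)
    next
      \<comment> \<open>Equality for every \<open>y\<close> would make \<open>F\<close> the
        evaluation at \<open>x - x'\<close>; hence points on different copies are separated.\<close>
      have diff: "\<exists>y\<in>characters. y x \<noteq> y x' * F y" for x x'
      proof -
        obtain y where y: "y \<in> characters" "F y \<noteq> y (x - x')" using no by blast
        have "cnj (y x') * y x' = 1" "cmod (y x') = 1"
          using y(1) by (auto simp: characters_def complex_norm_square[symmetric] mult.commute)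
        then have "y x \<noteq> y x' * F y"
          using y(2) characters_diff[OF y(1), of x x'] by (metis mult.assoc mult.commute mult_1)
        then show ?thesis using y(1) by blast
      qed
      fix z z' :: "'a \<times> bool" assume z: "z \<noteq> z'"
      have same: "\<exists>y\<in>characters. ext y (x, b) \<noteq> ext y (x', b)" if "x \<noteq> x'" for x x' b
      proof -
        obtain y where y: "y \<in> characters" "y x \<noteq> y x'" using C.sep[OF \<open>x \<noteq> x'\<close>] by blast
        have "F y \<noteq> 0" using unit[OF y(1)] by auto
        then show ?thesis using y by (auto simp: ext_def)
      qed
      have other: "\<exists>y\<in>characters. ext y (x, b) \<noteq> ext y (x', b')" if "b \<noteq> b'" for x x' b b'
      proof -
        have "\<exists>y\<in>characters. ext y (x, False) \<noteq> ext y (x', True)" for x x'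
          using diff[of x x'] by (simp add: ext_def)
        then show ?thesis using that by (cases b; cases b') (simp_all, metis)
      qed
      have "\<exists>y\<in>characters. ext y (fst z, snd z) \<noteq> ext y (fst z', snd z')"
      proof (cases "snd z = snd z'")
        case True
        then have "fst z \<noteq> fst z'" using z by (auto simp: prod_eq_iff)
        from same[OF this, of "snd z"] True show ?thesis by simp
      next
        case False
        then show ?thesis by (rule other)
      qed
      then show "\<exists>g\<in>ext ` characters. g z \<noteq> g z'" by simp
    qed
    let ?M = "distr \<nu> borel (\<lambda>x. (x, False))" and ?N = "distr \<mu> borel (\<lambda>x. (x, True))"
    have m: "(\<lambda>x. (x, b)) \<in> borel_measurable \<nu>" "(\<lambda>x. (x, b)) \<in> borel_measurable \<mu>" for b :: bool
      unfolding measurable_cong_sets[OF \<mu>(2) refl] measurable_cong_sets[OF \<nu>(2) refl]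
      by (intro borel_measurable_continuous_onI continuous_intros)+
    obtain L :: "nat \<Rightarrow> ('a \<times> bool) set" where L: "\<And>n. compact (L n)" "(\<Union>n. L n) = UNIV"
      by (rule compact_Union_prod[OF K, of "\<lambda>_. UNIV :: bool set"]) (auto simp: finite_imp_compact)
    have "?M = ?N"
    proof (rule D.measure_eq[OF _ _ _ _ L])
      show "finite_measure ?M" "finite_measure ?N"
        using \<nu>.prob_space_distr[OF m(1)] \<mu>.prob_space_distr[OF m(2)] by (auto simp: prob_space_def)
      fix g assume "g \<in> ext ` characters"
      then obtain y where y: "y \<in> characters" "g = ext y" by blast
      have g: "g \<in> borel_measurable borel"
        using D.cont[OF \<open>g \<in> ext ` characters\<close>] by (rule borel_measurable_continuous_onI)
      have "(\<integral>z. g z \<partial>?M) = char_fun \<nu> y" "(\<integral>z. g z \<partial>?N) = F y * char_fun \<mu> y"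
        unfolding integral_distr[OF m(1) g] integral_distr[OF m(2) g] by (simp_all add: y(2) ext_def char_fun_def)
      then show "(\<integral>z. g z \<partial>?M) = (\<integral>z. g z \<partial>?N)" using eq[OF y(1)] by simp
    qed auto
    moreover have S: "UNIV \<times> {False} \<in> sets (borel :: ('a \<times> bool) measure)"
      by (intro borel_open open_Times open_UNIV discrete_topology_class.open_discrete)
    have "emeasure ?M (UNIV \<times> {False}) = 1" "emeasure ?N (UNIV \<times> {False}) = 0"
      using \<nu>.emeasure_space_1 by (simp_all add: emeasure_distr[OF m(1) S] emeasure_distr[OF m(2) S] vimage_def)
    ultimately show False by simp
  qed
  then obtain x where x: "\<And>y. y \<in> characters \<Longrightarrow> F y = y x" by blast
  have tr: "(\<lambda>t. t + x) \<in> borel_measurable borel"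
    by (intro borel_measurable_continuous_onI continuous_intros)
  have "\<nu> = distr \<mu> borel (\<lambda>t. t + x)"
  proof (rule C.measure_eq[OF _ _ _ _ K])
    show "finite_measure (distr \<mu> borel (\<lambda>t. t + x))"
      using \<mu>.prob_space_distr[of "\<lambda>t. t + x" borel] tr \<mu>(2)
      by (auto simp: prob_space_def cong: measurable_cong_sets)
    fix y :: "'a \<Rightarrow> complex" assume y: "y \<in> characters"
    have "char_fun (distr \<mu> borel (\<lambda>t. t + x)) y = (\<integral>t. y t * y x \<partial>\<mu>)"
      unfolding char_fun_distr[OF \<mu>(2) tr y] using y by (simp add: characters_def)
    also have "\<dots> = char_fun \<nu> y" using eq[OF y] x[OF y] by (simp add: char_fun_def mult.commute)
    finally show "(\<integral>t. y t \<partial>\<nu>) = (\<integral>t. y t \<partial>distr \<mu> borel (\<lambda>t. t + x))"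
      by (simp add: char_fun_def)
  qed (use \<nu> in \<open>auto intro: \<nu>.finite_measure_axioms\<close>)
  then show ?thesis by blast
qed

section \<open>Linear forms\<close>

text \<open>The equation is used only against the test functions in \<open>G\<close>. Once it yields
  \<open>law \<nu> \<mu> = law \<mu> \<nu>\<close>, arbitrary pairs of characters may be integrated,
  and \<open>c\<close> and \<open>d\<close> disappear. Modulus one then follows from
  \<open>F y * cnj (F y) = F (\<lambda>_. 1) = 1\<close>.\<close>

lemma shift_of_injective_equation:
  fixes \<mu> \<nu> :: "'a::{topological_ab_group_add, second_countable_topology, t2_space} measure"
  defines "F \<equiv> \<lambda>y. char_fun \<nu> y / char_fun \<mu> y"
  assumes lc: "locally_compact_space (euclidean :: 'a topology)"
    and \<mu>: "prob_space \<mu>" "sets \<mu> = sets borel" "nonvanishing_char_fun \<mu>"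
    and \<nu>: "prob_space \<nu>" "sets \<nu> = sets borel" "nonvanishing_char_fun \<nu>"
    and c: "continuous_endomorphism c" "inj c" and d: "continuous_endomorphism d" "inj d"
    and eq: "\<And>k l. k \<in> characters \<Longrightarrow> l \<in> characters \<Longrightarrow>
      F (\<lambda>x. k (c x) * l (d x)) = F (\<lambda>x. k (c x)) * F (\<lambda>x. l (d x))"
  shows "\<exists>x. \<nu> = distr \<mu> borel (\<lambda>t. t + x)"
proof -
  interpret \<mu>: prob_space \<mu> by fact
  interpret \<nu>: prob_space \<nu> by fact
  interpret C: separating_characters "characters :: ('a \<Rightarrow> complex) set"
    by (rule separating_characters_characters[OF lc])
  obtain K :: "nat \<Rightarrow> 'a set" where K: "\<And>n. compact (K n)" "(\<Union>n. K n) = UNIV"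
    using sigma_compact[OF lc] by blast
  obtain K2 :: "nat \<Rightarrow> ('a \<times> 'a) set" where K2: "\<And>n. compact (K2 n)" "(\<Union>n. K2 n) = UNIV"
    by (rule compact_Union_prod[OF K K]) (rule that)
  have nz: "char_fun \<mu> y \<noteq> 0" "char_fun \<nu> y \<noteq> 0" if "y \<in> characters" for y
    using \<mu>(3) \<nu>(3) that by (auto simp: nonvanishing_char_fun_def)
  define T where "T z = (fst z + fst (snd z), fst z + snd (snd z))" for z :: "'a \<times> 'a \<times> 'a"
  define law where "law \<alpha> \<beta> = distr (\<alpha> \<Otimes>\<^sub>M (\<beta> \<Otimes>\<^sub>M \<beta>)) borel T" for \<alpha> \<beta>
  have T_meas: "T \<in> borel_measurable (\<alpha> \<Otimes>\<^sub>M (\<beta> \<Otimes>\<^sub>M \<beta>))"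
    if "sets \<alpha> = sets borel" "sets \<beta> = sets borel" for \<alpha> \<beta> :: "'a measure"
  proof -
    have "T \<in> borel_measurable (borel \<Otimes>\<^sub>M (borel \<Otimes>\<^sub>M borel))"
      unfolding borel_prod T_def by (intro borel_measurable_continuous_onI continuous_intros)
    then show ?thesis using that by (simp cong: measurable_cong_sets sets_pair_measure_cong)
  qed
  have pair_meas: "(\<lambda>z. k (fst z) * l (snd z)) \<in> borel_measurable borel"
    if "k \<in> characters" "l \<in> characters" for k l :: "'a \<Rightarrow> complex"
  proof -
    note [measurable] = characters_measurable[OF that(1)] characters_measurable[OF that(2)]
    show ?thesis unfolding borel_prod[symmetric] by measurable
  qed
  have law_prob: "prob_space (law \<alpha> \<beta>)"
    if "prob_space \<alpha>" "sets \<alpha> = sets borel" "prob_space \<beta>" "sets \<beta> = sets borel" for \<alpha> \<beta>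
    unfolding law_def using T_meas that by (intro prob_space.prob_space_distr prob_space_pair)
  have law_int: "(\<integral>z. k (fst z) * l (snd z) \<partial>law \<alpha> \<beta>) =
      char_fun \<alpha> (\<lambda>x. k x * l x) * (char_fun \<beta> k * char_fun \<beta> l)"
    if \<alpha>: "prob_space \<alpha>" "sets \<alpha> = sets borel" and \<beta>: "prob_space \<beta>" "sets \<beta> = sets borel"
      and k: "k \<in> characters" and l: "l \<in> characters" for \<alpha> \<beta> k l
  proof -
    have mk: "k \<in> borel_measurable \<alpha>" "k \<in> borel_measurable \<beta>" "l \<in> borel_measurable \<alpha>" "l \<in> borel_measurable \<beta>"
      unfolding measurable_cong_sets[OF \<alpha>(2) refl] measurable_cong_sets[OF \<beta>(2) refl]
      using k l by (auto intro: characters_measurable)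
    have n1: "cmod (k x) = 1" "cmod (l x) = 1" for x using k l by (auto simp: characters_def)
    have "(\<integral>z. k (fst z) * l (snd z) \<partial>law \<alpha> \<beta>) =
      (\<integral>z. k (fst (T z)) * l (snd (T z)) \<partial>(\<alpha> \<Otimes>\<^sub>M (\<beta> \<Otimes>\<^sub>M \<beta>)))"
      unfolding law_def by (rule integral_distr[OF T_meas[OF \<alpha>(2) \<beta>(2)] pair_meas[OF k l]])
    also have "\<dots> = (\<integral>z. (k (fst z) * l (fst z)) * (k (fst (snd z)) * l (snd (snd z))) \<partial>(\<alpha> \<Otimes>\<^sub>M (\<beta> \<Otimes>\<^sub>M \<beta>)))"
      using k l by (intro Bochner_Integration.integral_cong refl) (simp add: T_def characters_def mult_ac)
    also have "\<dots> = (\<integral>x. k x * l x \<partial>\<alpha>) * (\<integral>w. k (fst w) * l (snd w) \<partial>(\<beta> \<Otimes>\<^sub>M \<beta>))"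
    proof (rule integral_pair_mult[where f = "\<lambda>x. k x * l x" and g = "\<lambda>w. k (fst w) * l (snd w)"])
      show "(\<lambda>x. k x * l x) \<in> borel_measurable \<alpha>" using mk by measurable
      show "(\<lambda>w. k (fst w) * l (snd w)) \<in> borel_measurable (\<beta> \<Otimes>\<^sub>M \<beta>)" using mk by measurable
    qed (auto simp: norm_mult n1 intro: prob_space_pair \<alpha> \<beta>)
    also have "(\<integral>w. k (fst w) * l (snd w) \<partial>(\<beta> \<Otimes>\<^sub>M \<beta>)) = (\<integral>x. k x \<partial>\<beta>) * (\<integral>x. l x \<partial>\<beta>)"
      by (rule integral_pair_mult) (auto simp: n1 intro: \<beta> mk)
    finally show ?thesis by (simp add: char_fun_def)
  qed
  define G where "G = {\<lambda>z. k (c (fst z)) * l (d (snd z)) | k l. k \<in> characters \<and> l \<in> characters}"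
  have ch: "(\<lambda>x. k (c x)) \<in> characters" "(\<lambda>x. k (d x)) \<in> characters" if "k \<in> characters" for k
    by (rule characters_comp[OF that c(1)], rule characters_comp[OF that d(1)])
  interpret D: separating_characters G
  proof
    fix g assume "g \<in> G"
    then obtain k l where g: "k \<in> characters" "l \<in> characters" "g = (\<lambda>z. k (c (fst z)) * l (d (snd z)))"
      unfolding G_def by blast
    have cont: "continuous_on UNIV (\<lambda>x. k (c x))" "continuous_on UNIV (\<lambda>x. l (d x))"
      using ch(1)[OF g(1)] ch(2)[OF g(2)] by (auto simp: characters_def)
    show "continuous_on UNIV g" unfolding g(3)
      by (intro continuous_intros continuous_on_compose2[OF cont(1)] continuous_on_compose2[OF cont(2)]) auto
    show "cmod (g z) \<le> 1" for z using g by (simp add: norm_mult characters_def)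
    show "(\<lambda>z. cnj (g z)) \<in> G" unfolding G_def
      by (intro CollectI exI[of _ "\<lambda>x. cnj (k x)"] exI[of _ "\<lambda>x. cnj (l x)"])
         (simp add: g characters_cnj)
    fix h assume "h \<in> G"
    then obtain k' l' where h: "k' \<in> characters" "l' \<in> characters" "h = (\<lambda>z. k' (c (fst z)) * l' (d (snd z)))"
      unfolding G_def by blast
    show "(\<lambda>z. g z * h z) \<in> G" unfolding G_def
      by (intro CollectI exI[of _ "\<lambda>x. k x * k' x"] exI[of _ "\<lambda>x. l x * l' x"])
         (simp add: g h characters_mult mult_ac)
  next
    show "(\<lambda>_. 1) \<in> G" unfolding G_def
      by (intro CollectI exI[of _ "\<lambda>x. 1"]) (simp add: characters_one)
  next
    fix z z' :: "'a \<times> 'a" assume z: "z \<noteq> z'"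
    show "\<exists>g\<in>G. g z \<noteq> g z'"
    proof (cases "fst z = fst z'")
      case True
      then have "d (snd z) \<noteq> d (snd z')" using z d(2) by (auto simp: prod_eq_iff inj_eq)
      then obtain l where l: "l \<in> characters" "l (d (snd z)) \<noteq> l (d (snd z'))" using C.sep by blast
      have "(\<lambda>z. 1 * l (d (snd z))) \<in> G"
        unfolding G_def using l(1) characters_one by (intro CollectI exI[of _ "\<lambda>_. 1"] exI[of _ l]) simp
      then show ?thesis using l(2) by (intro bexI[of _ "\<lambda>z. 1 * l (d (snd z))"]) auto
    next
      case False
      then have "c (fst z) \<noteq> c (fst z')" using c(2) by (auto simp: inj_eq)
      then obtain k where k: "k \<in> characters" "k (c (fst z)) \<noteq> k (c (fst z'))" using C.sep by blast
      have "(\<lambda>z. k (c (fst z)) * 1) \<in> G"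
        unfolding G_def using k(1) characters_one by (intro CollectI exI[of _ k] exI[of _ "\<lambda>_. 1"]) simp
      then show ?thesis using k(2) by (intro bexI[of _ "\<lambda>z. k (c (fst z)) * 1"]) auto
    qed
  qed
  have laws: "law \<nu> \<mu> = law \<mu> \<nu>"
  proof (rule D.measure_eq[OF _ _ _ _ K2])
    show "finite_measure (law \<nu> \<mu>)" "finite_measure (law \<mu> \<nu>)"
      using law_prob[OF \<nu>(1,2) \<mu>(1,2)] law_prob[OF \<mu>(1,2) \<nu>(1,2)] by (auto simp: prob_space_def)
    show "sets (law \<nu> \<mu>) = sets borel" "sets (law \<mu> \<nu>) = sets borel" by (simp_all add: law_def)
    fix g assume "g \<in> G"
    then obtain k l where g: "k \<in> characters" "l \<in> characters" "g = (\<lambda>z. k (c (fst z)) * l (d (snd z)))"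
      unfolding G_def by blast
    note kl = ch(1)[OF g(1)] ch(2)[OF g(2)]
    show "(\<integral>z. g z \<partial>law \<nu> \<mu>) = (\<integral>z. g z \<partial>law \<mu> \<nu>)"
      using law_int[OF \<nu>(1,2) \<mu>(1,2) kl] law_int[OF \<mu>(1,2) \<nu>(1,2) kl] eq[OF g(1,2)]
        nz(1)[OF kl(1)] nz(1)[OF kl(2)] nz(1)[OF characters_mult[OF kl]]
      unfolding g(3) F_def by (simp add: field_simps)
  qed
  have mult: "F (\<lambda>x. k x * l x) = F k * F l" if "k \<in> characters" "l \<in> characters" for k l
    using law_int[OF \<nu>(1,2) \<mu>(1,2) that] law_int[OF \<mu>(1,2) \<nu>(1,2) that]
      nz(1)[OF that(1)] nz(1)[OF that(2)] nz(1)[OF characters_mult[OF that]]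
    unfolding laws F_def by (simp add: field_simps)
  have cnj: "F (\<lambda>x. cnj (y x)) = cnj (F y)" for y by (simp add: F_def char_fun_cnj)
  have unit: "cmod (F y) = 1" if y: "y \<in> characters" for y
  proof -
    have "(\<lambda>x. y x * cnj (y x)) = (\<lambda>_. 1)"
      using y by (auto simp: characters_def complex_norm_square[symmetric])
    moreover have "F (\<lambda>_. 1) = 1"
      using \<mu>.prob_space \<nu>.prob_space by (simp add: F_def char_fun_def)
    ultimately have "F y * cnj (F y) = 1"
      using mult[OF y characters_cnj[OF y]] cnj by simp
    then have "(cmod (F y))\<^sup>2 = 1"
      using complex_norm_square[of "F y"] by (metis of_real_eq_1_iff)
    then show ?thesis by (simp add: power2_eq_1_iff) (smt (verit) norm_ge_zero)
  qed
  show ?thesis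
  proof (rule shift_of_multiplier[OF lc \<mu>(1,2) \<nu>(1,2) _ mult cnj unit])
    show "char_fun \<nu> y = F y * char_fun \<mu> y" if "y \<in> characters" for y
      using nz(1)[OF that] by (simp add: F_def)
  qed
qed

text \<open>The coefficients \<open>a j\<close> stay general so that both hypotheses of the theorem
  are instances: identities in (I), and \<open>a 3 = 0\<close> in (II).\<close>

lemma char_fun_linear_forms:
  fixes P :: "'p measure" and \<xi> :: "nat \<Rightarrow> 'p \<Rightarrow> 'a::{topological_ab_group_add, second_countable_topology, t2_space}"
  assumes P: "prob_space P" and ind: "prob_space.indep_vars P (\<lambda>_. borel) \<xi> {1, 2, 3}"
    and a: "\<And>j. j \<in> {1, 2, 3} \<Longrightarrow> continuous_endomorphism (a j)"
    and b: "\<And>j. j \<in> {1, 2, 3} \<Longrightarrow> continuous_endomorphism (b j)"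
    and L1: "L1 = (\<lambda>\<omega>. a 1 (\<xi> 1 \<omega>) + a 2 (\<xi> 2 \<omega>) + a 3 (\<xi> 3 \<omega>))"
    and L2: "L2 = (\<lambda>\<omega>. b 1 (\<xi> 1 \<omega>) + b 2 (\<xi> 2 \<omega>) + b 3 (\<xi> 3 \<omega>))"
    and u: "u \<in> characters" and v: "v \<in> characters"
  shows "(\<integral>z. u (fst z) * v (snd z) \<partial>distr P borel (\<lambda>\<omega>. (L1 \<omega>, L2 \<omega>))) =
    (\<Prod>j\<in>{1, 2, 3}. char_fun (distr P borel (\<xi> j)) (\<lambda>x. u (a j x) * v (b j x)))"
proof -
  interpret prob_space P by fact
  have \<xi>: "\<xi> j \<in> borel_measurable P" if "j \<in> {1, 2, 3}" for j
    using ind that unfolding indep_vars_def by blast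
  have form: "(\<lambda>\<omega>. f 1 (\<xi> 1 \<omega>) + f 2 (\<xi> 2 \<omega>) + f 3 (\<xi> 3 \<omega>)) \<in> borel_measurable P"
    if "\<And>j. j \<in> {1, 2, 3} \<Longrightarrow> continuous_endomorphism (f j)" for f :: "nat \<Rightarrow> 'a \<Rightarrow> 'a"
  proof -
    have f: "(\<lambda>\<omega>. f j (\<xi> j \<omega>)) \<in> borel_measurable P" if "j \<in> {1, 2, 3}" for j
      using \<xi>[OF that] \<open>j \<in> {1, 2, 3} \<Longrightarrow> continuous_endomorphism (f j)\<close>[OF that]
      by (auto simp: continuous_endomorphism_def intro: measurable_compose borel_measurable_continuous_onI)
    have add: "(\<lambda>z::'a \<times> 'a. fst z + snd z) \<in> borel_measurable borel"
      by (intro borel_measurable_continuous_onI continuous_intros)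
    have plus: "(\<lambda>\<omega>. g \<omega> + h \<omega>) \<in> borel_measurable P"
      if "g \<in> borel_measurable P" "h \<in> borel_measurable P" for g h :: "'p \<Rightarrow> 'a"
      using measurable_compose[OF borel_measurable_Pair[OF that] add] by simp
    show ?thesis using f by (intro plus) auto
  qed
  have LL: "(\<lambda>\<omega>. (L1 \<omega>, L2 \<omega>)) \<in> borel_measurable P"
    unfolding L1 L2 by (intro borel_measurable_Pair form a b)
  note [measurable] = characters_measurable[OF u] characters_measurable[OF v]
  have uv: "(\<lambda>z. u (fst z) * v (snd z)) \<in> borel_measurable borel"
    unfolding borel_prod[symmetric] by measurable
  define y where "y j x = u (a j x) * v (b j x)" for j x
  have y: "y j \<in> characters" if "j \<in> {1, 2, 3}" for j
    unfolding y_def by (rule characters_mult[OF characters_comp[OF u a[OF that]] characters_comp[OF v b[OF that]]])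
  have ym: "y j \<in> borel_measurable borel" if "j \<in> {1, 2, 3}" for j
    by (rule characters_measurable[OF y[OF that]])
  have indy: "indep_vars (\<lambda>_. borel) (\<lambda>j \<omega>. y j (\<xi> j \<omega>)) {1, 2, 3}"
    by (rule indep_vars_compose2[OF ind]) (rule ym)
  have inty: "integrable P (\<lambda>\<omega>. y j (\<xi> j \<omega>))" if "j \<in> {1, 2, 3}" for j
  proof (rule integrable_const_bound[of _ 1])
    show "(\<lambda>\<omega>. y j (\<xi> j \<omega>)) \<in> borel_measurable P" by (rule measurable_compose[OF \<xi>[OF that] ym[OF that]])
    show "AE \<omega> in P. cmod (y j (\<xi> j \<omega>)) \<le> 1" using y[OF that] by (simp add: characters_def)
  qed
  have "(\<integral>z. u (fst z) * v (snd z) \<partial>distr P borel (\<lambda>\<omega>. (L1 \<omega>, L2 \<omega>))) = (\<integral>\<omega>. u (L1 \<omega>) * v (L2 \<omega>) \<partial>P)"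
    using integral_distr[OF LL uv] by simp
  also have "\<dots> = (\<integral>\<omega>. (\<Prod>j\<in>{1, 2, 3}. y j (\<xi> j \<omega>)) \<partial>P)"
    using u v unfolding L1 L2 y_def
    by (intro Bochner_Integration.integral_cong refl) (simp add: characters_def mult_ac)
  also have "\<dots> = (\<Prod>j\<in>{1, 2, 3}. \<integral>\<omega>. y j (\<xi> j \<omega>) \<partial>P)"
    using inty by (intro indep_vars_lebesgue_integral[OF _ indy]) auto
  also have "\<dots> = (\<Prod>j\<in>{1, 2, 3}. char_fun (distr P borel (\<xi> j)) (y j))"
  proof (rule prod.cong[OF refl])
    fix j :: nat assume j: "j \<in> {1, 2, 3}"
    show "(\<integral>\<omega>. y j (\<xi> j \<omega>) \<partial>P) = char_fun (distr P borel (\<xi> j)) (y j)"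
      unfolding char_fun_def by (rule integral_distr[OF \<xi>[OF j] ym[OF j], symmetric])
  qed
  finally show ?thesis unfolding y_def .
qed

lemma continuous_endomorphism_diff:
  fixes f g :: "'a::topological_ab_group_add \<Rightarrow> 'a"
  assumes "continuous_endomorphism f" "continuous_endomorphism g"
  shows "continuous_endomorphism (\<lambda>x. f x - g x)"
  using assms by (auto simp: continuous_endomorphism_def Modules.additive_def intro: continuous_on_diff)

lemma inj_of_kernel:
  assumes "continuous_endomorphism f" "group_kernel f = {0}"
  shows "inj f"
proof (rule injI)
  fix x y assume "f x = f y"
  have "f (x - y) = f x - f y"
    using assms(1) by (auto simp: continuous_endomorphism_def intro: Modules.additive.diff)
  then have "x - y \<in> group_kernel f" using \<open>f x = f y\<close> by (simp add: group_kernel_def)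
  then show "x = y" using assms(2) by simp
qed

text \<open>Along direction \<open>m\<close> the \<open>m\<close>-th factor of the functional equation is constant;
  \<open>d i m\<close> is the resulting increment in the \<open>i\<close>-th factor.\<close>

lemma shifts_of_linear_forms:
  fixes P :: "'p measure" and Q :: "'q measure"
    and \<xi> :: "nat \<Rightarrow> 'p \<Rightarrow> 'a::{topological_ab_group_add, second_countable_topology, t2_space}"
    and \<eta> :: "nat \<Rightarrow> 'q \<Rightarrow> 'a"
    and a b :: "nat \<Rightarrow> 'a \<Rightarrow> 'a" and d :: "nat \<Rightarrow> nat \<Rightarrow> 'a \<Rightarrow> 'a"
  assumes lc: "locally_compact_space (euclidean :: 'a topology)"
    and P: "prob_space P" "prob_space.indep_vars P (\<lambda>_. borel) \<xi> {1, 2, 3}"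
      "\<And>j. j \<in> {1, 2, 3} \<Longrightarrow> nonvanishing_char_fun (distr P borel (\<xi> j))"
    and Q: "prob_space Q" "prob_space.indep_vars Q (\<lambda>_. borel) \<eta> {1, 2, 3}"
      "\<And>j. j \<in> {1, 2, 3} \<Longrightarrow> nonvanishing_char_fun (distr Q borel (\<eta> j))"
    and a: "\<And>j. j \<in> {1, 2, 3} \<Longrightarrow> continuous_endomorphism (a j)"
    and b: "\<And>j. j \<in> {1, 2, 3} \<Longrightarrow> continuous_endomorphism (b j)"
    and L: "L1 = (\<lambda>\<omega>. a 1 (\<xi> 1 \<omega>) + a 2 (\<xi> 2 \<omega>) + a 3 (\<xi> 3 \<omega>))"
      "L2 = (\<lambda>\<omega>. b 1 (\<xi> 1 \<omega>) + b 2 (\<xi> 2 \<omega>) + b 3 (\<xi> 3 \<omega>))"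
    and M: "M1 = (\<lambda>\<omega>. a 1 (\<eta> 1 \<omega>) + a 2 (\<eta> 2 \<omega>) + a 3 (\<eta> 3 \<omega>))"
      "M2 = (\<lambda>\<omega>. b 1 (\<eta> 1 \<omega>) + b 2 (\<eta> 2 \<omega>) + b 3 (\<eta> 3 \<omega>))"
    and eq: "distr P borel (\<lambda>\<omega>. (L1 \<omega>, L2 \<omega>)) = distr Q borel (\<lambda>\<omega>. (M1 \<omega>, M2 \<omega>))"
    and dir: "\<And>m k. m \<in> {1, 2, 3} \<Longrightarrow> k \<in> characters \<Longrightarrow> \<exists>u\<in>characters. \<exists>v\<in>characters.
      \<forall>i\<in>{1, 2, 3}. \<forall>x. u (a i x) * v (b i x) = k (d i m x)"
    and d0: "\<And>m x. m \<in> {1, 2, 3} \<Longrightarrow> d m m x = 0"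
    and d: "\<And>i m. i \<in> {1, 2, 3} \<Longrightarrow> m \<in> {1, 2, 3} \<Longrightarrow> i \<noteq> m \<Longrightarrow> continuous_endomorphism (d i m) \<and> inj (d i m)"
    and j: "j \<in> {1, 2, 3 :: nat}"
  shows "\<exists>x. distr Q borel (\<eta> j) = group_convolution (distr P borel (\<xi> j)) (degenerate x)"
proof -
  interpret P: prob_space P by fact
  interpret Q: prob_space Q by fact
  have meas: "\<xi> j \<in> borel_measurable P" "\<eta> j \<in> borel_measurable Q" if "j \<in> {1, 2, 3}" for j
    using P(2) Q(2) that unfolding P.indep_vars_def Q.indep_vars_def by blast+
  have prob: "prob_space (distr P borel (\<xi> j))" "prob_space (distr Q borel (\<eta> j))" if "j \<in> {1, 2, 3}" for j
    using meas[OF that] by (auto intro: P.prob_space_distr Q.prob_space_distr)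
  define F where "F i y = char_fun (distr Q borel (\<eta> i)) y / char_fun (distr P borel (\<xi> i)) y" for i y
  have F1: "F i (\<lambda>_. 1) = 1" if "i \<in> {1, 2, 3}" for i
    using prob_space.prob_space[OF prob(1)[OF that]] prob_space.prob_space[OF prob(2)[OF that]]
    by (simp add: F_def char_fun_def)
  have d_one: "(\<lambda>x. k (d m m x)) = (\<lambda>_. 1)" if "m \<in> {1, 2, 3}" "k \<in> characters" for m k
    using d0[OF that(1)] characters_zero[OF that(2)] by simp
  have prod: "(\<Prod>i\<in>{1, 2, 3}. F i (\<lambda>x. k (d i m x) * l (d i n x))) = 1"
    if mn: "m \<in> {1, 2, 3}" "n \<in> {1, 2, 3}" and k: "k \<in> characters" and l: "l \<in> characters" for m n k l
  proof -
    obtain u v where uv: "u \<in> characters" "v \<in> characters" "\<And>i x. i \<in> {1, 2, 3} \<Longrightarrow> u (a i x) * v (b i x) = k (d i m x)"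
      using dir[OF mn(1) k] by blast
    obtain u' v' where uv': "u' \<in> characters" "v' \<in> characters" "\<And>i x. i \<in> {1, 2, 3} \<Longrightarrow> u' (a i x) * v' (b i x) = l (d i n x)"
      using dir[OF mn(2) l] by blast
    \<comment> \<open>The product of a direction belonging to \<open>m\<close> and one belonging to
      \<open>n\<close>; both increments appear in the i-th factor.\<close>
    define y where "y i x = k (d i m x) * l (d i n x)" for i x
    have y: "(\<lambda>x. (u (a i x) * u' (a i x)) * (v (b i x) * v' (b i x))) = y i" if "i \<in> {1, 2, 3}" for i
      unfolding y_def uv(3)[OF that, symmetric] uv'(3)[OF that, symmetric] by (simp add: mult_ac)
    have ych: "y i \<in> characters" if "i \<in> {1, 2, 3}" for i
      unfolding y[OF that, symmetric]
      by (intro characters_mult[of "\<lambda>x. u (a i x) * u' (a i x)" "\<lambda>x. v (b i x) * v' (b i x)"]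
          characters_mult[OF characters_comp[OF uv(1) a[OF that]] characters_comp[OF uv'(1) a[OF that]]]
          characters_mult[OF characters_comp[OF uv(2) b[OF that]] characters_comp[OF uv'(2) b[OF that]]])
    have e1: "(\<Prod>i\<in>{1, 2, 3}. char_fun (distr P borel (\<xi> i)) (y i)) = (\<Prod>i\<in>{1, 2, 3}. char_fun (distr Q borel (\<eta> i)) (y i))"
      using char_fun_linear_forms[OF P(1,2) a b L characters_mult[OF uv(1) uv'(1)] characters_mult[OF uv(2) uv'(2)]]
        char_fun_linear_forms[OF Q(1,2) a b M characters_mult[OF uv(1) uv'(1)] characters_mult[OF uv(2) uv'(2)]]
      unfolding eq by (simp add: y)
    have "char_fun (distr P borel (\<xi> i)) (y i) \<noteq> 0" if "i \<in> {1, 2, 3}" for i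
      using P(3)[OF that] ych[OF that] by (simp add: nonvanishing_char_fun_def)
    then have e2: "(\<Prod>i\<in>{1, 2, 3}. char_fun (distr P borel (\<xi> i)) (y i)) \<noteq> 0" by simp
    have "(\<Prod>i\<in>{1, 2, 3}. F i (y i)) = 1"
      unfolding F_def prod_dividef e1[symmetric] by (rule divide_self[OF e2])
    then show ?thesis unfolding y_def .
  qed
  obtain m n where mn: "m \<in> {1, 2, 3}" "n \<in> {1, 2, 3}" "j \<noteq> m" "j \<noteq> n" "m \<noteq> n" "{1, 2, 3} = {j, m, n}"
  proof -
    consider "j = 1" | "j = 2" | "j = 3" using j by auto
    then show ?thesis by cases (rule that[of 2 3], auto, rule that[of 1 3], auto, rule that[of 1 2], auto)
  qed
  \<comment> \<open>\<open>d m m\<close> and \<open>d n n\<close> vanish, so the m-th factor sees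
    only \<open>l\<close> and the n-th only \<open>k\<close>.\<close>
  have prod3: "F j (\<lambda>x. k (d j m x) * l (d j n x)) * (F m (\<lambda>x. l (d m n x)) * F n (\<lambda>x. k (d n m x))) = 1"
    if "k \<in> characters" "l \<in> characters" for k l
    using prod[OF mn(1,2) that] d0[OF mn(1)] d0[OF mn(2)] characters_zero[OF that(1)] characters_zero[OF that(2)]
    unfolding mn(6) using mn(3,4,5) by simp
  have mult: "F j (\<lambda>x. k (d j m x) * l (d j n x)) = F j (\<lambda>x. k (d j m x)) * F j (\<lambda>x. l (d j n x))"
    if k: "k \<in> characters" and l: "l \<in> characters" for k l
  proof -
    \<comment> \<open>These two factors depend on one character each and are eliminated by
      comparison with the cases \<open>l = 1\<close> and \<open>k = 1\<close>.\<close>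
    define p q where "p = F n (\<lambda>x. k (d n m x))" and "q = F m (\<lambda>x. l (d m n x))"
    have cancel: "A = B * C" if "A * (q * p) = 1" "B * p = 1" "C * q = 1" for A B C
    proof -
      have "A = A * ((B * p) * (C * q))" using that by simp
      also have "\<dots> = (A * (q * p)) * (B * C)" by (simp only: mult_ac)
      finally show ?thesis using that by simp
    qed
    show ?thesis
    proof (rule cancel)
      show "F j (\<lambda>x. k (d j m x) * l (d j n x)) * (q * p) = 1"
        using prod3[OF k l] by (simp add: p_def q_def)
      show "F j (\<lambda>x. k (d j m x)) * p = 1"
        using prod3[OF k characters_one] F1[OF mn(1)] by (simp add: p_def)
      show "F j (\<lambda>x. l (d j n x)) * q = 1"
        using prod3[OF characters_one l] F1[OF mn(2)] by (simp add: q_def)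
    qed
  qed
  have "\<exists>x. distr Q borel (\<eta> j) = distr (distr P borel (\<xi> j)) borel (\<lambda>t. t + x)"
    using d[OF j mn(1) mn(3)] d[OF j mn(2) mn(4)] mult prob[OF j] P(3)[OF j] Q(3)[OF j]
    unfolding F_def by (intro shift_of_injective_equation[OF lc, of _ _ "d j m" "d j n"]) auto
  then show ?thesis using group_convolution_degenerate[OF _ prob(1)[OF j]] by simp
qed

theorem theorem1:
  fixes P :: "'p measure" and Q :: "'q measure"
    and \<xi> :: "nat \<Rightarrow> 'p \<Rightarrow> 'a::{topological_ab_group_add, second_countable_topology, t2_space}"
    and \<eta> :: "nat \<Rightarrow> 'q \<Rightarrow> 'a"
    and b :: "nat \<Rightarrow> 'a \<Rightarrow> 'a"
    and L1 L2 :: "'p \<Rightarrow> 'a" and M1 M2 :: "'q \<Rightarrow> 'a"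
  assumes "locally_compact_space (euclidean :: 'a topology)"
    and "\<And>j. j \<in> {1, 2, 3} \<Longrightarrow> continuous_endomorphism (b j)"
    and "prob_space P"
    and "prob_space.indep_vars P (\<lambda>_. borel) \<xi> {1, 2, 3}"
    and "\<And>j. j \<in> {1, 2, 3} \<Longrightarrow> nonvanishing_char_fun (distr P borel (\<xi> j))"
    and "prob_space Q"
    and "prob_space.indep_vars Q (\<lambda>_. borel) \<eta> {1, 2, 3}"
    and "\<And>j. j \<in> {1, 2, 3} \<Longrightarrow> nonvanishing_char_fun (distr Q borel (\<eta> j))"
    and "L2 = (\<lambda>\<omega>. b 1 (\<xi> 1 \<omega>) + b 2 (\<xi> 2 \<omega>) + b 3 (\<xi> 3 \<omega>))"
    and "M2 = (\<lambda>\<omega>. b 1 (\<eta> 1 \<omega>) + b 2 (\<eta> 2 \<omega>) + b 3 (\<eta> 3 \<omega>))"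
    and "(L1 = (\<lambda>\<omega>. \<xi> 1 \<omega> + \<xi> 2 \<omega> + \<xi> 3 \<omega>) \<and>
          M1 = (\<lambda>\<omega>. \<eta> 1 \<omega> + \<eta> 2 \<omega> + \<eta> 3 \<omega>) \<and>
          group_kernel (\<lambda>x. b 1 x - b 2 x) = {0} \<and>
          group_kernel (\<lambda>x. b 1 x - b 3 x) = {0} \<and>
          group_kernel (\<lambda>x. b 2 x - b 3 x) = {0})
       \<or> (L1 = (\<lambda>\<omega>. \<xi> 1 \<omega> + \<xi> 2 \<omega>) \<and>
          M1 = (\<lambda>\<omega>. \<eta> 1 \<omega> + \<eta> 2 \<omega>) \<and>
          group_kernel (\<lambda>x. b 1 x - b 2 x) = {0} \<and>
          group_kernel (b 3) = {0})"
    and "distr P borel (\<lambda>\<omega>. (L1 \<omega>, L2 \<omega>)) = distr Q borel (\<lambda>\<omega>. (M1 \<omega>, M2 \<omega>))"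
  shows "\<forall>j\<in>{1, 2, 3}. \<exists>x. distr Q borel (\<eta> j) =
           group_convolution (distr P borel (\<xi> j)) (degenerate x)"
proof
  note lc = assms(1) and b = assms(2) and P = assms(3-5) and Q = assms(6-8) and L2 = assms(9) and M2 = assms(10)
  fix j :: nat assume j: "j \<in> {1, 2, 3}"
  have bd: "continuous_endomorphism (\<lambda>x. b i x - b m x)" if "i \<in> {1, 2, 3}" "m \<in> {1, 2, 3}" for i m
    using that b by (intro continuous_endomorphism_diff)
  have inj: "inj (\<lambda>x. b i x - b m x)"
    if "i \<in> {1, 2, 3}" "m \<in> {1, 2, 3}" "group_kernel (\<lambda>x. b i x - b m x) = {0} \<or> group_kernel (\<lambda>x. b m x - b i x) = {0}" for i m
  proof (rule inj_of_kernel[OF bd[OF that(1,2)]])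
    have "group_kernel (\<lambda>x. b i x - b m x) = group_kernel (\<lambda>x. b m x - b i x)"
      by (auto simp: group_kernel_def)
    then show "group_kernel (\<lambda>x. b i x - b m x) = {0}" using that(3) by auto
  qed
  have cid: "continuous_endomorphism (\<lambda>x::'a. x)" and c0: "continuous_endomorphism (\<lambda>_::'a. 0)"
    by (auto simp: continuous_endomorphism_def Modules.additive_def)
  have bm: "(\<lambda>x. cnj (k (b m x))) \<in> characters" if "k \<in> characters" "m \<in> {1, 2, 3}" for k m
    by (rule characters_cnj[OF characters_comp[OF that(1) b[OF that(2)]]])
  have b0: "b m 0 = 0" if "m \<in> {1, 2, 3}" for m
    using b[OF that] by (auto simp: continuous_endomorphism_def intro: Modules.additive.zero)
  show "\<exists>x. distr Q borel (\<eta> j) = group_convolution (distr P borel (\<xi> j)) (degenerate x)"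
    using assms(11)
  proof (elim disjE conjE)
    assume L1: "L1 = (\<lambda>\<omega>. \<xi> 1 \<omega> + \<xi> 2 \<omega> + \<xi> 3 \<omega>)" and M1: "M1 = (\<lambda>\<omega>. \<eta> 1 \<omega> + \<eta> 2 \<omega> + \<eta> 3 \<omega>)"
      and ker: "group_kernel (\<lambda>x. b 1 x - b 2 x) = {0}" "group_kernel (\<lambda>x. b 1 x - b 3 x) = {0}"
          "group_kernel (\<lambda>x. b 2 x - b 3 x) = {0}"
    show ?thesis
    proof (rule shifts_of_linear_forms[where a = "\<lambda>_ x. x" and d = "\<lambda>i m x. b i x - b m x",
          OF lc P Q cid b L1 L2 M1 M2 assms(12) _ _ _ j])
      fix m :: nat and k :: "'a \<Rightarrow> complex" assume m: "m \<in> {1, 2, 3}" and k: "k \<in> characters"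
      \<comment> \<open>With \<open>v = k\<close> and \<open>u\<close> the conjugate of
        \<open>k\<close> composed with \<open>b m\<close>, the i-th factor becomes
        \<open>k (b i x - b m x)\<close>, trivial for \<open>i = m\<close>.\<close>
      show "\<exists>u\<in>characters. \<exists>v\<in>characters. \<forall>i\<in>{1, 2, 3}. \<forall>x. u x * v (b i x) = k (b i x - b m x)"
        by (rule bexI[OF _ bm[OF k m]], rule bexI[OF _ k]) (simp add: characters_diff[OF k] mult.commute)
    next
      fix i m :: nat assume "i \<in> {1, 2, 3}" "m \<in> {1, 2, 3}" "i \<noteq> m"
      then show "continuous_endomorphism (\<lambda>x. b i x - b m x) \<and> inj (\<lambda>x. b i x - b m x)"
        using ker by (intro conjI bd inj) auto
    qed auto
  next
    assume L1: "L1 = (\<lambda>\<omega>. \<xi> 1 \<omega> + \<xi> 2 \<omega>)" and M1: "M1 = (\<lambda>\<omega>. \<eta> 1 \<omega> + \<eta> 2 \<omega>)"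
      and ker: "group_kernel (\<lambda>x. b 1 x - b 2 x) = {0}" "group_kernel (b 3) = {0}"
    define a where "a i x = (if i = 3 then 0 else x)" for i :: nat and x :: 'a
    \<comment> \<open>Direction 3 is \<open>u = k\<close>, \<open>v = 1\<close>, with increments
      \<open>a i\<close>. Directions 1 and 2 are chosen as in case (I), but their third factor has
      increment \<open>b 3\<close> because \<open>a 3\<close> is zero.\<close>
    define d where "d i m x = (if m = 3 then a i x else if i = 3 then b 3 x else b i x - b m x)"
      for i m :: nat and x
    have a: "continuous_endomorphism (a i)" for i
    proof -
      have "a i = (if i = 3 then (\<lambda>_. 0) else (\<lambda>x. x))" by (auto simp: a_def)
      then show ?thesis using cid c0 by simp
    qed
    have L1': "L1 = (\<lambda>\<omega>. a 1 (\<xi> 1 \<omega>) + a 2 (\<xi> 2 \<omega>) + a 3 (\<xi> 3 \<omega>))"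
      and M1': "M1 = (\<lambda>\<omega>. a 1 (\<eta> 1 \<omega>) + a 2 (\<eta> 2 \<omega>) + a 3 (\<eta> 3 \<omega>))"
      unfolding L1 M1 a_def by simp_all
    show ?thesis
    proof (rule shifts_of_linear_forms[where d = d, OF lc P Q a b L1' L2 M1' M2 assms(12) _ _ _ j])
      fix m :: nat and k :: "'a \<Rightarrow> complex" assume m: "m \<in> {1, 2, 3}" and k: "k \<in> characters"
      show "\<exists>u\<in>characters. \<exists>v\<in>characters. \<forall>i\<in>{1, 2, 3}. \<forall>x. u (a i x) * v (b i x) = k (d i m x)"
      proof (cases "m = 3")
        case True
        show ?thesis
          by (rule bexI[OF _ k], rule bexI[OF _ characters_one]) (simp add: d_def True)
      next
        case False
        show ?thesis
          by (rule bexI[OF _ bm[OF k m]], rule bexI[OF _ k])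
             (use False in \<open>auto simp: d_def a_def characters_diff[OF k] characters_zero[OF k] b0[OF m] mult.commute\<close>)
      qed
    next
      fix i m :: nat assume im: "i \<in> {1, 2, 3}" "m \<in> {1, 2, 3}" "i \<noteq> m"
      consider "m = 3" | "m \<noteq> 3" "i = 3" | "m \<noteq> 3" "i \<noteq> 3" by blast
      then show "continuous_endomorphism (d i m) \<and> inj (d i m)"
      proof cases
        case 1
        then have "d i m = (\<lambda>x. x)" using im by (auto simp: d_def a_def)
        then show ?thesis using cid by simp
      next
        case 2
        then have "d i m = b 3" by (auto simp: d_def)
        then show ?thesis using b[of 3] inj_of_kernel[OF b ker(2)] by simp
      next
        case 3
        then have "d i m = (\<lambda>x. b i x - b m x)" by (auto simp: d_def)
        moreover have "inj (\<lambda>x. b i x - b m x)" using im 3 ker by (intro inj) auto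
        ultimately show ?thesis using bd[OF im(1,2)] by simp
      qed
    qed (auto simp: d_def a_def)
  qed
qed

end
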